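(* Let $Y(t)$, $t\ge 0$, be a critical Markov branching process with non-homogeneous Poisson immigration, with offspring p.g.f. $f(s)=s+(1-s)^{\gamma+1}L(1/(1-s))$, $s\in[0,1)$, $\gamma\in(0,1]$, immigrant p.g.f. $g(s)=1-(1-s)^{\alpha}l(1/(1-s))$, $\alpha\in(0,1]$, and Poisson intensity $r(t)=t^{-\theta}L_R(t)$, where $L,l,L_R$ are slowly varying at infinity. Assume that $\theta=1$ and $\alpha=\gamma$, that $R(t)\uparrow R\le\infty$ and $Q(t)\uparrow\infty$ as $t\to\infty$, and that $$\frac{r(t)Q(t)}{q(t)R(t)}\to d\in[0,\infty),\qquad t\to\infty .$$ Then for every $x>0$ $$\mathbf{P}\{Y(t)/W(\mu t)\le x\mid Y(t)>0\}\to D_{\gamma,d}(x),\qquad t\to\infty,$$ where $D_{\gamma,d}$ is the distribution function on $[0,\infty)$ with Laplace transform $$\int_0^\infty e^{-\lambda x}\,\mathrm{d}D_{\gamma,d}(x)=\frac{d}{1+d}+\frac{1}{1+d}\cdot\frac{1}{1+\lambda^{\gamma}},\qquad \lambda>0 .$$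
   Context: Model. In a Markov branching process each particle, independently of all others, lives an exponentially distributed time with parameter $\mu>0$ and at its death produces a random number $\xi\ge 0$ of new particles of the same type; $f(s)=\mathbf{E}[s^{\xi}]$ is the offspring p.g.f. Let $Z(t)$ be the number of particles at time $t$ and $F(t;s)=\mathbf{E}[s^{Z(t)}\mid Z(0)=1]$, so $\partial F(t;s)/\partial t=\mu[f(F(t;s))-F(t;s)]$, $F(0;s)=s$. Let $\nu(t)$ be a non-homogeneous Poisson process with intensity $r(t)$, mean measure $R(t)=\int_0^t r(u)\,du$ (finite for each $t$), and jump points $0=S_0<S_1<S_2<\cdots$. At each $S_k$, $k\ge1$, $I_k$ new particles immigrate, where $I_1,I_2,\dots$ are i.i.d. non-negative integer-valued with p.g.f. $g(s)=\mathbf{E}[s^{I_k}]$. The Markov branching process with non-homogeneous Poisson immigration is $$Y(t)=\sum_{k=1}^{\nu(t)}\sum_{j=1}^{I_k}Z^{(k,j)}(t-S_k),\qquad t\ge 0,$$ where $Z^{(k,j)}$ are i.i.d. copies of $Z$ started from one particle; the processes $Z^{(k,j)}$, the variables $I_k$ and the Poisson process $\nu$ are independent. Notation. $q(t;s)=1-g(F(t;s))$, $q(t)=q(t;0)$, $Q(t)=\int_0^t q(u)\,du$. $V(x)=\int_0^{1-1/x}\frac{du}{f(u)-u}=\int_1^x\frac{u^{\gamma-1}}{L(u)}\,du$ for $x\ge1$, which is increasing from $[1,\infty)$ onto $[0,\infty)$, and $W:[0,\infty)\to[1,\infty)$ is the inverse function of $V$. *)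

theory Defs
  imports "HOL-Probability.Probability"
begin

text \<open>
  Slow variation is an asymptotic notion: measurability and positivity are required only on a
  neighbourhood of infinity.
\<close>
definition slowly_varying :: "(real \<Rightarrow> real) \<Rightarrow> bool" where
  "slowly_varying L \<longleftrightarrow>
     (\<exists>a. set_borel_measurable borel {a..} L \<and> (\<forall>x\<ge>a. 0 < L x)) \<and>
     (\<forall>c>0. ((\<lambda>x. L (c * x) / L x) \<longlongrightarrow> 1) at_top)"

definition pgf :: "nat pmf \<Rightarrow> real \<Rightarrow> real" where
  "pgf p s = measure_pmf.expectation p (\<lambda>n. s ^ n)"

text \<open>
  A family tree attaches to every potential individual its life length and its number of children.
  Individuals carry Ulam-Harris labels: \<open>[]\<close> is the ancestor, born at time 0, and \<open>u @ [i]\<close> is the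
  child number \<open>i\<close> (counted from 0) of \<open>u\<close>, which really is born only if \<open>i\<close> is smaller than the
  number of children of \<open>u\<close>.  All children of \<open>u\<close> are born at the death of \<open>u\<close>.
\<close>
type_synonym family_tree = "nat list \<Rightarrow> real \<times> nat"

definition ever_born :: "family_tree \<Rightarrow> nat list \<Rightarrow> bool" where
  "ever_born \<tau> u \<longleftrightarrow> (\<forall>i<length u. u ! i < snd (\<tau> (take i u)))"

definition birth_time :: "family_tree \<Rightarrow> nat list \<Rightarrow> real" where
  "birth_time \<tau> u = (\<Sum>i<length u. fst (\<tau> (take i u)))"

text \<open>
  The number of particles alive at time \<open>t\<close>.  The convention \<open>card A = 0\<close> for infinite \<open>A\<close> matters
  only if the population explodes, which for a critical process has probability 0.
\<close>
definition population :: "family_tree \<Rightarrow> real \<Rightarrow> nat" where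
  "population \<tau> t =
     card {u. ever_born \<tau> u \<and> birth_time \<tau> u \<le> t \<and> t < birth_time \<tau> u + fst (\<tau> u)}"

text \<open>
  The law of the family tree of one particle: all life lengths and offspring numbers are independent,
  exponential with parameter \<open>\<mu>\<close> and of law \<open>p\<close> respectively.  Under it \<open>population\<close> is the Markov
  branching process \<open>Z\<close> with \<open>Z 0 = 1\<close>.
\<close>
definition tree_law :: "real \<Rightarrow> nat pmf \<Rightarrow> family_tree measure" where
  "tree_law \<mu> p =
     Pi\<^sub>M UNIV (\<lambda>_. density lborel (exponential_density \<mu>) \<Otimes>\<^sub>M measure_pmf p)"

definition bp_F :: "real \<Rightarrow> nat pmf \<Rightarrow> real \<Rightarrow> real \<Rightarrow> real" where
  "bp_F \<mu> p t s = (\<integral>\<tau>. s ^ population \<tau> t \<partial>tree_law \<mu> p)"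

definition bp_q :: "real \<Rightarrow> nat pmf \<Rightarrow> nat pmf \<Rightarrow> real \<Rightarrow> real \<Rightarrow> real" where
  "bp_q \<mu> p h t s = 1 - pgf h (bp_F \<mu> p t s)"

definition bp_Q :: "real \<Rightarrow> nat pmf \<Rightarrow> nat pmf \<Rightarrow> real \<Rightarrow> real" where
  "bp_Q \<mu> p h t = (LBINT u:{0..t}. bp_q \<mu> p h u 0)"

definition bp_V :: "nat pmf \<Rightarrow> real \<Rightarrow> real" where
  "bp_V p x = (LBINT u:{0..1 - 1 / x}. 1 / (pgf p u - u))"

definition bp_W :: "nat pmf \<Rightarrow> real \<Rightarrow> real" where
  "bp_W p = inv_into {1..} (bp_V p)"

definition mean_measure :: "(real \<Rightarrow> real) \<Rightarrow> real \<Rightarrow> real" where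
  "mean_measure r t = (LBINT u:{0..t}. r u)"

text \<open>
  Independence of the increments is stated for infinite sequences of times; this covers finitely many
  times, because a finite sequence can be continued constantly.  The formula for the law of an increment
  also makes sense when its mean is 0 (\<open>poisson_pmf\<close> does not).  The value \<open>r 0\<close> is irrelevant.
\<close>
locale nonhomogeneous_poisson_process = prob_space M
  for M :: "'a measure" and r :: "real \<Rightarrow> real" and \<nu> :: "real \<Rightarrow> 'a \<Rightarrow> nat" +
  assumes intensity_nonneg: "0 < t \<Longrightarrow> 0 \<le> r t"
    and intensity_integrable: "0 \<le> t \<Longrightarrow> set_integrable lborel {0..t} r"
    and count_measurable: "0 \<le> t \<Longrightarrow> \<nu> t \<in> measurable M (count_space UNIV)"
    and count_0: "\<omega> \<in> space M \<Longrightarrow> \<nu> 0 \<omega> = 0"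
    and count_mono: "\<omega> \<in> space M \<Longrightarrow> mono_on {0..} (\<lambda>t. \<nu> t \<omega>)"
    and count_right_continuous:
      "\<omega> \<in> space M \<Longrightarrow> 0 \<le> t \<Longrightarrow> continuous (at_right t) (\<lambda>u. real (\<nu> u \<omega>))"
    and count_increments_indep:
      "mono t' \<Longrightarrow> 0 \<le> t' 0 \<Longrightarrow>
         indep_vars (\<lambda>_. count_space UNIV) (\<lambda>i \<omega>. \<nu> (t' (Suc i)) \<omega> - \<nu> (t' i) \<omega>) (UNIV :: nat set)"
    and count_increments_poisson:
      "0 \<le> s \<Longrightarrow> s \<le> t \<Longrightarrow>
         \<P>(\<omega> in M. \<nu> t \<omega> - \<nu> s \<omega> = n) =
           (mean_measure r t - mean_measure r s) ^ n / fact n *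
             exp (- (mean_measure r t - mean_measure r s))"

text \<open>The \<open>k\<close>-th jump point \<open>S\<^sub>k\<close>; it is used only when at least \<open>k\<close> jumps occur.\<close>
definition jump_time :: "(real \<Rightarrow> 'a \<Rightarrow> nat) \<Rightarrow> nat \<Rightarrow> 'a \<Rightarrow> real" where
  "jump_time \<nu> k \<omega> = Inf {t. 0 \<le> t \<and> k \<le> \<nu> t \<omega>}"

text \<open>
  The independent sources of randomness: the family tree of the \<open>j\<close>-th member of the \<open>k\<close>-th group of
  immigrants, the size of the \<open>k\<close>-th group, and the whole process of arrivals.
\<close>
datatype source = Tree nat nat | Group nat | Arrivals

locale bp_poisson_immigration = nonhomogeneous_poisson_process M r \<nu>
  for M :: "'a measure" and r :: "real \<Rightarrow> real" and \<nu> :: "real \<Rightarrow> 'a \<Rightarrow> nat" +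
  fixes \<mu> :: real
    and p h :: "nat pmf"
    and \<tau> :: "nat \<Rightarrow> nat \<Rightarrow> 'a \<Rightarrow> family_tree"
    and I :: "nat \<Rightarrow> 'a \<Rightarrow> nat"
  assumes \<mu>_pos: "0 < \<mu>"
    and tree_measurable: "\<tau> k j \<in> measurable M (tree_law \<mu> p)"
    and tree_distr: "distr M (tree_law \<mu> p) (\<tau> k j) = tree_law \<mu> p"
    and group_measurable: "I k \<in> measurable M (count_space UNIV)"
    and group_distr: "distr M (count_space UNIV) (I k) = measure_pmf h"
    and sources_indep:
      "indep_sets
         (\<lambda>src. case src of
            Tree k j \<Rightarrow> {\<tau> k j -` A \<inter> space M |A. A \<in> sets (tree_law \<mu> p)}
          | Group k \<Rightarrow> {I k -` A \<inter> space M |A. A \<in> UNIV}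
          | Arrivals \<Rightarrow> sigma_sets (space M) {\<nu> t -` A \<inter> space M |t A. 0 \<le> t})
         UNIV"

definition bp_Y ::
  "(real \<Rightarrow> 'a \<Rightarrow> nat) \<Rightarrow> (nat \<Rightarrow> 'a \<Rightarrow> nat) \<Rightarrow> (nat \<Rightarrow> nat \<Rightarrow> 'a \<Rightarrow> family_tree) \<Rightarrow> real \<Rightarrow> 'a \<Rightarrow> nat" where
  "bp_Y \<nu> I \<tau> t \<omega> =
     (\<Sum>k = 1..\<nu> t \<omega>. \<Sum>j = 1..I k \<omega>. population (\<tau> k j \<omega>) (t - jump_time \<nu> k \<omega>))"

definition critical_offspring :: "nat pmf \<Rightarrow> bool" where
  "critical_offspring p \<longleftrightarrow>
     integrable (measure_pmf p) real \<and> measure_pmf.expectation p real = 1"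

text \<open>\<open>N\<close> is the probability law on \<open>[0,\<infinity>)\<close> whose distribution function \<open>cdf N\<close> is \<open>D\<^sub>\<gamma>\<^sub>,\<^sub>d\<close>.\<close>
definition limit_law :: "real \<Rightarrow> real \<Rightarrow> real measure \<Rightarrow> bool" where
  "limit_law \<gamma> d N \<longleftrightarrow>
     real_distribution N \<and> measure N {..<0} = 0 \<and>
     (\<forall>y>0. (\<integral>x. exp (- y * x) \<partial>N) = d / (1 + d) + 1 / (1 + d) * (1 / (1 + y powr \<gamma>)))"

end

theory Submission
  imports Defs
begin

text \<open>
  Write \<open>P(t)\<close> for the probability that a family started by one particle is alive at time \<open>t\<close>, and
  \<open>f\<close>, \<open>g\<close> for the generating functions of the offspring and of the immigrant groups.

  Cutting the family tree at the death of the ancestor (\<open>distr_graft\<close>, \<open>bp_F_first_death\<close>) gives an integral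
  equation for \<open>F(t;s)\<close>, hence \<open>F' = \<mu>(f(F) - F)\<close>.  Separating variables, \<open>G(F(t;s)) = G(s) + \<mu>t\<close> with
  \<open>G(y) = \<integral>\<^sub>0\<^sup>y du/(f(u) - u)\<close> (\<open>G_F\<close>).  So the argument \<open>s\<close> acts as a time shift,
  \<open>F(t;s) = F(t + G(s)/\<mu>; 0)\<close>, everything is a function of \<open>P\<close>, and \<open>W(\<mu>t) = 1/P(t)\<close>.  With
  \<open>q(t) = 1 - g(1 - P(t))\<close> the Poisson arrivals yield (\<open>expectation_bp_Y_power\<close>)
  \<open>E s^Y(t) = exp(-J(c,t))\<close>, where \<open>J(c,t) = \<integral>\<^sub>0\<^sup>t r(u) q(t - u + c) du\<close> and \<open>c = G(s)/\<mu>\<close>.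

  The Laplace transform at \<open>\<lambda>\<close> of \<open>Y(t)/W(\<mu>t)\<close> given \<open>Y(t) > 0\<close> is therefore
  \<open>1 - (1 - exp(-J(c,t))) / (1 - exp(-J(0,t)))\<close> with \<open>s = exp(-\<lambda>P(t))\<close>.  Regular variation of \<open>P\<close> with index
  \<open>-1/\<gamma>\<close> makes the delay \<open>c\<close> asymptotically \<open>\<lambda>\<^sup>-\<^sup>\<gamma> t\<close> (\<open>delay_ratio\<close>), and because \<open>\<alpha> = \<gamma>\<close> the function \<open>q\<close> has
  index \<open>-1\<close>.  As \<open>\<theta> = 1\<close>, \<open>r\<close> has index \<open>-1\<close> as well, so both \<open>R\<close> and \<open>Q\<close> vary slowly and the convolution
  \<open>J(0,t)\<close> is concentrated at its two ends: arrivals near time \<open>0\<close> contribute \<open>q(t)R(t)\<close>, arrivals near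
  time \<open>t\<close> contribute \<open>r(t)Q(t) ~ d q(t)R(t)\<close> (\<open>J_0_asymp\<close>).  The delay moves the argument of \<open>q\<close> away from \<open>0\<close>,
  so only the early arrivals remain and \<open>J(c,t) ~ q(t)R(t)/(1 + \<lambda>\<^sup>-\<^sup>\<gamma>)\<close> (\<open>J_delayed_asymp\<close>).  Since
  \<open>q(t)R(t)\<close> tends to \<open>0\<close>, the transforms converge to \<open>1 - \<lambda>\<^sup>\<gamma> / ((1 + d)(1 + \<lambda>\<^sup>\<gamma>))\<close>.  The atom of the limit at the
  origin comes from the late arrivals: their families are alive but too young to be of order \<open>W(\<mu>t)\<close>.

  A continuity theorem for Laplace transforms (\<open>laplace_continuity\<close>) turns this into weak convergence; it also
  produces the limit law, so no explicit density is needed.  That the limit has no atom at any \<open>x > 0\<close>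
  (\<open>limit_law_no_atom\<close>) follows from the self-decomposability of the Mittag-Leffler law.
\<close>

section \<open>The law of a family tree\<close>

text \<open>
  Inverse to cutting a tree at its root.  Subtrees hang below all natural numbers, also where no child is born,
  so that below a random root they can be an i.i.d. sequence.
\<close>
definition graft :: "'b \<times> (nat \<Rightarrow> nat list \<Rightarrow> 'b) \<Rightarrow> nat list \<Rightarrow> 'b" where
  "graft x u = (case u of [] \<Rightarrow> fst x | i # v \<Rightarrow> snd x i v)"

lemma graft_simps [simp]: "graft x [] = fst x" "graft x (i # v) = snd x i v"
  by (simp_all add: graft_def)

lemma measurable_graft [measurable]:
  "graft \<in> D \<Otimes>\<^sub>M Pi\<^sub>M UNIV (\<lambda>_. Pi\<^sub>M UNIV (\<lambda>_. D)) \<rightarrow>\<^sub>M Pi\<^sub>M UNIV (\<lambda>_. D)"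
proof (rule measurable_PiM_single')
  fix u :: "nat list"
  show "(\<lambda>x. graft x u) \<in> D \<Otimes>\<^sub>M Pi\<^sub>M UNIV (\<lambda>_. Pi\<^sub>M UNIV (\<lambda>_. D)) \<rightarrow>\<^sub>M D"
  proof (cases u)
    case (Cons i v)
    have "(\<lambda>x. snd x i) \<in> D \<Otimes>\<^sub>M Pi\<^sub>M UNIV (\<lambda>_. Pi\<^sub>M UNIV (\<lambda>_. D)) \<rightarrow>\<^sub>M Pi\<^sub>M (UNIV :: nat list set) (\<lambda>_. D)"
      by (rule measurable_compose[OF measurable_snd measurable_component_singleton]) simp
    from measurable_compose[OF this measurable_component_singleton[of v]] show ?thesis
      by (simp add: Cons)
  qed simp
qed (auto simp: graft_def space_pair_measure space_PiM PiE_iff split: list.split)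

text \<open>
  The label set consists of the root and of one copy of itself for every natural number.  Hence i.i.d. marks
  are the same thing as an independent mark at the root and i.i.d. families of marks below it; on finite
  cylinders, which determine the measure, both laws are products over the same labels.
\<close>
lemma distr_graft:
  fixes D :: "'b measure"
  assumes "prob_space D"
  shows "distr (D \<Otimes>\<^sub>M Pi\<^sub>M UNIV (\<lambda>_. Pi\<^sub>M UNIV (\<lambda>_. D))) (Pi\<^sub>M UNIV (\<lambda>_. D)) graft = Pi\<^sub>M UNIV (\<lambda>_. D)"
proof -
  let ?T = "Pi\<^sub>M (UNIV :: nat list set) (\<lambda>_. D)"
  let ?S = "Pi\<^sub>M (UNIV :: nat set) (\<lambda>_. ?T)"
  interpret D: prob_space D by fact
  interpret T: product_prob_space "\<lambda>_. D" "UNIV :: nat list set" ..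
  have TT: "prob_space ?T" by (intro prob_space_PiM assms)
  interpret S: product_prob_space "\<lambda>_. ?T" "UNIV :: nat set"
    by (intro product_prob_spaceI TT)
  have SS: "prob_space ?S" by (intro prob_space_PiM TT)
  show ?thesis
  proof (rule T.PiM_eq)
    fix J :: "nat list set" and F assume J: "finite J" and F: "\<And>u. u \<in> J \<Longrightarrow> F u \<in> sets D"
    \<comment> \<open>The cylinder is split according to the first letter of its labels; \<open>Ji i\<close> are the labels below child \<open>i\<close>.\<close>
    define K where "K = hd ` (J - {[]})"
    define Ji where "Ji i = {v. i # v \<in> J}" for i
    define A where "A = (if [] \<in> J then F [] else space D)"
    define C where "C i = {\<tau> \<in> space ?T. \<forall>v\<in>Ji i. \<tau> v \<in> F (i # v)}" for i
    define B where "B = {\<sigma> \<in> space ?S. \<forall>i\<in>K. \<sigma> i \<in> C i}"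
    have K: "finite K" using J by (simp add: K_def)
    have Ji: "finite (Ji i)" for i
      using finite_vimageI[OF J, of "(#) i"] by (simp add: Ji_def vimage_def)
    have emb: "prod_emb UNIV (\<lambda>_. D) J (\<Pi>\<^sub>E u\<in>J. F u) = {\<tau> \<in> space ?T. \<forall>u\<in>J. \<tau> u \<in> F u}"
      by (auto simp: prod_emb_def space_PiM)
    have Jsplit: "J - {[]} = (\<lambda>(i, v). i # v) ` (Sigma K Ji)"
    proof (intro set_eqI iffI)
      fix u assume "u \<in> J - {[]}"
      then show "u \<in> (\<lambda>(i, v). i # v) ` (Sigma K Ji)"
      proof (cases u)
        case (Cons i v)
        then have "i \<in> K" using \<open>u \<in> J - {[]}\<close> by (force simp: K_def)
        then show ?thesis using \<open>u \<in> J - {[]}\<close> Cons by (intro image_eqI[of _ _ "(i, v)"]) (auto simp: Ji_def)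
      qed (use \<open>u \<in> J - {[]}\<close> in simp)
    qed (auto simp: Ji_def)
    have vim: "graft -` prod_emb UNIV (\<lambda>_. D) J (\<Pi>\<^sub>E u\<in>J. F u) \<inter> space (D \<Otimes>\<^sub>M ?S) = A \<times> B"
    proof -
      have eq: "(\<forall>u\<in>J. graft x u \<in> F u) \<longleftrightarrow> fst x \<in> A \<and> snd x \<in> B"
        if x: "x \<in> space D \<times> space ?S" for x
      proof -
        have "(\<forall>u\<in>J. graft x u \<in> F u) \<longleftrightarrow>
            ([] \<in> J \<longrightarrow> fst x \<in> F []) \<and> (\<forall>u\<in>J - {[]}. graft x u \<in> F u)"
          unfolding graft_simps(1)[symmetric] by blast
        also have "(\<forall>u\<in>J - {[]}. graft x u \<in> F u) \<longleftrightarrow> (\<forall>i\<in>K. \<forall>v\<in>Ji i. snd x i v \<in> F (i # v))"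
          unfolding Jsplit by auto
        finally show ?thesis using x
          by (auto simp: A_def B_def C_def space_PiM PiE_iff)
      qed
      have sub: "A \<times> B \<subseteq> space D \<times> space ?S"
        using F sets.sets_into_space[OF F] by (auto simp: A_def B_def)
      have gr: "graft x \<in> space ?T" if "x \<in> space D \<times> space ?S" for x
        using measurable_space[OF measurable_graft, of x] that by (simp add: space_pair_measure)
      show ?thesis
      proof (rule set_eqI)
        fix x
        show "x \<in> graft -` prod_emb UNIV (\<lambda>_. D) J (\<Pi>\<^sub>E u\<in>J. F u) \<inter> space (D \<Otimes>\<^sub>M ?S) \<longleftrightarrow> x \<in> A \<times> B"
        proof (cases "x \<in> space D \<times> space ?S")
          case True
          then show ?thesis
            using eq[OF True] gr[OF True] by (simp add: emb space_pair_measure mem_Times_iff)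
        next
          case False
          then show ?thesis using sub by (auto simp only: space_pair_measure Int_iff)
        qed
      qed
    qed
    have C[measurable]: "C i \<in> sets ?T" for i
      unfolding C_def using F Ji by (intro sets.sets_Collect_finite_All) (auto simp: Ji_def)
    have A[measurable]: "A \<in> sets D" using F by (auto simp: A_def)
    have B[measurable]: "B \<in> sets ?S"
      unfolding B_def using K C by (intro sets.sets_Collect_finite_All) auto
    have "emeasure (distr (D \<Otimes>\<^sub>M ?S) ?T graft) (prod_emb UNIV (\<lambda>_. D) J (\<Pi>\<^sub>E u\<in>J. F u))
        = emeasure (D \<Otimes>\<^sub>M ?S) (A \<times> B)"
      using J F by (subst emeasure_distr) (auto simp: vim intro!: sets_PiM_I)
    also have "\<dots> = emeasure D A * emeasure ?S B"
      by (rule sigma_finite_measure.emeasure_pair_measure_Times) (auto intro: prob_space_imp_sigma_finite SS)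
    also have "emeasure ?S B = (\<Prod>i\<in>K. emeasure ?T (C i))"
      unfolding B_def by (rule S.emeasure_PiM_Collect) (auto simp: K)
    also have "\<dots> = (\<Prod>i\<in>K. \<Prod>v\<in>Ji i. emeasure D (F (i # v)))"
      unfolding C_def by (intro prod.cong refl T.emeasure_PiM_Collect) (auto simp: Ji, auto simp: Ji_def F)
    also have "\<dots> = (\<Prod>(i, v)\<in>Sigma K Ji. emeasure D (F (i # v)))"
      by (rule prod.Sigma) (auto simp: K Ji)
    also have "\<dots> = (\<Prod>u\<in>J - {[]}. emeasure D (F u))"
      unfolding Jsplit by (subst prod.reindex) (auto simp: inj_on_def case_prod_beta)
    also have "emeasure D A * \<dots> = (\<Prod>u\<in>J. emeasure D (F u))"
      using J by (cases "[] \<in> J") (simp_all add: A_def prod.remove D.emeasure_space_1)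
    finally show "emeasure (distr (D \<Otimes>\<^sub>M ?S) ?T graft) (prod_emb UNIV (\<lambda>_. D) J (\<Pi>\<^sub>E u\<in>J. F u))
        = (\<Prod>u\<in>J. emeasure D (F u))" .
  qed simp
qed

definition root_law :: "real \<Rightarrow> nat pmf \<Rightarrow> (real \<times> nat) measure" where
  "root_law \<mu> p = density lborel (exponential_density \<mu>) \<Otimes>\<^sub>M measure_pmf p"

lemma tree_law_eq: "tree_law \<mu> p = Pi\<^sub>M UNIV (\<lambda>_. root_law \<mu> p)"
  by (simp add: tree_law_def root_law_def)

lemma sets_root_law [measurable_cong]: "sets (root_law \<mu> p) = sets (borel \<Otimes>\<^sub>M count_space UNIV)"
  unfolding root_law_def by (intro sets_pair_measure_cong) auto

lemma sets_tree_law [measurable_cong]: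
  "sets (tree_law \<mu> p) = sets (Pi\<^sub>M UNIV (\<lambda>_. borel \<Otimes>\<^sub>M count_space UNIV))"
  unfolding tree_law_eq by (intro sets_PiM_cong refl sets_root_law)

lemma space_tree_law [simp]: "space (tree_law \<mu> p) = UNIV"
  using sets_eq_imp_space_eq[OF sets_tree_law] by (simp add: space_PiM space_pair_measure)

lemma prob_space_root_law: "0 < \<mu> \<Longrightarrow> prob_space (root_law \<mu> p)"
  unfolding root_law_def
  by (intro prob_space_pair prob_space_exponential_density measure_pmf.prob_space_axioms)

lemma prob_space_tree_law: "0 < \<mu> \<Longrightarrow> prob_space (tree_law \<mu> p)"
  unfolding tree_law_eq by (intro prob_space_PiM prob_space_root_law)

lemma measurable_life_length [measurable]: "(\<lambda>\<tau>. fst (\<tau> u)) \<in> borel_measurable (tree_law \<mu> p)"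
  unfolding measurable_cong_sets[OF sets_tree_law refl]
  by (rule measurable_compose[OF measurable_component_singleton[of u] measurable_fst]) simp

lemma measurable_offspring [measurable]: "(\<lambda>\<tau>. snd (\<tau> u)) \<in> tree_law \<mu> p \<rightarrow>\<^sub>M count_space UNIV"
  unfolding measurable_cong_sets[OF sets_tree_law refl]
  by (rule measurable_compose[OF measurable_component_singleton[of u] measurable_snd]) simp

lemma measurable_birth_time [measurable]: "(\<lambda>\<tau>. birth_time \<tau> u) \<in> borel_measurable (tree_law \<mu> p)"
  unfolding birth_time_def by measurable

lemma measurable_ever_born [measurable]: "Measurable.pred (tree_law \<mu> p) (\<lambda>\<tau>. ever_born \<tau> u)"
  unfolding ever_born_def by measurable

lemma ever_born_graft [simp]:
  "ever_born (graft x) []"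
  "ever_born (graft x) (i # v) \<longleftrightarrow> i < snd (fst x) \<and> ever_born (snd x i) v"
  by (auto simp: ever_born_def All_less_Suc2)

lemma birth_time_graft [simp]:
  "birth_time (graft x) [] = 0"
  "birth_time (graft x) (i # v) = fst (fst x) + birth_time (snd x i) v"
  by (simp_all add: birth_time_def sum.lessThan_Suc_shift del: sum.lessThan_Suc)

definition alive :: "family_tree \<Rightarrow> real \<Rightarrow> nat list set" where
  "alive \<tau> t = {u. ever_born \<tau> u \<and> birth_time \<tau> u \<le> t \<and> t < birth_time \<tau> u + fst (\<tau> u)}"

text \<open>
  Cutting off at a generation gives the recursion over generations by which the mean population is bounded.
\<close>
definition alive_upto :: "nat \<Rightarrow> family_tree \<Rightarrow> real \<Rightarrow> nat list set" where
  "alive_upto n \<tau> t = alive \<tau> t \<inter> {u. length u < n}"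

lemma population_alive: "population \<tau> t = card (alive \<tau> t)"
  by (simp add: population_def alive_def)

lemma Nil_alive_graft: "[] \<in> alive (graft x) t \<longleftrightarrow> 0 \<le> t \<and> t < fst (fst x)"
  by (simp add: alive_def)

lemma Cons_alive_graft:
  "i # v \<in> alive (graft x) t \<longleftrightarrow> i < snd (fst x) \<and> v \<in> alive (snd x i) (t - fst (fst x))"
  by (auto simp: alive_def)

lemma alive_graft:
  "alive (graft x) t = (if 0 \<le> t \<and> t < fst (fst x) then {[]} else {}) \<union>
     (\<Union>i<snd (fst x). (#) i ` alive (snd x i) (t - fst (fst x)))" (is "?L = ?R")
proof (rule set_eqI)
  fix u show "u \<in> ?L \<longleftrightarrow> u \<in> ?R"
    by (cases u) (auto simp: Nil_alive_graft Cons_alive_graft)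
qed

lemma alive_upto_graft:
  "alive_upto (Suc n) (graft x) t = (if 0 \<le> t \<and> t < fst (fst x) then {[]} else {}) \<union>
     (\<Union>i<snd (fst x). (#) i ` alive_upto n (snd x i) (t - fst (fst x)))" (is "?L = ?R")
proof (rule set_eqI)
  fix u show "u \<in> ?L \<longleftrightarrow> u \<in> ?R"
    by (cases u) (auto simp: alive_upto_def Nil_alive_graft Cons_alive_graft)
qed

text \<open>
  Counting with values in \<open>ennreal\<close> stays additive and monotone as long as finiteness is not known; \<open>card\<close> does not.
\<close>
abbreviation ecard :: "nat list set \<Rightarrow> ennreal" where
  "ecard \<equiv> emeasure (count_space UNIV)"

lemma ecard_image_Cons: "ecard ((#) i ` A) = ecard A"
proof (cases "finite A")
  case False
  then have "infinite ((#) i ` A)" by (simp add: finite_image_iff)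
  with False show ?thesis by simp
qed (simp add: card_image)

lemma ecard_alive_upto_graft:
  "ecard (alive_upto (Suc n) (graft x) t) = of_bool (0 \<le> t \<and> t < fst (fst x)) +
     (\<Sum>i<snd (fst x). ecard (alive_upto n (snd x i) (t - fst (fst x))))"
proof -
  let ?A = "\<lambda>i. (#) i ` alive_upto n (snd x i) (t - fst (fst x))"
  have "ecard (\<Union>i<snd (fst x). ?A i) = (\<Sum>i<snd (fst x). ecard (?A i))"
    by (rule sym, rule sum_emeasure) (auto simp: disjoint_family_on_def)
  then show ?thesis
    unfolding alive_upto_graft
    by (subst plus_emeasure[symmetric]) (auto simp: ecard_image_Cons)
qed

lemma population_graft:
  assumes "finite (alive (graft x) t)"
  shows "population (graft x) t = of_bool (0 \<le> t \<and> t < fst (fst x)) +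
     (\<Sum>i<snd (fst x). population (snd x i) (t - fst (fst x)))"
proof -
  let ?A = "\<lambda>i. (#) i ` alive (snd x i) (t - fst (fst x))"
  have fin: "finite (?A i)" if "i < snd (fst x)" for i
    by (rule finite_subset[OF _ assms]) (use that in \<open>auto simp: alive_graft\<close>)
  have "card (\<Union>i<snd (fst x). ?A i) = (\<Sum>i<snd (fst x). card (?A i))"
    by (rule card_UN_disjoint) (use fin in auto)
  moreover have "card (?A i) = population (snd x i) (t - fst (fst x))" for i
    by (simp add: population_alive card_image)
  ultimately show ?thesis
    unfolding population_alive alive_graft using fin
    by (subst card_Un_disjoint) auto
qed

lemma measurable_ecard_alive_upto [measurable (raw)]:
  assumes [measurable]: "f \<in> N \<rightarrow>\<^sub>M tree_law \<mu> p" "t \<in> borel_measurable N"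
  shows "(\<lambda>x. ecard (alive_upto n (f x) (t x))) \<in> borel_measurable N"
proof -
  have "(\<lambda>y. indicator (alive_upto n (f (fst y)) (t (fst y))) (snd y) :: ennreal)
      \<in> borel_measurable (N \<Otimes>\<^sub>M count_space UNIV)"
  proof (rule measurable_compose_countable[OF _ measurable_snd])
    fix u :: "nat list"
    show "(\<lambda>y. indicator (alive_upto n (f (fst y)) (t (fst y))) u :: ennreal) \<in> borel_measurable (N \<Otimes>\<^sub>M count_space UNIV)"
      unfolding indicator_def alive_upto_def alive_def by simp
  qed
  then have "(\<lambda>x. \<integral>\<^sup>+u. indicator (alive_upto n (f x) (t x)) u \<partial>count_space UNIV) \<in> borel_measurable N"
    by (intro sigma_finite_measure.borel_measurable_nn_integral sigma_finite_measure_count_space)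
       (simp add: case_prod_beta)
  then show ?thesis by simp
qed

lemma ecard_alive_SUP: "ecard (alive \<tau> t) = (SUP n. ecard (alive_upto n \<tau> t))"
proof -
  have "(\<Union>n. alive_upto n \<tau> t) = alive \<tau> t"
    by (auto simp: alive_upto_def)
  moreover have "(SUP n. ecard (alive_upto n \<tau> t)) = ecard (\<Union>n. alive_upto n \<tau> t)"
    by (rule SUP_emeasure_incseq) (auto simp: incseq_def alive_upto_def)
  ultimately show ?thesis by simp
qed

lemma measurable_ecard_alive [measurable (raw)]:
  assumes [measurable]: "f \<in> N \<rightarrow>\<^sub>M tree_law \<mu> p" "t \<in> borel_measurable N"
  shows "(\<lambda>x. ecard (alive (f x) (t x))) \<in> borel_measurable N"
  unfolding ecard_alive_SUP by measurable

text \<open>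
  \<open>enn2real\<close> maps \<open>\<infinity>\<close> to 0, just as \<open>card\<close> does with infinite sets.
\<close>
lemma real_population: "real (population \<tau> t) = enn2real (ecard (alive \<tau> t))"
  by (cases "finite (alive \<tau> t)") (simp_all add: population_alive)

lemma measurable_population [measurable (raw)]:
  assumes [measurable]: "f \<in> N \<rightarrow>\<^sub>M tree_law \<mu> p" "t \<in> borel_measurable N"
  shows "(\<lambda>x. population (f x) (t x)) \<in> N \<rightarrow>\<^sub>M count_space UNIV"
proof -
  have "(\<lambda>x. real (population (f x) (t x))) \<in> borel_measurable N"
    unfolding real_population by measurable
  then have "(\<lambda>x. nat \<lfloor>real (population (f x) (t x))\<rfloor>) \<in> N \<rightarrow>\<^sub>M count_space UNIV"
    by measurable
  then show ?thesis by simp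
qed

abbreviation forest_law :: "real \<Rightarrow> nat pmf \<Rightarrow> (nat \<Rightarrow> family_tree) measure" where
  "forest_law \<mu> p \<equiv> Pi\<^sub>M UNIV (\<lambda>_. tree_law \<mu> p)"

lemma space_forest_law [simp]: "space (forest_law \<mu> p) = UNIV"
  by (simp add: space_PiM)

lemma prob_space_forest_law: "0 < \<mu> \<Longrightarrow> prob_space (forest_law \<mu> p)"
  by (intro prob_space_PiM prob_space_tree_law)

lemma tree_law_graft:
  "0 < \<mu> \<Longrightarrow> distr (root_law \<mu> p \<Otimes>\<^sub>M forest_law \<mu> p) (tree_law \<mu> p) graft = tree_law \<mu> p"
  using distr_graft[OF prob_space_root_law] by (simp add: tree_law_eq)

lemma measurable_graft_tree [measurable]:
  "graft \<in> root_law \<mu> p \<Otimes>\<^sub>M forest_law \<mu> p \<rightarrow>\<^sub>M tree_law \<mu> p"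
  using measurable_graft[of "root_law \<mu> p"] by (simp add: tree_law_eq)

lemma nn_integral_root_law:
  assumes "0 < \<mu>" and [measurable]: "f \<in> borel_measurable (borel \<Otimes>\<^sub>M count_space UNIV)"
  shows "(\<integral>\<^sup>+x. f x \<partial>root_law \<mu> p) =
    (\<integral>\<^sup>+T. \<integral>\<^sup>+k. f (T, k) \<partial>measure_pmf p \<partial>density lborel (exponential_density \<mu>))"
proof -
  have "f \<in> borel_measurable (density lborel (exponential_density \<mu>) \<Otimes>\<^sub>M measure_pmf p)"
    using assms(2) by (simp add: measurable_cong_sets[OF sets_pair_measure_cong])
  then show ?thesis unfolding root_law_def
    by (rule measure_pmf.nn_integral_fst[symmetric])
qed

lemma nn_integral_tree_law_graft:
  assumes \<mu>: "0 < \<mu>" and f: "f \<in> borel_measurable (tree_law \<mu> p)"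
  shows "(\<integral>\<^sup>+\<tau>. f \<tau> \<partial>tree_law \<mu> p) = (\<integral>\<^sup>+x. \<integral>\<^sup>+\<sigma>. f (graft (x, \<sigma>)) \<partial>forest_law \<mu> p \<partial>root_law \<mu> p)"
proof -
  interpret S: prob_space "forest_law \<mu> p" by (rule prob_space_forest_law[OF \<mu>])
  have "(\<integral>\<^sup>+\<tau>. f \<tau> \<partial>tree_law \<mu> p) = (\<integral>\<^sup>+y. f (graft y) \<partial>(root_law \<mu> p \<Otimes>\<^sub>M forest_law \<mu> p))"
    by (subst tree_law_graft[OF \<mu>, symmetric], subst nn_integral_distr) (use f in auto)
  also have "\<dots> = (\<integral>\<^sup>+x. \<integral>\<^sup>+\<sigma>. f (graft (x, \<sigma>)) \<partial>forest_law \<mu> p \<partial>root_law \<mu> p)"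
    by (rule S.nn_integral_fst[symmetric]) (rule measurable_compose[OF measurable_graft_tree f])
  finally show ?thesis .
qed

lemma nn_integral_forest_component:
  assumes \<mu>: "0 < \<mu>" and f: "f \<in> borel_measurable (tree_law \<mu> p)"
  shows "(\<integral>\<^sup>+\<sigma>. f (\<sigma> i) \<partial>forest_law \<mu> p) = (\<integral>\<^sup>+\<tau>. f \<tau> \<partial>tree_law \<mu> p)"
proof -
  interpret product_prob_space "\<lambda>_::nat. tree_law \<mu> p" UNIV
    by (intro product_prob_spaceI prob_space_tree_law \<mu>)
  have "(\<integral>\<^sup>+\<tau>. f \<tau> \<partial>tree_law \<mu> p) = (\<integral>\<^sup>+\<tau>. f \<tau> \<partial>distr (forest_law \<mu> p) (tree_law \<mu> p) (\<lambda>\<sigma>. \<sigma> i))"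
    by (simp add: PiM_component)
  also have "\<dots> = (\<integral>\<^sup>+\<sigma>. f (\<sigma> i) \<partial>forest_law \<mu> p)"
    by (rule nn_integral_distr) (use f in auto)
  finally show ?thesis ..
qed

lemma AE_exponential_nonneg: "AE T in density lborel (exponential_density \<mu>). 0 \<le> T"
  by (subst AE_density) (auto simp: exponential_density_def)

text \<open>
  A renewal argument: at time \<open>t\<close> either the ancestor is still alive, or it has died and its children are on average
  at most one, each with an expected progeny of at most 1 at the remaining time.  So the bound 1 reproduces
  itself from one generation to the next.
\<close>
lemma nn_integral_alive_upto_le:
  assumes \<mu>: "0 < \<mu>" and mean: "(\<integral>\<^sup>+k. of_nat k \<partial>measure_pmf p) \<le> 1"
  shows "(\<integral>\<^sup>+\<tau>. ecard (alive_upto n \<tau> t) \<partial>tree_law \<mu> p) \<le> indicator {0..} t"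
proof (induction n arbitrary: t)
  case 0
  then show ?case by (simp add: alive_upto_def)
next
  case (Suc n)
  interpret S: prob_space "forest_law \<mu> p" by (rule prob_space_forest_law[OF \<mu>])
  interpret E: prob_space "density lborel (exponential_density \<mu>)"
    by (rule prob_space_exponential_density[OF \<mu>])
  have [measurable]: "(\<lambda>\<tau>. ecard (alive_upto n \<tau> s)) \<in> borel_measurable (tree_law \<mu> p)" for n s
    by measurable
  have comp: "(\<lambda>\<sigma>. \<sigma> i) \<in> forest_law \<mu> p \<rightarrow>\<^sub>M tree_law \<mu> p" for i
    by (rule measurable_component_singleton) simp
  have "(\<integral>\<^sup>+\<tau>. ecard (alive_upto (Suc n) \<tau> t) \<partial>tree_law \<mu> p)
      = (\<integral>\<^sup>+x. \<integral>\<^sup>+\<sigma>. ecard (alive_upto (Suc n) (graft (x, \<sigma>)) t) \<partial>forest_law \<mu> p \<partial>root_law \<mu> p)"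
    by (rule nn_integral_tree_law_graft[OF \<mu>]) measurable
  also have "\<dots> = (\<integral>\<^sup>+x. of_bool (0 \<le> t \<and> t < fst x) +
      (\<Sum>i<snd x. \<integral>\<^sup>+\<tau>. ecard (alive_upto n \<tau> (t - fst x)) \<partial>tree_law \<mu> p) \<partial>root_law \<mu> p)"
  proof (rule nn_integral_cong)
    fix x
    have m: "(\<lambda>\<sigma>. ecard (alive_upto n (\<sigma> i) s)) \<in> borel_measurable (forest_law \<mu> p)" for i s
      by (rule measurable_compose[OF comp]) measurable
    have "(\<integral>\<^sup>+\<sigma>. ecard (alive_upto (Suc n) (graft (x, \<sigma>)) t) \<partial>forest_law \<mu> p) =
      of_bool (0 \<le> t \<and> t < fst x) + (\<Sum>i<snd x. \<integral>\<^sup>+\<sigma>. ecard (alive_upto n (\<sigma> i) (t - fst x)) \<partial>forest_law \<mu> p)"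
      unfolding ecard_alive_upto_graft fst_conv snd_conv
      by (subst nn_integral_add) (auto simp: nn_integral_sum m S.emeasure_space_1[simplified])
    then show "(\<integral>\<^sup>+\<sigma>. ecard (alive_upto (Suc n) (graft (x, \<sigma>)) t) \<partial>forest_law \<mu> p) =
      of_bool (0 \<le> t \<and> t < fst x) + (\<Sum>i<snd x. \<integral>\<^sup>+\<tau>. ecard (alive_upto n \<tau> (t - fst x)) \<partial>tree_law \<mu> p)"
      by (subst (asm) nn_integral_forest_component[OF \<mu>]) auto
  qed
  also have "\<dots> \<le> (\<integral>\<^sup>+x. of_bool (0 \<le> t \<and> t < fst x) + of_nat (snd x) * indicator {0..} (t - fst x) \<partial>root_law \<mu> p)"
  proof (intro nn_integral_mono add_left_mono)
    fix x :: "real \<times> nat"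
    have "(\<Sum>i<snd x. \<integral>\<^sup>+\<tau>. ecard (alive_upto n \<tau> (t - fst x)) \<partial>tree_law \<mu> p)
        \<le> (\<Sum>i<snd x. indicator {0..} (t - fst x))"
      by (intro sum_mono Suc.IH)
    then show "(\<Sum>i<snd x. \<integral>\<^sup>+\<tau>. ecard (alive_upto n \<tau> (t - fst x)) \<partial>tree_law \<mu> p)
        \<le> of_nat (snd x) * indicator {0..} (t - fst x)" by simp
  qed
  also have "\<dots> = (\<integral>\<^sup>+T. \<integral>\<^sup>+k. of_bool (0 \<le> t \<and> t < T) + of_nat k * indicator {0..} (t - T)
      \<partial>measure_pmf p \<partial>density lborel (exponential_density \<mu>))"
    by (subst nn_integral_root_law[OF \<mu>]) auto
  also have "\<dots> = (\<integral>\<^sup>+T. of_bool (0 \<le> t \<and> t < T) + (\<integral>\<^sup>+k. of_nat k \<partial>measure_pmf p) * indicator {0..} (t - T)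
      \<partial>density lborel (exponential_density \<mu>))"
    by (intro nn_integral_cong) (subst nn_integral_add, auto simp: nn_integral_multc)
  also have "\<dots> \<le> (\<integral>\<^sup>+T. indicator {0..} t \<partial>density lborel (exponential_density \<mu>))"
  proof (rule nn_integral_mono_AE)
    show "AE T in density lborel (exponential_density \<mu>). of_bool (0 \<le> t \<and> t < T) +
        (\<integral>\<^sup>+k. of_nat k \<partial>measure_pmf p) * indicator {0..} (t - T) \<le> (indicator {0..} t :: ennreal)"
      using AE_exponential_nonneg by eventually_elim (use mean in \<open>auto simp: indicator_def\<close>)
  qed
  also have "\<dots> = indicator {0..} t"
    using E.emeasure_space_1 by simp
  finally show ?case .
qed

lemma nn_integral_alive_le:
  assumes \<mu>: "0 < \<mu>" and mean: "(\<integral>\<^sup>+k. of_nat k \<partial>measure_pmf p) \<le> 1"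
  shows "(\<integral>\<^sup>+\<tau>. ecard (alive \<tau> t) \<partial>tree_law \<mu> p) \<le> indicator {0..} t"
proof -
  have "(\<integral>\<^sup>+\<tau>. ecard (alive \<tau> t) \<partial>tree_law \<mu> p) = (SUP n. \<integral>\<^sup>+\<tau>. ecard (alive_upto n \<tau> t) \<partial>tree_law \<mu> p)"
    unfolding ecard_alive_SUP
  proof (rule nn_integral_monotone_convergence_SUP)
    show "incseq (\<lambda>n \<tau>. ecard (alive_upto n \<tau> t))"
      by (auto simp: incseq_def le_fun_def alive_upto_def intro!: emeasure_mono)
  qed measurable
  also have "\<dots> \<le> indicator {0..} t"
    by (intro SUP_least nn_integral_alive_upto_le assms)
  finally show ?thesis .
qed

text \<open>
  By this the default value of \<open>card\<close> for infinite sets is met with probability 0 only.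
\<close>
lemma AE_finite_alive:
  assumes "0 < \<mu>" and "(\<integral>\<^sup>+k. of_nat k \<partial>measure_pmf p) \<le> 1"
  shows "AE \<tau> in tree_law \<mu> p. finite (alive \<tau> t)"
proof -
  have "(\<integral>\<^sup>+\<tau>. ecard (alive \<tau> t) \<partial>tree_law \<mu> p) \<noteq> \<infinity>"
    using nn_integral_alive_le[OF assms, of t] by (cases "0 \<le> t") (auto simp: top_unique indicator_def)
  then have "AE \<tau> in tree_law \<mu> p. ecard (alive \<tau> t) \<noteq> \<infinity>"
    by (intro nn_integral_PInf_AE) measurable
  then show ?thesis
    by eventually_elim (metis emeasure_count_space_infinite subset_UNIV)
qed

lemma AE_population_negative_time:
  assumes "0 < \<mu>" and "(\<integral>\<^sup>+k. of_nat k \<partial>measure_pmf p) \<le> 1" and "t < 0"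
  shows "AE \<tau> in tree_law \<mu> p. population \<tau> t = 0"
proof -
  have "(\<integral>\<^sup>+\<tau>. ecard (alive \<tau> t) \<partial>tree_law \<mu> p) = 0"
    using nn_integral_alive_le[OF assms(1,2), of t] \<open>t < 0\<close> by auto
  then have "AE \<tau> in tree_law \<mu> p. ecard (alive \<tau> t) = 0"
    by (subst (asm) nn_integral_0_iff_AE) auto
  then show ?thesis
    by eventually_elim (simp add: population_alive emeasure_count_space_eq_0)
qed

section \<open>Generating functions and the first death\<close>

lemma integrable_pmf_power: "0 \<le> s \<Longrightarrow> s \<le> 1 \<Longrightarrow> integrable (measure_pmf p) (\<lambda>n. (s::real) ^ n)"
  by (rule measure_pmf.integrable_const_bound[where B=1]) (auto simp: power_le_one)

lemma pgf_1 [simp]: "pgf p 1 = 1"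
  by (simp add: pgf_def)

lemma pgf_mono: "0 \<le> s \<Longrightarrow> s \<le> t \<Longrightarrow> t \<le> 1 \<Longrightarrow> pgf p s \<le> pgf p t"
  unfolding pgf_def by (intro integral_mono integrable_pmf_power power_mono) auto

lemma pgf_nonneg: "0 \<le> s \<Longrightarrow> 0 \<le> pgf p s"
  unfolding pgf_def by (intro Bochner_Integration.integral_nonneg) auto

lemma pgf_le_1: "0 \<le> s \<Longrightarrow> s \<le> 1 \<Longrightarrow> pgf p s \<le> 1"
  using pgf_mono[of s 1 p] by simp

lemma continuous_on_pgf: "continuous_on {0..1} (pgf p)"
proof (rule continuous_on_sequentiallyI)
  fix u :: "nat \<Rightarrow> real" and a assume u: "\<forall>n. u n \<in> {0..1}" "a \<in> {0..1}" "u \<longlonglongrightarrow> a"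
  show "(\<lambda>n. pgf p (u n)) \<longlonglongrightarrow> pgf p a"
    unfolding pgf_def
  proof (rule integral_dominated_convergence[where w="\<lambda>_. 1"])
    show "AE k in measure_pmf p. (\<lambda>n. u n ^ k) \<longlonglongrightarrow> a ^ k"
      using u(3) by (intro AE_I2 tendsto_power)
    show "AE k in measure_pmf p. norm (u n ^ k) \<le> 1" for n
      using u(1) by (intro AE_I2) (auto simp: power_le_one)
  qed auto
qed

lemma convex_on_pgf: "convex_on {0..1} (pgf p)"
proof (rule convex_onI)
  fix t x y :: real assume *: "0 < t" "t < 1" "x \<in> {0..1}" "y \<in> {0..1}"
  have c: "0 \<le> (1 - t) * x + t * y" "(1 - t) * x + t * y \<le> 1"
    using * convex_bound_le[of x 1 y "1 - t" t] by auto
  have pw: "((1 - t) * x + t * y) ^ n \<le> (1 - t) * x ^ n + t * y ^ n" for n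
    using convex_onD[OF convex_power_even[of n], of t x y] convex_onD[OF convex_power_odd[of n], of t x y] *
    by (cases "even n") auto
  have "pgf p ((1 - t) * x + t * y) \<le> measure_pmf.expectation p (\<lambda>n. (1 - t) * x ^ n + t * y ^ n)"
    unfolding pgf_def using pw * c by (intro integral_mono integrable_pmf_power Bochner_Integration.integrable_add integrable_mult_right) auto
  also have "\<dots> = (1 - t) * pgf p x + t * pgf p y"
    unfolding pgf_def using * by (simp add: integrable_pmf_power)
  finally show "pgf p ((1 - t) *\<^sub>R x + t *\<^sub>R y) \<le> (1 - t) * pgf p x + t * pgf p y" by simp
qed simp

lemma measurable_bp_F [measurable]:
  assumes "0 < \<mu>" shows "(\<lambda>t. bp_F \<mu> p t s) \<in> borel_measurable borel"
proof -
  interpret T: prob_space "tree_law \<mu> p" by (rule prob_space_tree_law[OF assms])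
  show ?thesis unfolding bp_F_def by measurable
qed

lemma bp_F_bounds:
  assumes "0 < \<mu>" "0 \<le> s" "s \<le> 1" shows "0 \<le> bp_F \<mu> p t s" "bp_F \<mu> p t s \<le> 1"
proof -
  interpret T: prob_space "tree_law \<mu> p" by (rule prob_space_tree_law[OF assms(1)])
  show "0 \<le> bp_F \<mu> p t s"
    unfolding bp_F_def using assms by (intro Bochner_Integration.integral_nonneg) auto
  show "bp_F \<mu> p t s \<le> 1"
    unfolding bp_F_def by (rule T.integral_le_const) 
     (use assms in \<open>auto simp: power_le_one intro!: T.integrable_const_bound[where B=1]\<close>)
qed

lemma bp_F_negative_time:
  assumes "0 < \<mu>" "(\<integral>\<^sup>+k. of_nat k \<partial>measure_pmf p) \<le> 1" "t < 0"
  shows "bp_F \<mu> p t s = 1"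
proof -
  interpret T: prob_space "tree_law \<mu> p" by (rule prob_space_tree_law[OF assms(1)])
  have "bp_F \<mu> p t s = (\<integral>\<tau>. 1 \<partial>tree_law \<mu> p)"
    unfolding bp_F_def
    by (rule integral_cong_AE) (use AE_population_negative_time[OF assms] in \<open>auto elim: eventually_mono\<close>)
  then show ?thesis using T.prob_space by simp
qed

lemma integral_forest_prod:
  fixes \<phi> :: "family_tree \<Rightarrow> real"
  assumes \<mu>: "0 < \<mu>" and \<phi>: "\<phi> \<in> borel_measurable (tree_law \<mu> p)" "\<And>\<tau>. norm (\<phi> \<tau>) \<le> 1"
  shows "(\<integral>\<sigma>. (\<Prod>i<k. \<phi> (\<sigma> i)) \<partial>forest_law \<mu> p) = (\<integral>\<tau>. \<phi> \<tau> \<partial>tree_law \<mu> p) ^ k"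
proof -
  interpret T: prob_space "tree_law \<mu> p" by (rule prob_space_tree_law[OF \<mu>])
  interpret product_prob_space "\<lambda>_::nat. tree_law \<mu> p" UNIV
    by (intro product_prob_spaceI prob_space_tree_law \<mu>)
  have int: "integrable (tree_law \<mu> p) \<phi>"
    using \<phi> by (intro T.integrable_const_bound[where B=1]) auto
  have "(\<integral>\<sigma>. (\<Prod>i<k. \<phi> (\<sigma> i)) \<partial>forest_law \<mu> p) =
      (\<integral>\<sigma>. (\<Prod>i<k. \<phi> (\<sigma> i)) \<partial>distr (forest_law \<mu> p) (Pi\<^sub>M {..<k} (\<lambda>_. tree_law \<mu> p)) (\<lambda>\<sigma>. restrict \<sigma> {..<k}))"
  proof (subst integral_distr)
    show "(\<lambda>\<sigma>. restrict \<sigma> {..<k}) \<in> forest_law \<mu> p \<rightarrow>\<^sub>M Pi\<^sub>M {..<k} (\<lambda>_. tree_law \<mu> p)"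
      by (rule measurable_restrict_subset) simp
    show "(\<lambda>\<sigma>. \<Prod>i<k. \<phi> (\<sigma> i)) \<in> borel_measurable (Pi\<^sub>M {..<k} (\<lambda>_. tree_law \<mu> p))"
      by (intro borel_measurable_prod measurable_compose[OF measurable_component_singleton, where g=\<phi>] \<phi>(1))
  qed simp
  also have "\<dots> = (\<integral>\<sigma>. (\<Prod>i<k. \<phi> (\<sigma> i)) \<partial>Pi\<^sub>M {..<k} (\<lambda>_. tree_law \<mu> p))"
    by (subst distr_PiM_restrict_finite) auto
  also have "\<dots> = (\<Prod>i<k. (\<integral>\<tau>. \<phi> \<tau> \<partial>tree_law \<mu> p))"
    using int by (intro product_integral_prod) auto
  finally show ?thesis by simp
qed

lemma AE_population_graft:
  assumes \<mu>: "0 < \<mu>" and mean: "(\<integral>\<^sup>+k. of_nat k \<partial>measure_pmf p) \<le> 1"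
  shows "AE y in root_law \<mu> p \<Otimes>\<^sub>M forest_law \<mu> p.
     population (graft y) t = of_bool (0 \<le> t \<and> t < fst (fst y)) +
     (\<Sum>i<snd (fst y). population (snd y i) (t - fst (fst y)))"
proof -
  have "AE \<tau> in distr (root_law \<mu> p \<Otimes>\<^sub>M forest_law \<mu> p) (tree_law \<mu> p) graft. finite (alive \<tau> t)"
    unfolding tree_law_graft[OF \<mu>] by (rule AE_finite_alive[OF assms])
  then have "AE y in root_law \<mu> p \<Otimes>\<^sub>M forest_law \<mu> p. finite (alive (graft y) t)"
    by (rule AE_distrD[OF measurable_graft_tree])
  then show ?thesis by eventually_elim (rule population_graft)
qed

lemma integral_root_law:
  fixes f :: "real \<times> nat \<Rightarrow> real"
  assumes "0 < \<mu>" and f: "f \<in> borel_measurable (borel \<Otimes>\<^sub>M count_space UNIV)" and b: "\<And>x. norm (f x) \<le> 1"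
  shows "(\<integral>x. f x \<partial>root_law \<mu> p) =
    (\<integral>T. (\<integral>k. f (T, k) \<partial>measure_pmf p) \<partial>density lborel (exponential_density \<mu>))"
proof -
  interpret E: prob_space "density lborel (exponential_density \<mu>)"
    by (rule prob_space_exponential_density[OF assms(1)])
  interpret pair_prob_space "density lborel (exponential_density \<mu>)" "measure_pmf p" ..
  have "f \<in> borel_measurable (density lborel (exponential_density \<mu>) \<Otimes>\<^sub>M measure_pmf p)"
    using f by (simp add: measurable_cong_sets[OF sets_pair_measure_cong])
  then have "integrable (density lborel (exponential_density \<mu>) \<Otimes>\<^sub>M measure_pmf p) f"
    using b by (intro integrable_const_bound[where B=1]) auto
  from integral_fst'[OF this] show ?thesis unfolding root_law_def ..
qed

text \<open>
  Conditioning on the life length \<open>T\<close> and the number of children of the ancestor.  While the ancestor is alive,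
  \<open>t - T\<close> is negative and the second factor is \<open>pgf p 1 = 1\<close>.
\<close>
lemma bp_F_first_death:
  assumes \<mu>: "0 < \<mu>" and mean: "(\<integral>\<^sup>+k. of_nat k \<partial>measure_pmf p) \<le> 1"
    and s: "0 \<le> s" "s \<le> 1"
  shows "bp_F \<mu> p t s = (\<integral>T. s ^ of_bool (0 \<le> t \<and> t < T) * pgf p (bp_F \<mu> p (t - T) s)
      \<partial>density lborel (exponential_density \<mu>))"
proof -
  interpret R: prob_space "root_law \<mu> p" by (rule prob_space_root_law[OF \<mu>])
  interpret S: prob_space "forest_law \<mu> p" by (rule prob_space_forest_law[OF \<mu>])
  interpret RS: pair_prob_space "root_law \<mu> p" "forest_law \<mu> p" ..
  have comp [measurable]: "(\<lambda>\<sigma>. \<sigma> i) \<in> forest_law \<mu> p \<rightarrow>\<^sub>M tree_law \<mu> p" for i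
    by (rule measurable_component_singleton) simp
  let ?F = "\<lambda>t. bp_F \<mu> p t s"
  let ?b = "\<lambda>T. s ^ of_bool (0 \<le> t \<and> t < T)"
  note Fm[measurable] = measurable_bp_F[OF \<mu>, of p s]
  have F01: "0 \<le> ?F u \<and> ?F u \<le> 1" for u using bp_F_bounds[OF \<mu> s] by auto
  let ?\<psi> = "\<lambda>y. ?b (fst (fst y)) * (\<Prod>i<snd (fst y). s ^ population (snd y i) (t - fst (fst y)))"
  have [measurable]: "fst \<in> borel_measurable (root_law \<mu> p)"
    by (subst measurable_cong_sets[OF sets_root_law refl]) simp
  have [measurable]: "snd \<in> root_law \<mu> p \<rightarrow>\<^sub>M count_space UNIV"
    by (subst measurable_cong_sets[OF sets_root_law refl]) simp
  have \<psi>[measurable]: "?\<psi> \<in> borel_measurable (root_law \<mu> p \<Otimes>\<^sub>M forest_law \<mu> p)"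
  proof -
    have "(\<lambda>y. \<Prod>i<k. s ^ population (snd y i) (t - fst (fst y))) \<in> borel_measurable (root_law \<mu> p \<Otimes>\<^sub>M forest_law \<mu> p)" for k
      by measurable
    then have "(\<lambda>y. \<Prod>i<snd (fst y). s ^ population (snd y i) (t - fst (fst y))) \<in> borel_measurable (root_law \<mu> p \<Otimes>\<^sub>M forest_law \<mu> p)"
      by (rule measurable_compose_countable) measurable
    then show ?thesis by measurable
  qed
  have \<psi>01: "norm (?\<psi> y) \<le> 1" for y
    using s by (auto simp: abs_mult intro!: mult_le_one power_le_one prod_le_1 prod_nonneg abs_of_nonneg[THEN eq_refl, THEN order_trans])
  have "?F t = (\<integral>\<tau>. s ^ population \<tau> t \<partial>distr (root_law \<mu> p \<Otimes>\<^sub>M forest_law \<mu> p) (tree_law \<mu> p) graft)"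
    by (simp add: bp_F_def tree_law_graft[OF \<mu>])
  also have "\<dots> = (\<integral>y. s ^ population (graft y) t \<partial>(root_law \<mu> p \<Otimes>\<^sub>M forest_law \<mu> p))"
    by (rule integral_distr) measurable
  also have "\<dots> = (\<integral>y. ?\<psi> y \<partial>(root_law \<mu> p \<Otimes>\<^sub>M forest_law \<mu> p))"
  proof (rule integral_cong_AE)
    show "AE y in root_law \<mu> p \<Otimes>\<^sub>M forest_law \<mu> p. s ^ population (graft y) t = ?\<psi> y"
      using AE_population_graft[OF \<mu> mean, of t] by eventually_elim (simp add: power_add power_sum)
  qed measurable
  also have "\<dots> = (\<integral>x. \<integral>\<sigma>. ?\<psi> (x, \<sigma>) \<partial>forest_law \<mu> p \<partial>root_law \<mu> p)"
    by (rule RS.integral_fst'[symmetric]) (intro RS.integrable_const_bound[where B=1] AE_I2 \<psi> \<psi>01)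
  also have "\<dots> = (\<integral>x. ?b (fst x) * ?F (t - fst x) ^ snd x \<partial>root_law \<mu> p)"
  proof (rule Bochner_Integration.integral_cong[OF refl])
    fix x
    have "(\<integral>\<sigma>. (\<Prod>i<snd x. s ^ population (\<sigma> i) (t - fst x)) \<partial>forest_law \<mu> p) = ?F (t - fst x) ^ snd x"
      unfolding bp_F_def by (rule integral_forest_prod[OF \<mu>]) (use s in \<open>auto simp: power_le_one\<close>)
    then show "(\<integral>\<sigma>. ?\<psi> (x, \<sigma>) \<partial>forest_law \<mu> p) = ?b (fst x) * ?F (t - fst x) ^ snd x"
      by simp
  qed
  also have "\<dots> = (\<integral>T. (\<integral>k. ?b T * ?F (t - T) ^ k \<partial>measure_pmf p) \<partial>density lborel (exponential_density \<mu>))"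
  proof (subst integral_root_law[OF \<mu>])
    show "norm (?b (fst x) * ?F (t - fst x) ^ snd x) \<le> 1" for x
      using s F01[of "t - fst x"] by (auto simp: abs_mult intro!: mult_le_one power_le_one)
  qed auto
  also have "\<dots> = (\<integral>T. ?b T * pgf p (?F (t - T)) \<partial>density lborel (exponential_density \<mu>))"
    by (simp add: pgf_def)
  finally show ?thesis .
qed

section \<open>The backward equation\<close>

text \<open>
  The mean bound excludes explosion.  The last assumption makes 1 the only fixed point of \<open>pgf p\<close> in \<open>[0,1]\<close>, so the
  backward equation can be integrated on all of \<open>[0,1)\<close>.
\<close>
locale branching_process =
  fixes \<mu> :: real and p :: "nat pmf"
  assumes \<mu>_pos: "0 < \<mu>"
    and mean_le_1: "(\<integral>\<^sup>+k. of_nat k \<partial>measure_pmf p) \<le> 1"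
    and pgf_gt: "0 \<le> s \<Longrightarrow> s < 1 \<Longrightarrow> s < pgf p s"
begin

abbreviation F where "F \<equiv> bp_F \<mu> p"

text \<open>
  Substituting \<open>v = t - T\<close> in the decomposition at the first death and multiplying by \<open>exp (\<mu> t)\<close> leaves the upper
  limit of integration as the only place on the right where \<open>t\<close> occurs; thus measurability of \<open>F\<close> improves to continuity and then
  to differentiability.
\<close>
lemma F_integral_equation:
  assumes s: "0 \<le> s" "s \<le> 1" and t: "0 \<le> t"
  shows "(\<lambda>v. \<mu> * exp (\<mu> * v) * pgf p (F v s)) integrable_on {0..t}"
    and "F t s * exp (\<mu> * t) = s + integral {0..t} (\<lambda>v. \<mu> * exp (\<mu> * v) * pgf p (F v s))"
proof -
  let ?D = "density lborel (exponential_density \<mu>)"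
  interpret E: prob_space ?D by (rule prob_space_exponential_density[OF \<mu>_pos])
  have [measurable]: "(\<lambda>t. F t s) \<in> borel_measurable borel"
    by (rule measurable_bp_F[OF \<mu>_pos])
  define k where "k v = pgf p (F v s)" for v
  have k_meas[measurable]: "k \<in> borel_measurable borel" unfolding k_def pgf_def by measurable
  have k01: "0 \<le> k v" "k v \<le> 1" for v
    unfolding k_def using bp_F_bounds[OF \<mu>_pos s, of p v] by (auto intro: pgf_nonneg pgf_le_1)
  let ?K = "\<lambda>v. \<mu> * exp (\<mu> * v) * k v"
  have int: "set_integrable lborel {0..t} ?K"
    unfolding set_integrable_def
  proof (rule integrableI_bounded_set_indicator[where B="\<mu> * exp (\<mu> * t)"])
    show "AE v in lborel. v \<in> {0..t} \<longrightarrow> norm (\<mu> * exp (\<mu> * v) * k v) \<le> \<mu> * exp (\<mu> * t)"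
    proof (intro AE_I2 impI)
      fix v assume "v \<in> {0..t}"
      then have "exp (\<mu> * v) * k v \<le> exp (\<mu> * t) * 1"
        using \<mu>_pos k01[of v] by (intro mult_mono) auto
      then show "norm (\<mu> * exp (\<mu> * v) * k v) \<le> \<mu> * exp (\<mu> * t)"
        using \<mu>_pos k01[of v] by (auto simp: abs_mult mult.assoc)
    qed
  qed (use t in auto)
  show "(\<lambda>v. \<mu> * exp (\<mu> * v) * pgf p (F v s)) integrable_on {0..t}"
    using set_borel_integral_eq_integral(1)[OF int] unfolding k_def .
  have gt: "measure ?D {t<..} = exp (- \<mu> * t)"
  proof -
    have "distributed ?D lborel (\<lambda>x. x) (exponential_density \<mu>)"
      unfolding distributed_def by (auto simp: distr_id2 intro!: AE_I2)
    from E.exponential_distributedD_gt[OF this t \<mu>_pos] show ?thesis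
      by (simp add: greaterThan_def mult.commute)
  qed
  have "F t s = (\<integral>T. s ^ of_bool (0 \<le> t \<and> t < T) * k (t - T) \<partial>?D)"
    unfolding k_def by (rule bp_F_first_death[OF \<mu>_pos mean_le_1 s])
  also have "\<dots> = (\<integral>T. s * indicator {t<..} T + indicator {..t} T * k (t - T) \<partial>?D)"
  proof (rule Bochner_Integration.integral_cong[OF refl])
    fix T
    show "s ^ of_bool (0 \<le> t \<and> t < T) * k (t - T) = s * indicator {t<..} T + indicator {..t} T * k (t - T)"
      using t bp_F_negative_time[OF \<mu>_pos mean_le_1, of "t - T" s] by (cases "t < T") (simp_all add: k_def)
  qed
  also have "\<dots> = s * exp (- \<mu> * t) + (\<integral>T. indicator {..t} T * k (t - T) \<partial>?D)"
  proof (subst Bochner_Integration.integral_add)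
    show "integrable ?D (\<lambda>T. s * indicator {t<..} T)"
      by (intro integrable_mult_right E.integrable_const_bound[where B=1]) auto
    show "integrable ?D (\<lambda>T. indicator {..t} T * k (t - T))"
      by (rule E.integrable_const_bound[where B=1]) (use k01 in \<open>auto simp: indicator_def\<close>)
  qed (simp add: gt)
  also have "(\<integral>T. indicator {..t} T * k (t - T) \<partial>?D) = (\<integral>T. exponential_density \<mu> T * (indicator {..t} T * k (t - T)) \<partial>lborel)"
    by (subst integral_density) (use \<mu>_pos in \<open>auto simp: exponential_density_nonneg\<close>)
  also have "\<dots> = (\<integral>v. exponential_density \<mu> (t - v) * (indicator {..t} (t - v) * k v) \<partial>lborel)"
    by (subst lborel_integral_real_affine[where c="-1" and t=t]) simp_all
  also have "\<dots> = (\<integral>v. exp (- \<mu> * t) * (indicator {0..t} v *\<^sub>R ?K v) \<partial>lborel)"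
    by (rule Bochner_Integration.integral_cong)
       (auto simp: indicator_def exponential_density_def algebra_simps simp flip: exp_add)
  also have "\<dots> = exp (- \<mu> * t) * (LINT v:{0..t}|lborel. ?K v)"
    by (simp add: set_lebesgue_integral_def)
  also have "(LINT v:{0..t}|lborel. ?K v) = integral {0..t} ?K"
    by (rule set_borel_integral_eq_integral(2)[OF int])
  finally have "F t s = exp (- \<mu> * t) * (s + integral {0..t} ?K)"
    by (simp add: algebra_simps)
  then have "F t s * exp (\<mu> * t) = (exp (- \<mu> * t) * exp (\<mu> * t)) * (s + integral {0..t} ?K)"
    by (simp add: algebra_simps)
  then show "F t s * exp (\<mu> * t) = s + integral {0..t} (\<lambda>v. \<mu> * exp (\<mu> * v) * pgf p (F v s))"
    by (simp add: k_def flip: exp_add)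
qed

lemma F_0: "0 \<le> s \<Longrightarrow> s \<le> 1 \<Longrightarrow> F 0 s = s"
  using F_integral_equation(2)[of s 0] by simp

lemma F_eq:
  assumes "0 \<le> s" "s \<le> 1" "0 \<le> t"
  shows "F t s = exp (- \<mu> * t) * (s + integral {0..t} (\<lambda>v. \<mu> * exp (\<mu> * v) * pgf p (F v s)))"
proof -
  have "exp (- \<mu> * t) * exp (\<mu> * t) = 1" by (simp flip: exp_add)
  then show ?thesis
    unfolding F_integral_equation(2)[OF assms, symmetric] by (simp add: ac_simps)
qed

lemma continuous_on_F:
  assumes s: "0 \<le> s" "s \<le> 1"
  shows "continuous_on {0..b} (\<lambda>t. F t s)"
proof (cases "0 \<le> b")
  case True
  have "continuous_on {0..b} (\<lambda>t. exp (- \<mu> * t) * (s + integral {0..t} (\<lambda>v. \<mu> * exp (\<mu> * v) * pgf p (F v s))))"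
    by (intro continuous_intros indefinite_integral_continuous_1 F_integral_equation s True)
  then show ?thesis
    by (rule continuous_on_eq) (use F_eq[OF s] in auto)
qed simp

lemma F_backward_equation:
  assumes s: "0 \<le> s" "s \<le> 1" and t: "0 \<le> t" "t \<le> b"
  shows "((\<lambda>t. F t s) has_real_derivative \<mu> * (pgf p (F t s) - F t s)) (at t within {0..b})"
proof -
  let ?K = "\<lambda>v. \<mu> * exp (\<mu> * v) * pgf p (F v s)"
  have cont: "continuous_on {0..b} ?K"
    by (intro continuous_intros continuous_on_compose2[OF continuous_on_pgf continuous_on_F[OF s]])
       (use bp_F_bounds[OF \<mu>_pos s] in auto)
  have D: "((\<lambda>t. integral {0..t} ?K) has_real_derivative ?K t) (at t within {0..b})"
    by (rule integral_has_real_derivative[OF cont]) (use t in auto)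
  have "((\<lambda>t. exp (- \<mu> * t) * (s + integral {0..t} ?K)) has_real_derivative
      exp (- \<mu> * t) * (- \<mu>) * (s + integral {0..t} ?K) + ?K t * exp (- \<mu> * t)) (at t within {0..b})"
    by (rule derivative_eq_intros D refl | simp)+
  also have "exp (- \<mu> * t) * (- \<mu>) * (s + integral {0..t} ?K) + ?K t * exp (- \<mu> * t)
      = - \<mu> * (exp (- \<mu> * t) * (s + integral {0..t} ?K)) + \<mu> * (exp (\<mu> * t) * exp (- \<mu> * t)) * pgf p (F t s)"
    by (simp add: algebra_simps)
  also have "\<dots> = \<mu> * (pgf p (F t s) - F t s)"
    unfolding F_eq[OF s t(1), symmetric] by (simp add: algebra_simps flip: exp_add)
  finally have "((\<lambda>t. exp (- \<mu> * t) * (s + integral {0..t} ?K)) has_real_derivative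
      \<mu> * (pgf p (F t s) - F t s)) (at t within {0..b})" .
  then show ?thesis
    by (rule has_field_derivative_transform_within[where d=1]) (use t F_eq[OF s] in auto)
qed

text \<open>
  The ancestor alone survives up to time \<open>t\<close> with probability \<open>exp (- \<mu> t)\<close>.
\<close>
lemma F_le:
  assumes s: "0 \<le> s" "s \<le> 1" and t: "0 \<le> t"
  shows "F t s \<le> 1 - (1 - s) * exp (- \<mu> * t)"
proof -
  let ?K = "\<lambda>v. \<mu> * exp (\<mu> * v) * pgf p (F v s)"
  have hi: "((\<lambda>v. \<mu> * exp (\<mu> * v)) has_integral exp (\<mu> * t) - exp (\<mu> * 0)) {0..t}"
    by (rule fundamental_theorem_of_calculus[OF t])
       (auto intro!: derivative_eq_intros simp flip: has_real_derivative_iff_has_vector_derivative)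
  have "integral {0..t} ?K \<le> exp (\<mu> * t) - exp (\<mu> * 0)"
  proof (rule has_integral_le[OF integrable_integral[OF F_integral_equation(1)[OF s t]] hi])
    fix v assume "v \<in> {0..t}"
    have "pgf p (F v s) \<le> 1"
      using bp_F_bounds[OF \<mu>_pos s, of p v] by (intro pgf_le_1)
    then show "?K v \<le> \<mu> * exp (\<mu> * v)"
      using \<mu>_pos by (simp add: mult_left_le)
  qed
  then have "F t s \<le> exp (- \<mu> * t) * (s + (exp (\<mu> * t) - 1))"
    unfolding F_eq[OF s t] by (intro mult_left_mono) auto
  also have "\<dots> = exp (- \<mu> * t) * exp (\<mu> * t) - (1 - s) * exp (- \<mu> * t)"
    by (simp only: algebra_simps)
  also have "exp (- \<mu> * t) * exp (\<mu> * t) = 1"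
    by (simp flip: exp_add)
  finally show ?thesis .
qed

lemma F_less_1: "0 \<le> s \<Longrightarrow> s < 1 \<Longrightarrow> 0 \<le> t \<Longrightarrow> F t s < 1"
  using F_le[of s t] by (smt (verit) exp_gt_zero zero_less_mult_iff)

text \<open>
  Up to the factor \<open>\<mu>\<close> the time which the backward equation needs to move from \<open>0\<close> to \<open>y\<close>; in the variable
  \<open>1 / (1 - y)\<close> it is the function \<open>V\<close>.
\<close>
definition G :: "real \<Rightarrow> real" where
  "G y = integral {0..y} (\<lambda>u. 1 / (pgf p u - u))"

lemma continuous_on_rate: "c < 1 \<Longrightarrow> continuous_on {0..c} (\<lambda>u. 1 / (pgf p u - u))"
  by (intro continuous_intros continuous_on_subset[OF continuous_on_pgf])
     (use pgf_gt in force)+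

lemma G_0 [simp]: "G 0 = 0" by (simp add: G_def)

lemma G_has_derivative:
  "0 \<le> y \<Longrightarrow> y \<le> c \<Longrightarrow> c < 1 \<Longrightarrow> (G has_real_derivative 1 / (pgf p y - y)) (at y within {0..c})"
  unfolding G_def by (rule integral_has_real_derivative[OF continuous_on_rate]) auto

lemma continuous_on_G: "c < 1 \<Longrightarrow> continuous_on {0..c} G"
  by (rule DERIV_continuous_on[OF G_has_derivative]) auto

lemma G_strict_mono:
  assumes "0 \<le> x" "x < y" "y < 1" shows "G x < G y"
proof (rule DERIV_pos_imp_increasing_open[OF assms(2)])
  fix z assume z: "x < z" "z < y"
  have "(G has_real_derivative 1 / (pgf p z - z)) (at z within {0..y})"
    by (rule G_has_derivative) (use assms z in auto)
  moreover have "at z within {0..y} = at z"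
    by (rule at_within_Icc_at) (use assms z in auto)
  ultimately show "\<exists>d. (G has_real_derivative d) (at z) \<and> 0 < d"
    using pgf_gt[of z] assms z by (intro exI[of _ "1 / (pgf p z - z)"]) auto
next
  show "continuous_on {x..y} G"
    by (rule continuous_on_subset[OF continuous_on_G[OF assms(3)]]) (use assms in auto)
qed

lemma G_less_iff: "0 \<le> x \<Longrightarrow> x < 1 \<Longrightarrow> 0 \<le> y \<Longrightarrow> y < 1 \<Longrightarrow> G x < G y \<longleftrightarrow> x < y"
  using G_strict_mono[of x y] G_strict_mono[of y x] by (cases x y rule: linorder_cases) auto

lemma G_eq_iff: "0 \<le> x \<Longrightarrow> x < 1 \<Longrightarrow> 0 \<le> y \<Longrightarrow> y < 1 \<Longrightarrow> G x = G y \<longleftrightarrow> x = y"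
  using G_less_iff[of x y] G_less_iff[of y x] by (cases x y rule: linorder_cases) auto

lemma G_nonneg: "0 \<le> x \<Longrightarrow> x < 1 \<Longrightarrow> 0 \<le> G x"
  using G_strict_mono[of 0 x] by (cases "x = 0") auto

lemma F_nonneg: "0 \<le> s \<Longrightarrow> s \<le> 1 \<Longrightarrow> 0 \<le> F t s"
  by (rule bp_F_bounds[OF \<mu>_pos])

text \<open>
  Separation of variables: along a solution of the backward equation \<open>G\<close> grows at the constant rate \<open>\<mu>\<close>.
\<close>
lemma G_F:
  assumes s: "0 \<le> s" "s < 1" and t: "0 \<le> t"
  shows "G (F t s) = G s + \<mu> * t"
proof -
  define c where "c = 1 - (1 - s) * exp (- \<mu> * t)"
  have c: "c < 1" using s by (simp add: c_def)
  have Fc: "F v s \<in> {0..c}" if "v \<in> {0..t}" for v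
  proof -
    have "exp (- \<mu> * t) \<le> exp (- \<mu> * v)" using that \<mu>_pos by simp
    then have "(1 - s) * exp (- \<mu> * t) \<le> (1 - s) * exp (- \<mu> * v)"
      using s by (intro mult_left_mono) auto
    moreover have "F v s \<le> 1 - (1 - s) * exp (- \<mu> * v)" "0 \<le> F v s"
      using F_le[of s v] F_nonneg[of s v] s that by auto
    ultimately show ?thesis
      unfolding c_def atLeastAtMost_iff by linarith
  qed
  have "\<exists>C. \<forall>v\<in>{0..t}. G (F v s) - \<mu> * v = C"
  proof (rule has_field_derivative_zero_constant)
    fix v assume v: "v \<in> {0..t}"
    have "((\<lambda>v. F v s) has_real_derivative \<mu> * (pgf p (F v s) - F v s)) (at v within {0..t})"
      by (rule F_backward_equation) (use s v in auto)
    moreover have "(G has_real_derivative 1 / (pgf p (F v s) - F v s)) (at (F v s) within (\<lambda>v. F v s) ` {0..t})"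
      by (rule DERIV_subset[OF G_has_derivative[OF _ _ c]]) (use Fc v in auto)
    ultimately have "(G \<circ> (\<lambda>v. F v s) has_real_derivative
        1 / (pgf p (F v s) - F v s) * (\<mu> * (pgf p (F v s) - F v s))) (at v within {0..t})"
      by (rule DERIV_image_chain[rotated])
    moreover have "pgf p (F v s) - F v s \<noteq> 0"
      using pgf_gt[of "F v s"] Fc[OF v] c by auto
    ultimately have "((\<lambda>v. G (F v s)) has_real_derivative \<mu>) (at v within {0..t})"
      by (simp add: o_def)
    then show "((\<lambda>v. G (F v s) - \<mu> * v) has_real_derivative 0) (at v within {0..t})"
      by (auto intro!: derivative_eq_intros)
  qed simp
  then obtain C where C: "\<And>v. v \<in> {0..t} \<Longrightarrow> G (F v s) - \<mu> * v = C" by blast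
  from C[of 0] C[of t] show ?thesis using t s by (simp add: F_0)
qed

text \<open>
  Both sides have the same image under \<open>G\<close>, which is injective: the initial value \<open>s\<close> is a time shift.
\<close>
lemma F_eq_F_0:
  assumes s: "0 \<le> s" "s < 1" and t: "0 \<le> t"
  shows "F t s = F (t + G s / \<mu>) 0"
proof -
  have 0: "0 \<le> t + G s / \<mu>" using t \<mu>_pos G_nonneg[OF s] by simp
  have "G (F t s) = G (F (t + G s / \<mu>) 0)"
    unfolding G_F[OF s t] G_F[OF order_refl zero_less_one 0] using \<mu>_pos by (simp add: field_simps)
  then show ?thesis
    using s t 0 by (simp add: G_eq_iff F_nonneg F_less_1)
qed

definition surv :: "real \<Rightarrow> real" where "surv t = 1 - F t 0"

lemma surv_pos: "0 \<le> t \<Longrightarrow> 0 < surv t"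
  by (simp add: surv_def F_less_1)

lemma surv_le_1: "surv t \<le> 1"
  by (simp add: surv_def F_nonneg)

lemma G_surv: "0 \<le> t \<Longrightarrow> G (1 - surv t) = \<mu> * t"
  by (simp add: surv_def G_F)

lemma surv_strict_antimono: "0 \<le> x \<Longrightarrow> x < y \<Longrightarrow> surv y < surv x"
  using G_less_iff[of "1 - surv x" "1 - surv y"] surv_pos[of x] surv_pos[of y] surv_le_1[of x] surv_le_1[of y] \<mu>_pos
  by (simp add: G_surv)

lemma surv_antimono: "0 \<le> x \<Longrightarrow> x \<le> y \<Longrightarrow> surv y \<le> surv x"
  using surv_strict_antimono[of x y] by (cases "x = y") auto

lemma surv_tendsto_0: "(surv \<longlongrightarrow> 0) at_top"
proof (rule order_tendstoI)
  fix c :: real assume "c < 0"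
  show "eventually (\<lambda>t. c < surv t) at_top"
    using eventually_ge_at_top[of 0]
  proof eventually_elim
    case (elim t)
    then show ?case using surv_pos[of t] \<open>c < 0\<close> by linarith
  qed
next
  fix c :: real assume c: "0 < c"
  define d where "d = min c 1"
  have d: "0 < d" "d \<le> 1" "d \<le> c" using c by (auto simp: d_def)
  show "eventually (\<lambda>t. surv t < c) at_top"
    using eventually_gt_at_top[of "max 0 (G (1 - d) / \<mu>)"]
  proof eventually_elim
    case (elim t)
    then have "G (1 - d) < G (1 - surv t)"
      using \<mu>_pos by (simp add: G_surv field_simps)
    then have "1 - d < 1 - surv t"
      using d elim surv_pos[of t] surv_le_1[of t] by (subst (asm) G_less_iff) auto
    then show ?case using d by simp
  qed
qed

lemma bp_V_eq: assumes "1 \<le> x" shows "bp_V p x = G (1 - 1 / x)"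
proof -
  have "set_integrable lborel {0..1 - 1 / x} (\<lambda>u. 1 / (pgf p u - u))"
    by (rule borel_integrable_atLeastAtMost') (use assms in \<open>auto intro!: continuous_on_rate\<close>)
  from set_borel_integral_eq_integral(2)[OF this] show ?thesis
    by (simp add: bp_V_def G_def)
qed

lemma bp_W_eq: assumes "0 \<le> t" shows "bp_W p (\<mu> * t) = 1 / surv t"
  unfolding bp_W_def
proof (rule inv_into_f_eq)
  show "inj_on (bp_V p) {1..}"
  proof (rule inj_onI)
    fix x y :: real assume xy: "x \<in> {1..}" "y \<in> {1..}" "bp_V p x = bp_V p y"
    then have "1 - 1 / x = 1 - 1 / y" by (simp add: bp_V_eq G_eq_iff)
    then show "x = y" by simp
  qed
  show "1 / surv t \<in> {1..}" using surv_pos[OF assms] surv_le_1[of t] by simp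
  then show "bp_V p (1 / surv t) = \<mu> * t" by (simp add: bp_V_eq G_surv assms)
qed

end

section \<open>The generating functional of the arrivals\<close>

lemma (in prob_space) expectation_power_nat:
  fixes N :: "'a \<Rightarrow> nat" and z :: real
  assumes N[measurable]: "N \<in> measurable M (count_space UNIV)" and z: "0 \<le> z" "z \<le> 1"
  shows "(\<lambda>n. z ^ n * \<P>(\<omega> in M. N \<omega> = n)) sums expectation (\<lambda>\<omega>. z ^ N \<omega>)"
proof -
  have eq: "expectation (\<lambda>\<omega>. \<Sum>n<m. z ^ n * of_bool (N \<omega> = n)) = (\<Sum>n<m. z ^ n * \<P>(\<omega> in M. N \<omega> = n))" for m
  proof -
    have "expectation (\<lambda>\<omega>. of_bool (N \<omega> = n) :: real) = \<P>(\<omega> in M. N \<omega> = n)" for n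
    proof -
      have "expectation (\<lambda>\<omega>. of_bool (N \<omega> = n) :: real) = expectation (indicator {\<omega> \<in> space M. N \<omega> = n})"
        by (rule Bochner_Integration.integral_cong) (auto simp: indicator_def)
      then show ?thesis by simp
    qed
    moreover have "integrable M (\<lambda>\<omega>. z ^ n * of_bool (N \<omega> = n))" for n
      by (rule integrable_const_bound[where B=1]) (use z in \<open>auto simp: power_le_one\<close>)
    ultimately show ?thesis
      by (subst Bochner_Integration.integral_sum) (simp_all del: sum_mult_of_bool_eq)
  qed
  have part: "(\<Sum>n<m. z ^ n * of_bool (N \<omega> = n)) = (if N \<omega> < m then z ^ N \<omega> else 0)" for m \<omega>
    by (simp add: of_bool_def if_distrib[of "(*) _"] sum.delta' cong: if_cong)
  have "(\<lambda>m. expectation (\<lambda>\<omega>. \<Sum>n<m. z ^ n * of_bool (N \<omega> = n))) \<longlonglongrightarrow> expectation (\<lambda>\<omega>. z ^ N \<omega>)"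
  proof (rule integral_dominated_convergence[where w="\<lambda>_. 1"])
    show "AE \<omega> in M. (\<lambda>m. \<Sum>n<m. z ^ n * of_bool (N \<omega> = n)) \<longlonglongrightarrow> z ^ N \<omega>"
    proof (rule AE_I2)
      fix \<omega>
      show "(\<lambda>m. \<Sum>n<m. z ^ n * of_bool (N \<omega> = n)) \<longlonglongrightarrow> z ^ N \<omega>"
        unfolding part
        by (rule tendsto_eventually, rule eventually_mono[OF eventually_gt_at_top[of "N \<omega>"]]) simp
    qed
    show "AE \<omega> in M. norm (\<Sum>n<m. z ^ n * of_bool (N \<omega> = n)) \<le> 1" for m
      unfolding part using z by (auto simp: power_le_one)
  qed auto
  then show ?thesis unfolding eq sums_def .
qed

text \<open>
  Half-open intervals avoid the point 0, where the sign of an intensity is unspecified.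
\<close>
lemma mean_measure_diff:
  assumes t: "set_integrable lborel {0..t} r" and st: "0 \<le> s" "s \<le> t"
  shows "set_integrable lborel {s<..t} r" "mean_measure r t - mean_measure r s = (LBINT u:{s<..t}. r u)"
proof -
  show i: "set_integrable lborel {s<..t} r"
    by (rule set_integrable_subset[OF t]) (use st in auto)
  have j: "set_integrable lborel {0..s} r"
    by (rule set_integrable_subset[OF t]) (use st in auto)
  have "{0..t} = {0..s} \<union> {s<..t}" using st by auto
  then have "mean_measure r t = (LBINT u:{0..s} \<union> {s<..t}. r u)" by (simp add: mean_measure_def)
  also have "\<dots> = mean_measure r s + (LBINT u:{s<..t}. r u)"
    unfolding mean_measure_def by (rule set_integral_Un) (use i j in auto)
  finally show "mean_measure r t - mean_measure r s = (LBINT u:{s<..t}. r u)" by simp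
qed

context nonhomogeneous_poisson_process
begin

abbreviation R where "R \<equiv> mean_measure r"

lemma mean_measure_Ioc:
  assumes "0 \<le> s" "s \<le> t"
  shows "set_integrable lborel {s<..t} r" "R t - R s = (LBINT u:{s<..t}. r u)"
  using mean_measure_diff[OF intensity_integrable assms] assms by auto

lemma expectation_power_increment:
  assumes st: "0 \<le> s" "s \<le> t" and z: "0 \<le> z" "z \<le> 1"
  shows "expectation (\<lambda>\<omega>. z ^ (\<nu> t \<omega> - \<nu> s \<omega>)) = exp (- ((R t - R s) * (1 - z)))"
proof -
  have m: "(\<lambda>\<omega>. \<nu> t \<omega> - \<nu> s \<omega>) \<in> measurable M (count_space UNIV)"
  proof -
    have [measurable]: "\<nu> t \<in> M \<rightarrow>\<^sub>M count_space UNIV" "\<nu> s \<in> M \<rightarrow>\<^sub>M count_space UNIV"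
      using st by (auto intro!: count_measurable)
    show ?thesis by measurable
  qed
  let ?m = "R t - R s"
  have "(\<lambda>n. (z * ?m) ^ n /\<^sub>R fact n) sums exp (z * ?m)"
    by (rule exp_converges)
  then have "(\<lambda>n. (z * ?m) ^ n /\<^sub>R fact n * exp (- ?m)) sums (exp (z * ?m) * exp (- ?m))"
    by (rule sums_mult2)
  moreover have "(z * ?m) ^ n /\<^sub>R fact n * exp (- ?m) = z ^ n * \<P>(\<omega> in M. \<nu> t \<omega> - \<nu> s \<omega> = n)" for n
    unfolding count_increments_poisson[OF st] by (simp add: power_mult_distrib divide_inverse mult_ac)
  ultimately have "expectation (\<lambda>\<omega>. z ^ (\<nu> t \<omega> - \<nu> s \<omega>)) = exp (z * ?m) * exp (- ?m)"
    using expectation_power_nat[OF m z] by (simp add: sums_unique2)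
  then show ?thesis by (simp add: algebra_simps flip: exp_add)
qed

text \<open>
  The infimum defining a jump time is attained, by right-continuity of the count.
\<close>
lemma jump_time_le_iff:
  assumes \<omega>: "\<omega> \<in> space M" and t: "0 \<le> t" and k: "k \<le> \<nu> t \<omega>" and u: "0 \<le> u"
  shows "jump_time \<nu> k \<omega> \<le> u \<longleftrightarrow> k \<le> \<nu> u \<omega>"
proof -
  let ?A = "{t. 0 \<le> t \<and> k \<le> \<nu> t \<omega>}"
  let ?S = "jump_time \<nu> k \<omega>"
  have ne: "?A \<noteq> {}" and bdd: "bdd_below ?A"
    using t k by (auto intro: bdd_belowI[of _ 0])
  have S0: "0 \<le> ?S" unfolding jump_time_def by (rule cInf_greatest[OF ne]) auto
  have mono: "\<nu> a \<omega> \<le> \<nu> b \<omega>" if "0 \<le> a" "a \<le> b" for a b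
    using mono_onD[OF count_mono[OF \<omega>], of a b] that by auto
  have "((\<lambda>u. real (\<nu> u \<omega>)) \<longlongrightarrow> real (\<nu> ?S \<omega>)) (at_right ?S)"
    using count_right_continuous[OF \<omega> S0] by (simp add: continuous_within)
  moreover have "eventually (\<lambda>v. real k \<le> real (\<nu> v \<omega>)) (at_right ?S)"
    using eventually_at_right_less[of ?S]
  proof eventually_elim
    case (elim v)
    then obtain a where "a \<in> ?A" "a < v"
      unfolding jump_time_def using cInf_less_iff[OF ne bdd] by blast
    then show ?case using mono[of a v] by auto
  qed
  ultimately have "real k \<le> real (\<nu> ?S \<omega>)"
    by (rule tendsto_lowerbound) simp
  then have kS: "k \<le> \<nu> ?S \<omega>" by simp
  show ?thesis
  proof
    assume "?S \<le> u" then show "k \<le> \<nu> u \<omega>" using kS mono[OF S0] by force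
  next
    assume "k \<le> \<nu> u \<omega>" then show "?S \<le> u"
      unfolding jump_time_def using u bdd by (intro cInf_lower) auto
  qed
qed

lemma jump_time_nonneg:
  assumes "0 \<le> t" "k \<le> \<nu> t \<omega>" shows "0 \<le> jump_time \<nu> k \<omega>"
  unfolding jump_time_def by (rule cInf_greatest) (use assms in auto)

lemma jump_time_le: "\<omega> \<in> space M \<Longrightarrow> 0 \<le> t \<Longrightarrow> k \<le> \<nu> t \<omega> \<Longrightarrow> jump_time \<nu> k \<omega> \<le> t"
  using jump_time_le_iff by blast

text \<open>
  Jump times are functions of the arrivals only, which is needed for their independence of all families; therefore
  the statement is about an arbitrary sigma-algebra containing the arrival events.  The value 0 replaces the infimum
  over a possibly empty set.
\<close>
lemma jump_time_measurable:
  assumes A: "sigma_algebra (space M) A" and t: "0 \<le> t"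
    and \<nu>A: "\<And>u n. 0 \<le> u \<Longrightarrow> {\<omega> \<in> space M. n \<le> \<nu> u \<omega>} \<in> A"
  shows "(\<lambda>\<omega>. if k \<le> \<nu> t \<omega> then jump_time \<nu> k \<omega> else 0) \<in> borel_measurable (sigma (space M) A)"
proof -
  interpret A: sigma_algebra "space M" A by fact
  have sets: "sets (sigma (space M) A) = A" by (simp add: A.sigma_sets_eq A.space_closed)
  have sp: "space (sigma (space M) A) = space M" by simp
  show ?thesis
  proof (rule borel_measurableI_le)
    fix u :: real
    show "{\<omega> \<in> space (sigma (space M) A). (if k \<le> \<nu> t \<omega> then jump_time \<nu> k \<omega> else 0) \<le> u} \<in> sets (sigma (space M) A)"
    proof (cases "0 \<le> u")
      case True
      have "{\<omega> \<in> space M. (if k \<le> \<nu> t \<omega> then jump_time \<nu> k \<omega> else 0) \<le> u} =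
          {\<omega> \<in> space M. k \<le> \<nu> u \<omega>} \<union> (space M - {\<omega> \<in> space M. k \<le> \<nu> t \<omega>})" (is "?L = ?R")
      proof (intro set_eqI)
        fix \<omega> show "\<omega> \<in> ?L \<longleftrightarrow> \<omega> \<in> ?R"
          using jump_time_le_iff[of \<omega> t k u] True t by auto
      qed
      then show ?thesis unfolding sets sp
        by (simp only:) (intro A.Un A.Diff A.top \<nu>A True t)
    next
      case False
      have "{\<omega> \<in> space M. (if k \<le> \<nu> t \<omega> then jump_time \<nu> k \<omega> else 0) \<le> u} = {}"
        using False jump_time_nonneg[OF t] by (force split: if_splits)
      then show ?thesis unfolding sets sp by (simp only: A.empty_sets)
    qed
  qed
qed

text \<open>
  Rounding the jump times up to the grid of mesh \<open>h\<close> groups the jumps by the grid cell in which they fall.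
\<close>
lemma prod_jump_times_step:
  assumes \<omega>: "\<omega> \<in> space M" and h: "0 < h"
  shows "(\<Prod>k=1..\<nu> (real m * h) \<omega>. \<phi> (of_int \<lceil>jump_time \<nu> k \<omega> / h\<rceil> * h)) =
    (\<Prod>i<m. \<phi> (real (Suc i) * h) ^ (\<nu> (real (Suc i) * h) \<omega> - \<nu> (real i * h) \<omega>))"
proof (induction m)
  case 0
  then show ?case using count_0[OF \<omega>] by simp
next
  case (Suc m)
  let ?a = "\<nu> (real m * h) \<omega>" and ?b = "\<nu> (real (Suc m) * h) \<omega>"
  have le: "?a \<le> ?b"
    using mono_onD[OF count_mono[OF \<omega>], of "real m * h" "real (Suc m) * h"] h by (auto simp: algebra_simps)
  have step: "of_int \<lceil>jump_time \<nu> k \<omega> / h\<rceil> * h = real (Suc m) * h" if k: "k \<in> {Suc ?a..?b}" for k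
  proof -
    have "jump_time \<nu> k \<omega> \<le> real (Suc m) * h"
      by (rule jump_time_le[OF \<omega>]) (use h k in auto)
    moreover have "\<not> jump_time \<nu> k \<omega> \<le> real m * h"
      using jump_time_le_iff[OF \<omega>, of "real (Suc m) * h" k "real m * h"] h k by auto
    ultimately have "\<lceil>jump_time \<nu> k \<omega> / h\<rceil> = int (Suc m)"
      using h by (intro ceiling_unique) (auto simp: field_simps)
    then show ?thesis by simp
  qed
  have "(\<Prod>k=1..?b. \<phi> (of_int \<lceil>jump_time \<nu> k \<omega> / h\<rceil> * h)) =
     (\<Prod>k=1..?a. \<phi> (of_int \<lceil>jump_time \<nu> k \<omega> / h\<rceil> * h)) * (\<Prod>k=Suc ?a..?b. \<phi> (of_int \<lceil>jump_time \<nu> k \<omega> / h\<rceil> * h))"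
    using le by (subst prod.union_disjoint[symmetric]) (auto intro!: prod.cong)
  also have "(\<Prod>k=Suc ?a..?b. \<phi> (of_int \<lceil>jump_time \<nu> k \<omega> / h\<rceil> * h)) = \<phi> (real (Suc m) * h) ^ (?b - ?a)"
  proof -
    have "(\<Prod>k=Suc ?a..?b. \<phi> (of_int \<lceil>jump_time \<nu> k \<omega> / h\<rceil> * h)) = (\<Prod>k=Suc ?a..?b. \<phi> (real (Suc m) * h))"
      by (rule prod.cong[OF refl]) (simp only: step)
    then show ?thesis by simp
  qed
  finally show ?case using Suc by (simp add: mult.commute)
qed

lemma set_integral_intensity_step:
  assumes h: "0 < h" and w[measurable]: "w \<in> borel_measurable borel" and w1: "\<And>u. \<bar>w u\<bar> \<le> 1"
  shows "set_integrable lborel {0..real m * h} (\<lambda>u. r u * w (of_int \<lceil>u / h\<rceil> * h))"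
    and "(LBINT u:{0..real m * h}. r u * w (of_int \<lceil>u / h\<rceil> * h)) =
      (\<Sum>i<m. (R (real (Suc i) * h) - R (real i * h)) * w (real (Suc i) * h))"
proof -
  let ?w = "\<lambda>u. w (of_int \<lceil>u / h\<rceil> * h)"
  have int: "set_integrable lborel A (\<lambda>u. r u * ?w u)" if A: "set_integrable lborel A r" for A
    using A unfolding set_integrable_def
  proof (rule Bochner_Integration.integrable_bound)
    have "(\<lambda>u. (indicator A u *\<^sub>R r u) * ?w u) \<in> borel_measurable lborel"
      using borel_measurable_integrable[OF A[unfolded set_integrable_def]] by measurable
    then show "(\<lambda>u. indicator A u *\<^sub>R (r u * ?w u)) \<in> borel_measurable lborel"
      by (simp add: mult.assoc)
    show "AE u in lborel. norm (indicator A u *\<^sub>R (r u * ?w u)) \<le> norm (indicator A u *\<^sub>R r u)"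
      using w1 by (auto simp: indicator_def abs_mult intro!: mult_left_le)
  qed
  show "set_integrable lborel {0..real m * h} (\<lambda>u. r u * ?w u)" for m :: nat
    by (intro int intensity_integrable) (use h in auto)
  show "(LBINT u:{0..real m * h}. r u * ?w u) =
      (\<Sum>i<m. (R (real (Suc i) * h) - R (real i * h)) * w (real (Suc i) * h))"
  proof (induction m)
    case 0
    have "set_integrable lborel {0..0} (\<lambda>u. r u * ?w u)"
      by (intro int intensity_integrable) simp
    from set_borel_integral_eq_integral(2)[OF this] show ?case by simp
  next
    case (Suc m)
    let ?a = "real m * h" and ?b = "real (Suc m) * h"
    have ab: "0 \<le> ?a" "?a \<le> ?b" using h by (auto simp: algebra_simps)
    have "{0..?b} = {0..?a} \<union> {?a<..?b}" using ab by auto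
    then have "(LBINT u:{0..?b}. r u * ?w u) = (LBINT u:{0..?a} \<union> {?a<..?b}. r u * ?w u)" by simp
    also have "\<dots> = (LBINT u:{0..?a}. r u * ?w u) + (LBINT u:{?a<..?b}. r u * ?w u)"
      by (intro set_integral_Un int intensity_integrable mean_measure_Ioc ab) auto
    also have "(LBINT u:{?a<..?b}. r u * ?w u) = (LBINT u:{?a<..?b}. r u * w ?b)"
    proof (rule set_lebesgue_integral_cong)
      show "\<forall>u. u \<in> {?a<..?b} \<longrightarrow> r u * ?w u = r u * w ?b"
      proof (intro allI impI)
        fix u assume "u \<in> {?a<..?b}"
        then have "\<lceil>u / h\<rceil> = int (Suc m)"
          using h by (intro ceiling_unique) (auto simp: field_simps)
        then show "r u * ?w u = r u * w ?b" by simp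
      qed
    qed simp
    also have "\<dots> = (R ?b - R ?a) * w ?b"
      unfolding mean_measure_Ioc(2)[OF ab] by simp
    finally show ?case unfolding Suc.IH by simp
  qed
qed

lemma expectation_prod_increments:
  assumes h: "0 < h" and \<phi>: "\<And>u. 0 \<le> \<phi> u" "\<And>u. \<phi> u \<le> 1"
  shows "expectation (\<lambda>\<omega>. \<Prod>i<m. \<phi> (real (Suc i) * h) ^ (\<nu> (real (Suc i) * h) \<omega> - \<nu> (real i * h) \<omega>)) =
    exp (- (\<Sum>i<m. (R (real (Suc i) * h) - R (real i * h)) * (1 - \<phi> (real (Suc i) * h))))"
proof -
  have "indep_vars (\<lambda>_. count_space UNIV) (\<lambda>i \<omega>. \<nu> (real (Suc i) * h) \<omega> - \<nu> (real i * h) \<omega>) (UNIV :: nat set)"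
    by (rule count_increments_indep) (use h in \<open>auto simp: mono_def\<close>)
  then have "indep_vars (\<lambda>_. count_space UNIV) (\<lambda>i \<omega>. \<nu> (real (Suc i) * h) \<omega> - \<nu> (real i * h) \<omega>) {..<m}"
    by (rule indep_vars_subset) simp
  then have ind: "indep_vars (\<lambda>_. borel) (\<lambda>i \<omega>. \<phi> (real (Suc i) * h) ^ (\<nu> (real (Suc i) * h) \<omega> - \<nu> (real i * h) \<omega>)) {..<m}"
    by (rule indep_vars_compose2[where Y="\<lambda>i n. \<phi> (real (Suc i) * h) ^ n"]) simp
  have "expectation (\<lambda>\<omega>. \<Prod>i<m. \<phi> (real (Suc i) * h) ^ (\<nu> (real (Suc i) * h) \<omega> - \<nu> (real i * h) \<omega>)) =
    (\<Prod>i<m. expectation (\<lambda>\<omega>. \<phi> (real (Suc i) * h) ^ (\<nu> (real (Suc i) * h) \<omega> - \<nu> (real i * h) \<omega>)))"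
  proof (rule indep_vars_lebesgue_integral[OF _ ind])
    fix i assume "i \<in> {..<m}"
    then have "(\<lambda>\<omega>. \<phi> (real (Suc i) * h) ^ (\<nu> (real (Suc i) * h) \<omega> - \<nu> (real i * h) \<omega>)) \<in> borel_measurable M"
      using ind unfolding indep_vars_def by blast
    then show "integrable M (\<lambda>\<omega>. \<phi> (real (Suc i) * h) ^ (\<nu> (real (Suc i) * h) \<omega> - \<nu> (real i * h) \<omega>))"
      using \<phi> by (intro integrable_const_bound[where B=1]) (auto simp: power_le_one)
  qed simp
  also have "\<dots> = (\<Prod>i<m. exp (- ((R (real (Suc i) * h) - R (real i * h)) * (1 - \<phi> (real (Suc i) * h)))))"
    by (intro prod.cong refl expectation_power_increment \<phi>) (use h in auto)
  finally show ?thesis by (simp add: exp_sum[symmetric] sum_negf)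
qed

lemma tendsto_ceiling_grid:
  assumes t: "0 < t" and u: "u \<in> {0..t}"
  defines "h \<equiv> \<lambda>n. t / real (Suc n)"
  shows "(\<lambda>n. of_int \<lceil>u / h n\<rceil> * h n) \<longlonglongrightarrow> u" "of_int \<lceil>u / h n\<rceil> * h n \<in> {0..t}"
proof -
  have h: "0 < h n" for n using t by (simp add: h_def)
  have lo: "u \<le> of_int \<lceil>u / h n\<rceil> * h n" for n
    using le_of_int_ceiling[of "u / h n"] by (subst (asm) pos_divide_le_eq[OF h])
  have hi: "of_int \<lceil>u / h n\<rceil> * h n \<le> u + h n" for n
  proof -
    have "of_int \<lceil>u / h n\<rceil> \<le> u / h n + 1" by (rule of_int_ceiling_le_add_one)
    then have "of_int \<lceil>u / h n\<rceil> * h n \<le> (u / h n + 1) * h n"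
      using h[of n] by (intro mult_right_mono) auto
    also have "\<dots> = u + h n" using h[of n] by (simp add: distrib_right)
    finally show ?thesis .
  qed
  have "h \<longlonglongrightarrow> 0" unfolding h_def by real_asymp
  then have lim_h: "(\<lambda>n. u + h n) \<longlonglongrightarrow> u + 0" by (intro tendsto_intros)
  show "(\<lambda>n. of_int \<lceil>u / h n\<rceil> * h n) \<longlonglongrightarrow> u"
  proof (rule tendsto_sandwich[where f="\<lambda>_. u" and h="\<lambda>n. u + h n"])
    show "(\<lambda>n. u + h n) \<longlonglongrightarrow> u" using lim_h by simp
    show "(\<lambda>n. u) \<longlonglongrightarrow> u" by (rule tendsto_const)
    show "eventually (\<lambda>n. u \<le> of_int \<lceil>u / h n\<rceil> * h n) sequentially" by (intro always_eventually allI lo)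
    show "eventually (\<lambda>n. of_int \<lceil>u / h n\<rceil> * h n \<le> u + h n) sequentially" by (intro always_eventually allI hi)
  qed
  have "u / h n = (u / t) * real (Suc n)" by (simp add: h_def)
  also have "\<dots> \<le> 1 * real (Suc n)"
    by (intro mult_right_mono) (use t u in auto)
  finally have "u / h n \<le> of_int (int (Suc n))" by simp
  then have "\<lceil>u / h n\<rceil> \<le> int (Suc n)" by (simp only: ceiling_le_iff)
  then have "of_int \<lceil>u / h n\<rceil> \<le> real (Suc n)" by linarith
  then have "of_int \<lceil>u / h n\<rceil> * h n \<le> real (Suc n) * h n" using h[of n] by (intro mult_right_mono) auto
  also have "\<dots> = t" by (simp add: h_def)
  finally show "of_int \<lceil>u / h n\<rceil> * h n \<in> {0..t}" using lo[of n] u by auto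
qed

text \<open>
  The probability generating functional.  For jump times rounded up to a grid it reduces to independent Poisson
  increments; as the grid is refined both sides converge, by continuity of \<open>\<phi>\<close> and dominated convergence.
\<close>
lemma expectation_prod_jump_times:
  assumes t: "0 < t" and [measurable]: "\<phi> \<in> borel_measurable borel"
    and \<phi>: "\<And>u. 0 \<le> \<phi> u" "\<And>u. \<phi> u \<le> 1" and cont: "continuous_on {0..t} \<phi>"
  shows "expectation (\<lambda>\<omega>. \<Prod>k=1..\<nu> t \<omega>. \<phi> (jump_time \<nu> k \<omega>)) = exp (- (LBINT u:{0..t}. r u * (1 - \<phi> u)))"
proof -
  define h where "h n = t / real (Suc n)" for n
  have h: "0 < h n" and mh: "real (Suc n) * h n = t" for n using t by (auto simp: h_def)
  define X where "X n \<omega> = (\<Prod>i<Suc n. \<phi> (real (Suc i) * h n) ^ (\<nu> (real (Suc i) * h n) \<omega> - \<nu> (real i * h n) \<omega>))" for n \<omega>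
  have X: "X n \<omega> = (\<Prod>k=1..\<nu> t \<omega>. \<phi> (of_int \<lceil>jump_time \<nu> k \<omega> / h n\<rceil> * h n))" if "\<omega> \<in> space M" for n \<omega>
    using prod_jump_times_step[OF that h[of n], of \<phi> "Suc n"] unfolding mh X_def by (rule sym)
  note grid = tendsto_ceiling_grid[OF t, folded h_def]
  have lim: "(\<lambda>n. \<phi> (of_int \<lceil>u / h n\<rceil> * h n)) \<longlonglongrightarrow> \<phi> u" if "u \<in> {0..t}" for u
    by (rule continuous_on_tendsto_compose[OF cont grid(1)[OF that] that]) (rule always_eventually, use grid(2)[OF that] in auto)
  have Xlim: "(\<lambda>n. X n \<omega>) \<longlonglongrightarrow> (\<Prod>k=1..\<nu> t \<omega>. \<phi> (jump_time \<nu> k \<omega>))" if \<omega>: "\<omega> \<in> space M" for \<omega>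
    unfolding X[OF \<omega>]
  proof (intro tendsto_prod lim)
    fix k assume "k \<in> {1..\<nu> t \<omega>}"
    then show "jump_time \<nu> k \<omega> \<in> {0..t}"
      using jump_time_nonneg[of t k \<omega>] jump_time_le[OF \<omega>, of t k] t by auto
  qed
  have Xm: "X n \<in> borel_measurable M" for n
  proof -
    have [measurable]: "\<nu> (real i * h n) \<in> M \<rightarrow>\<^sub>M count_space UNIV" for i :: nat
      by (rule count_measurable) (use h[of n] in auto)
    show ?thesis unfolding X_def by measurable
  qed
  have X0: "0 \<le> X n \<omega>" for n \<omega>
    unfolding X_def by (intro prod_nonneg ballI zero_le_power \<phi>)
  have X1: "X n \<omega> \<le> 1" for n \<omega>
    unfolding X_def by (intro prod_le_1 conjI zero_le_power power_le_one \<phi>)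
  have L1: "(\<lambda>n. expectation (X n)) \<longlonglongrightarrow> expectation (\<lambda>\<omega>. \<Prod>k=1..\<nu> t \<omega>. \<phi> (jump_time \<nu> k \<omega>))"
  proof (rule integral_dominated_convergence[where w="\<lambda>_. 1"])
    show "(\<lambda>\<omega>. \<Prod>k=1..\<nu> t \<omega>. \<phi> (jump_time \<nu> k \<omega>)) \<in> borel_measurable M"
      by (rule borel_measurable_LIMSEQ_real[OF Xlim Xm])
    show "AE \<omega> in M. (\<lambda>n. X n \<omega>) \<longlonglongrightarrow> (\<Prod>k=1..\<nu> t \<omega>. \<phi> (jump_time \<nu> k \<omega>))"
      by (rule AE_I2) (rule Xlim)
    show "AE \<omega> in M. norm (X n \<omega>) \<le> 1" for n
      by (rule AE_I2) (simp add: X0 X1)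
  qed (rule Xm, simp)
  have L2: "expectation (X n) = exp (- (LBINT u:{0..t}. r u * (1 - \<phi> (of_int \<lceil>u / h n\<rceil> * h n))))" for n
  proof -
    have "(\<lambda>u. 1 - \<phi> u) \<in> borel_measurable borel" by measurable
    moreover have "\<bar>1 - \<phi> u\<bar> \<le> 1" for u using \<phi>(1)[of u] \<phi>(2)[of u] by linarith
    ultimately have "(LBINT u:{0..real (Suc n) * h n}. r u * (1 - \<phi> (of_int \<lceil>u / h n\<rceil> * h n))) =
      (\<Sum>i<Suc n. (R (real (Suc i) * h n) - R (real i * h n)) * (1 - \<phi> (real (Suc i) * h n)))"
      by (rule set_integral_intensity_step(2)[OF h])
    moreover have "X n = (\<lambda>\<omega>. \<Prod>i<Suc n. \<phi> (real (Suc i) * h n) ^ (\<nu> (real (Suc i) * h n) \<omega> - \<nu> (real i * h n) \<omega>))"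
      by (rule ext) (rule X_def)
    ultimately show ?thesis
      by (simp only: expectation_prod_increments[where \<phi>=\<phi>, OF h \<phi>] mh)
  qed
  have L3: "(\<lambda>n. exp (- (LBINT u:{0..t}. r u * (1 - \<phi> (of_int \<lceil>u / h n\<rceil> * h n))))) \<longlonglongrightarrow>
      exp (- (LBINT u:{0..t}. r u * (1 - \<phi> u)))"
  proof (intro tendsto_exp tendsto_minus)
    have t0: "0 \<le> t" using t by simp
    note int = intensity_integrable[OF t0, unfolded set_integrable_def]
    have meas: "(\<lambda>u. indicator {0..t} u *\<^sub>R (r u * f u)) \<in> borel_measurable lborel"
      if "f \<in> borel_measurable borel" for f :: "real \<Rightarrow> real"
    proof -
      have "(\<lambda>u. (indicator {0..t} u *\<^sub>R r u) * f u) \<in> borel_measurable lborel"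
        by (intro borel_measurable_times borel_measurable_integrable[OF int])
           (use that in simp)
      then show ?thesis by (simp add: mult.assoc)
    qed
    show "(\<lambda>n. LBINT u:{0..t}. r u * (1 - \<phi> (of_int \<lceil>u / h n\<rceil> * h n))) \<longlonglongrightarrow> (LBINT u:{0..t}. r u * (1 - \<phi> u))"
      unfolding set_lebesgue_integral_def
    proof (rule integral_dominated_convergence[where w="\<lambda>u. norm (indicator {0..t} u *\<^sub>R r u)"])
      show "integrable lborel (\<lambda>u. norm (indicator {0..t} u *\<^sub>R r u))"
        using int by (rule integrable_norm)
      show "AE u in lborel. (\<lambda>n. indicator {0..t} u *\<^sub>R (r u * (1 - \<phi> (of_int \<lceil>u / h n\<rceil> * h n)))) \<longlonglongrightarrow>
          indicator {0..t} u *\<^sub>R (r u * (1 - \<phi> u))"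
      proof (rule AE_I2)
        fix u
        show "(\<lambda>n. indicator {0..t} u *\<^sub>R (r u * (1 - \<phi> (of_int \<lceil>u / h n\<rceil> * h n)))) \<longlonglongrightarrow>
          indicator {0..t} u *\<^sub>R (r u * (1 - \<phi> u))"
        proof (cases "u \<in> {0..t}")
          case True
          then show ?thesis by (intro tendsto_scaleR tendsto_mult tendsto_diff tendsto_const lim)
        next
          case False
          then show ?thesis by (simp only: indicator_simps scaleR_zero_left tendsto_const not_False_eq_True)
        qed
      qed
      show "AE u in lborel. norm (indicator {0..t} u *\<^sub>R (r u * (1 - \<phi> (of_int \<lceil>u / h n\<rceil> * h n))))
          \<le> norm (indicator {0..t} u *\<^sub>R r u)" for n
      proof (rule AE_I2)
        fix u
        have "\<bar>r u\<bar> * \<bar>1 - \<phi> (of_int \<lceil>u / h n\<rceil> * h n)\<bar> \<le> \<bar>r u\<bar>"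
        proof (rule mult_left_le)
          show "\<bar>1 - \<phi> (of_int \<lceil>u / h n\<rceil> * h n)\<bar> \<le> 1"
            using \<phi>(1)[of "of_int \<lceil>u / h n\<rceil> * h n"] \<phi>(2)[of "of_int \<lceil>u / h n\<rceil> * h n"] by linarith
        qed simp
        then show "norm (indicator {0..t} u *\<^sub>R (r u * (1 - \<phi> (of_int \<lceil>u / h n\<rceil> * h n))))
          \<le> norm (indicator {0..t} u *\<^sub>R r u)"
          by (cases "u \<in> {0..t}") (auto simp: abs_mult)
      qed
      show "(\<lambda>u. indicator {0..t} u *\<^sub>R (r u * (1 - \<phi> (of_int \<lceil>u / h n\<rceil> * h n)))) \<in> borel_measurable lborel" for n
        by (rule meas) measurable
      show "(\<lambda>u. indicator {0..t} u *\<^sub>R (r u * (1 - \<phi> u))) \<in> borel_measurable lborel"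
        by (rule meas) measurable
    qed
  qed
  show ?thesis
    by (rule LIMSEQ_unique[OF L1]) (unfold L2, rule L3)
qed

end

section \<open>The generating function of the process with immigration\<close>

text \<open>
  The identity maps from the sample space to two independent sub-sigma-algebras are independent random variables.
  So a quantity that depends on both may be integrated over two separate sample points, and the random
  objects involved need not be collected in a product space.
\<close>
lemma (in prob_space) expectation_indep_decouple:
  fixes f :: "'a \<times> 'a \<Rightarrow> real"
  assumes ind: "indep_set (sets N1) (sets N2)"
    and sp: "space N1 = space M" "space N2 = space M"
    and f: "f \<in> borel_measurable (N1 \<Otimes>\<^sub>M N2)" and b: "\<And>x. norm (f x) \<le> B"
  shows "expectation (\<lambda>\<omega>. f (\<omega>, \<omega>)) = expectation (\<lambda>\<omega>\<^sub>1. expectation (\<lambda>\<omega>\<^sub>2. f (\<omega>\<^sub>1, \<omega>\<^sub>2)))"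
proof -
  have sub: "sets N1 \<subseteq> sets M" "sets N2 \<subseteq> sets M"
    using indep_setD_ev1[OF ind] indep_setD_ev2[OF ind] by auto
  have pre: "(\<lambda>\<omega>. \<omega>) -` A \<inter> space M = A" if "A \<in> sets N" "space N = space M" for A and N :: "'a measure"
    using sets.sets_into_space[OF that(1)] that(2) by blast
  have id1: "(\<lambda>\<omega>. \<omega>) \<in> M \<rightarrow>\<^sub>M N1"
    by (rule measurableI) (use sub(1) sp(1) pre[OF _ sp(1)] in auto)
  have id2: "(\<lambda>\<omega>. \<omega>) \<in> M \<rightarrow>\<^sub>M N2"
    by (rule measurableI) (use sub(2) sp(2) pre[OF _ sp(2)] in auto)
  have g: "sigma_sets (space M) {(\<lambda>\<omega>. \<omega>) -` A \<inter> space M |A. A \<in> sets N} = sets N"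
    if "space N = space M" for N :: "'a measure"
  proof -
    have "{(\<lambda>\<omega>. \<omega>) -` A \<inter> space M |A. A \<in> sets N} = sets N"
      using pre[OF _ that] by (intro equalityI subsetI) (auto intro!: exI)
    then show ?thesis using sets.sigma_sets_eq[of N] that by simp
  qed
  have iv: "indep_var N1 (\<lambda>\<omega>. \<omega>) N2 (\<lambda>\<omega>. \<omega>)"
    unfolding indep_var_eq g[OF sp(1)] g[OF sp(2)] using id1 id2 ind by blast
  let ?D1 = "distr M N1 (\<lambda>\<omega>. \<omega>)" and ?D2 = "distr M N2 (\<lambda>\<omega>. \<omega>)"
  have eq: "?D1 \<Otimes>\<^sub>M ?D2 = distr M (N1 \<Otimes>\<^sub>M N2) (\<lambda>\<omega>. (\<omega>, \<omega>))"
    using iv unfolding indep_var_distribution_eq by simp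
  interpret D1: prob_space ?D1 by (rule prob_space_distr[OF id1])
  interpret D2: prob_space ?D2 by (rule prob_space_distr[OF id2])
  interpret D12: pair_prob_space ?D1 ?D2 ..
  have fD: "f \<in> borel_measurable (?D1 \<Otimes>\<^sub>M ?D2)"
    using f measurable_cong_sets[OF sets_pair_measure_cong[OF sets_distr sets_distr] refl] by blast
  have sec: "(\<lambda>\<omega>\<^sub>2. f (\<omega>\<^sub>1, \<omega>\<^sub>2)) \<in> borel_measurable N2" if "\<omega>\<^sub>1 \<in> space M" for \<omega>\<^sub>1
    by (rule measurable_compose[OF measurable_Pair1' f]) (use that sp in simp)
  have "expectation (\<lambda>\<omega>. f (\<omega>, \<omega>)) = (\<integral>x. f x \<partial>distr M (N1 \<Otimes>\<^sub>M N2) (\<lambda>\<omega>. (\<omega>, \<omega>)))"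
    by (rule integral_distr[symmetric, OF measurable_Pair[OF id1 id2] f])
  also have "\<dots> = (\<integral>\<omega>\<^sub>1. \<integral>\<omega>\<^sub>2. f (\<omega>\<^sub>1, \<omega>\<^sub>2) \<partial>?D2 \<partial>?D1)"
    unfolding eq[symmetric]
    by (rule D12.integral_fst'[symmetric]) (rule D12.integrable_const_bound[where B=B], use fD b in auto)
  also have "\<dots> = expectation (\<lambda>\<omega>\<^sub>1. \<integral>\<omega>\<^sub>2. f (\<omega>\<^sub>1, \<omega>\<^sub>2) \<partial>?D2)"
  proof (rule integral_distr[OF id1], rule D2.borel_measurable_lebesgue_integral)
    have "f \<in> borel_measurable (N1 \<Otimes>\<^sub>M ?D2)"
      using f measurable_cong_sets[OF sets_pair_measure_cong[OF refl sets_distr] refl] by blast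
    then show "(\<lambda>(\<omega>\<^sub>1, \<omega>\<^sub>2). f (\<omega>\<^sub>1, \<omega>\<^sub>2)) \<in> borel_measurable (N1 \<Otimes>\<^sub>M ?D2)"
      by simp
  qed
  also have "\<dots> = expectation (\<lambda>\<omega>\<^sub>1. expectation (\<lambda>\<omega>\<^sub>2. f (\<omega>\<^sub>1, \<omega>\<^sub>2)))"
    by (intro Bochner_Integration.integral_cong refl integral_distr[OF id2 sec])
  finally show ?thesis .
qed

context bp_poisson_immigration
begin

definition source_events :: "source \<Rightarrow> 'a set set" where
  "source_events src = (case src of
      Tree k j \<Rightarrow> {\<tau> k j -` A \<inter> space M |A. A \<in> sets (tree_law \<mu> p)}
    | Group k \<Rightarrow> {I k -` A \<inter> space M |A. A \<in> UNIV}
    | Arrivals \<Rightarrow> sigma_sets (space M) {\<nu> t -` A \<inter> space M |t A. 0 \<le> t})"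

definition source_algebra :: "source set \<Rightarrow> 'a measure" where
  "source_algebra S = sigma (space M) (\<Union>src\<in>S. source_events src)"

lemma indep_source_events: "indep_sets source_events UNIV"
  using sources_indep unfolding source_events_def .

lemma source_events_subset: "source_events src \<subseteq> events"
  using indep_source_events unfolding indep_sets_def by blast

lemma space_source_algebra [simp]: "space (source_algebra S) = space M"
  by (simp add: source_algebra_def space_measure_of_conv)

lemma sets_source_algebra: "sets (source_algebra S) = sigma_sets (space M) (\<Union>src\<in>S. source_events src)"
proof -
  have "(\<Union>src\<in>S. source_events src) \<subseteq> Pow (space M)"
    using source_events_subset sets.space_closed by blast
  then show ?thesis by (simp add: source_algebra_def)
qed

lemma Int_stable_source_events: "Int_stable (source_events src)"
proof (cases src)
  case (Tree k j)
  show ?thesis unfolding source_events_def Tree Int_stable_def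
  proof (clarsimp)
    fix A B assume "A \<in> sets (tree_law \<mu> p)" "B \<in> sets (tree_law \<mu> p)"
    then show "\<exists>C. \<tau> k j -` A \<inter> space M \<inter> (\<tau> k j -` B \<inter> space M) = \<tau> k j -` C \<inter> space M \<and> C \<in> sets (tree_law \<mu> p)"
      by (intro exI[of _ "A \<inter> B"]) auto
  qed
next
  case (Group k)
  show ?thesis unfolding source_events_def Group Int_stable_def
  proof (clarsimp)
    fix A B
    show "\<exists>C. I k -` A \<inter> space M \<inter> (I k -` B \<inter> space M) = I k -` C \<inter> space M"
      by (intro exI[of _ "A \<inter> B"]) auto
  qed
next
  case Arrivals
  have "sigma_algebra (space M) (sigma_sets (space M) {\<nu> t -` A \<inter> space M |t A. 0 \<le> t})"
    by (rule sigma_algebra_sigma_sets) auto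
  then interpret A: sigma_algebra "space M" "sigma_sets (space M) {\<nu> t -` A \<inter> space M |t A. 0 \<le> t}" .
  show ?thesis unfolding source_events_def Arrivals
    by (simp only: source.case) (rule Int_stableI, rule A.Int)
qed

lemma indep_source_algebras:
  assumes "disjoint_family_on S J" shows "indep_sets (\<lambda>j. sets (source_algebra (S j))) J"
  unfolding sets_source_algebra
proof (rule indep_sets_collect_sigma)
  show "indep_sets source_events (\<Union>j\<in>J. S j)"
    by (rule indep_sets_mono_index[OF subset_UNIV indep_source_events])
qed (rule Int_stable_source_events, rule assms)

lemma indep_two_source_algebras:
  assumes "A \<inter> B = {}" shows "indep_set (sets (source_algebra A)) (sets (source_algebra B))"
proof -
  have "indep_sets (\<lambda>b. sets (source_algebra (case b of True \<Rightarrow> A | False \<Rightarrow> B))) UNIV"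
    by (rule indep_source_algebras) (use assms in \<open>auto simp: disjoint_family_on_def split: bool.split\<close>)
  then show ?thesis unfolding indep_set_def
    by (rule indep_sets_mono_sets) (auto split: bool.split)
qed

lemma source_eventsD: "src \<in> S \<Longrightarrow> E \<in> source_events src \<Longrightarrow> E \<in> sets (source_algebra S)"
  unfolding sets_source_algebra by auto

lemma tree_source_measurable [measurable (raw)]:
  "Tree k j \<in> S \<Longrightarrow> \<tau> k j \<in> source_algebra S \<rightarrow>\<^sub>M tree_law \<mu> p"
  by (rule measurableI) (auto simp: source_events_def intro!: source_eventsD[of "Tree k j"] exI)

lemma group_source_measurable [measurable (raw)]:
  "Group k \<in> S \<Longrightarrow> I k \<in> source_algebra S \<rightarrow>\<^sub>M count_space UNIV"
  by (rule measurableI) (auto simp: source_events_def intro!: source_eventsD[of "Group k"] exI)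

lemma count_source_measurable:
  assumes "Arrivals \<in> S" "0 \<le> t" shows "\<nu> t \<in> source_algebra S \<rightarrow>\<^sub>M count_space UNIV"
proof (rule measurableI)
  fix A show "\<nu> t -` A \<inter> space (source_algebra S) \<in> sets (source_algebra S)"
    using assms by (intro source_eventsD[of Arrivals]) (auto simp: source_events_def intro!: sigma_sets.Basic)
qed simp

lemma jump_time_source_measurable:
  assumes S: "Arrivals \<in> S" and t: "0 \<le> t"
  shows "(\<lambda>\<omega>. if k \<le> \<nu> t \<omega> then jump_time \<nu> k \<omega> else 0) \<in> borel_measurable (source_algebra S)"
proof -
  have "(\<lambda>\<omega>. if k \<le> \<nu> t \<omega> then jump_time \<nu> k \<omega> else 0) \<in> borel_measurable (sigma (space M) (sets (source_algebra S)))"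
  proof (rule jump_time_measurable[OF _ t])
    show "sigma_algebra (space M) (sets (source_algebra S))"
      using sets.sigma_algebra_axioms[of "source_algebra S"] by simp
    fix u :: real and n assume "0 \<le> u"
    have "{\<omega> \<in> space M. n \<le> \<nu> u \<omega>} = \<nu> u -` {n..} \<inter> space (source_algebra S)" by auto
    then show "{\<omega> \<in> space M. n \<le> \<nu> u \<omega>} \<in> sets (source_algebra S)"
      using measurable_sets[OF count_source_measurable[OF S \<open>0 \<le> u\<close>], of "{n..}"] by simp
  qed
  moreover have "sets (sigma (space M) (sets (source_algebra S))) = sets (source_algebra S)"
    using sets.sigma_sets_eq[of "source_algebra S"] sets.space_closed[of "source_algebra S"] by simp
  ultimately show ?thesis using measurable_cong_sets by blast
qed

abbreviation non_arrivals :: "source set" where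
  "non_arrivals \<equiv> - {Arrivals}"

text \<open>
  The population with arrivals read off at one sample point and group sizes and families at another, so that
  Fubini applies.
\<close>
definition decoupled_Y :: "real \<Rightarrow> 'a \<times> 'a \<Rightarrow> nat" where
  "decoupled_Y t x = (\<Sum>k=1..\<nu> t (fst x). \<Sum>j=1..I k (snd x).
     population (\<tau> k j (snd x)) (t - jump_time \<nu> k (fst x)))"

lemma bp_Y_decoupled: "bp_Y \<nu> I \<tau> t \<omega> = decoupled_Y t (\<omega>, \<omega>)"
  by (simp add: bp_Y_def decoupled_Y_def)

lemma measurable_decoupled_Y:
  assumes t: "0 \<le> t"
  shows "decoupled_Y t \<in> source_algebra {Arrivals} \<Otimes>\<^sub>M source_algebra non_arrivals \<rightarrow>\<^sub>M count_space UNIV"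
    (is "_ \<in> ?N \<rightarrow>\<^sub>M _")
proof -
  let ?S = "\<lambda>k \<omega>. if k \<le> \<nu> t \<omega> then jump_time \<nu> k \<omega> else 0"
  have S: "(\<lambda>x. ?S k (fst x)) \<in> borel_measurable ?N" for k
    by (rule measurable_compose[OF measurable_fst jump_time_source_measurable]) (use t in auto)
  have \<nu>: "(\<lambda>x. \<nu> t (fst x)) \<in> ?N \<rightarrow>\<^sub>M count_space UNIV"
    by (rule measurable_compose[OF measurable_fst count_source_measurable]) (use t in auto)
  have Ik: "(\<lambda>x. I k (snd x)) \<in> ?N \<rightarrow>\<^sub>M count_space UNIV" for k
    by (rule measurable_compose[OF measurable_snd group_source_measurable]) auto
  have \<tau>: "(\<lambda>x. \<tau> k j (snd x)) \<in> ?N \<rightarrow>\<^sub>M tree_law \<mu> p" for k j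
    by (rule measurable_compose[OF measurable_snd tree_source_measurable]) auto
  have pop: "(\<lambda>x. population (\<tau> k j (snd x)) (t - ?S k (fst x))) \<in> ?N \<rightarrow>\<^sub>M count_space UNIV" for k j
    by (rule measurable_population[OF \<tau>]) (use S in measurable)
  have inner: "(\<lambda>x. \<Sum>j=1..I k (snd x). population (\<tau> k j (snd x)) (t - ?S k (fst x))) \<in> ?N \<rightarrow>\<^sub>M count_space UNIV" for k
    by (rule measurable_compose_countable[OF _ Ik, where f="\<lambda>i x. \<Sum>j=1..i. population (\<tau> k j (snd x)) (t - ?S k (fst x))"])
       (use pop in measurable)
  have outer: "(\<lambda>x. \<Sum>k=1..\<nu> t (fst x). \<Sum>j=1..I k (snd x). population (\<tau> k j (snd x)) (t - ?S k (fst x))) \<in> ?N \<rightarrow>\<^sub>M count_space UNIV"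
    by (rule measurable_compose_countable[OF _ \<nu>, where f="\<lambda>n x. \<Sum>k=1..n. \<Sum>j=1..I k (snd x). population (\<tau> k j (snd x)) (t - ?S k (fst x))"])
       (use inner in measurable)
  have "decoupled_Y t = (\<lambda>x. \<Sum>k=1..\<nu> t (fst x). \<Sum>j=1..I k (snd x). population (\<tau> k j (snd x)) (t - ?S k (fst x)))"
    unfolding decoupled_Y_def by (intro ext sum.cong refl) auto
  then show ?thesis using outer by simp
qed

lemma source_algebra_subset: "sets (source_algebra S) \<subseteq> events"
proof -
  have "indep_sets (\<lambda>_. sets (source_algebra S)) {()}"
    by (rule indep_source_algebras[of "\<lambda>_. S"]) (auto simp: disjoint_family_on_def)
  then show ?thesis unfolding indep_sets_def by simp
qed

lemma measurable_source_algebra: "f \<in> source_algebra S \<rightarrow>\<^sub>M N \<Longrightarrow> f \<in> M \<rightarrow>\<^sub>M N"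
  using source_algebra_subset[of S] by (auto simp: measurable_def)

lemma measurable_bp_Y: "0 \<le> t \<Longrightarrow> bp_Y \<nu> I \<tau> t \<in> M \<rightarrow>\<^sub>M count_space UNIV"
proof -
  assume t: "0 \<le> t"
  have id: "(\<lambda>\<omega>. \<omega>) \<in> M \<rightarrow>\<^sub>M source_algebra S" for S
    by (rule measurable_source_algebra[of _ S]) simp
  have "(\<lambda>\<omega>. decoupled_Y t (\<omega>, \<omega>)) \<in> M \<rightarrow>\<^sub>M count_space UNIV"
    by (rule measurable_compose[OF measurable_Pair[OF id id] measurable_decoupled_Y[OF t]])
  then show ?thesis by (simp add: bp_Y_decoupled[abs_def])
qed

lemma expectation_population_power:
  "expectation (\<lambda>\<omega>. s ^ population (\<tau> k j \<omega>) u) = bp_F \<mu> p u s"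
proof -
  have "bp_F \<mu> p u s = (\<integral>\<tau>. s ^ population \<tau> u \<partial>distr M (tree_law \<mu> p) (\<tau> k j))"
    unfolding bp_F_def tree_distr ..
  also have "\<dots> = expectation (\<lambda>\<omega>. s ^ population (\<tau> k j \<omega>) u)"
    by (rule integral_distr[OF tree_measurable]) measurable
  finally show ?thesis ..
qed

text \<open>
  Given the group size its families are i.i.d., so the group is governed by \<open>pgf h\<close> composed with \<open>bp_F\<close>.
\<close>
lemma expectation_group:
  assumes s: "0 \<le> s" "s \<le> 1"
  shows "expectation (\<lambda>\<omega>. \<Prod>j=1..I k \<omega>. s ^ population (\<tau> k j \<omega>) u) = pgf h (bp_F \<mu> p u s)"
proof -
  let ?A = "source_algebra {Group k}" and ?B = "source_algebra (range (Tree k))"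
  let ?f = "\<lambda>x. \<Prod>j=1..I k (fst x). s ^ population (\<tau> k j (snd x)) u"
  have Im: "(\<lambda>x. I k (fst x)) \<in> ?A \<Otimes>\<^sub>M ?B \<rightarrow>\<^sub>M count_space UNIV"
    by (rule measurable_compose[OF measurable_fst group_source_measurable]) simp
  have \<tau>: "(\<lambda>x. \<tau> k j (snd x)) \<in> ?A \<Otimes>\<^sub>M ?B \<rightarrow>\<^sub>M tree_law \<mu> p" for j
    by (rule measurable_compose[OF measurable_snd tree_source_measurable]) simp
  have pm: "(\<lambda>x. s ^ population (\<tau> k j (snd x)) u) \<in> borel_measurable (?A \<Otimes>\<^sub>M ?B)" for j
    by (rule measurable_compose[OF measurable_population[OF \<tau>], of "\<lambda>_. u"]) auto
  have fm: "?f \<in> borel_measurable (?A \<Otimes>\<^sub>M ?B)"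
    by (rule measurable_compose_countable[OF _ Im, where f="\<lambda>i x. \<Prod>j=1..i. s ^ population (\<tau> k j (snd x)) u"])
       (intro borel_measurable_prod pm)
  have ind: "indep_vars (\<lambda>_. borel) (\<lambda>j \<omega>. s ^ population (\<tau> k j \<omega>) u) J" for J
    unfolding indep_vars_def2
  proof (intro conjI ballI)
    have pj: "(\<lambda>\<omega>. s ^ population (\<tau> k j \<omega>) u) \<in> borel_measurable (source_algebra {Tree k j})" for j
      by (rule measurable_compose[OF measurable_population[OF tree_source_measurable], of _ _ _ "\<lambda>_. u"]) auto
    then show "random_variable borel (\<lambda>\<omega>. s ^ population (\<tau> k j \<omega>) u)" for j
      by (rule measurable_source_algebra)
    have "indep_sets (\<lambda>j. sets (source_algebra {Tree k j})) J"
      by (rule indep_source_algebras) (auto simp: disjoint_family_on_def)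
    then show "indep_sets (\<lambda>j. {(\<lambda>\<omega>. s ^ population (\<tau> k j \<omega>) u) -` A \<inter> space M |A. A \<in> sets borel}) J"
      by (rule indep_sets_mono_sets) (use measurable_sets[OF pj] in auto)
  qed
  have "expectation (\<lambda>\<omega>. \<Prod>j=1..I k \<omega>. s ^ population (\<tau> k j \<omega>) u) = expectation (\<lambda>\<omega>. ?f (\<omega>, \<omega>))" by simp
  also have "\<dots> = expectation (\<lambda>\<omega>\<^sub>1. expectation (\<lambda>\<omega>\<^sub>2. ?f (\<omega>\<^sub>1, \<omega>\<^sub>2)))"
  proof (rule expectation_indep_decouple[OF _ _ _ fm])
    show "indep_set (sets ?A) (sets ?B)" by (rule indep_two_source_algebras) auto
    show "norm (?f x) \<le> 1" for x
      using s by (auto simp: abs_prod intro!: prod_le_1 power_le_one)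
  qed simp_all
  also have "\<dots> = expectation (\<lambda>\<omega>. bp_F \<mu> p u s ^ I k \<omega>)"
  proof (rule Bochner_Integration.integral_cong[OF refl])
    fix \<omega>
    have "expectation (\<lambda>\<omega>\<^sub>2. \<Prod>j\<in>{1..I k \<omega>}. s ^ population (\<tau> k j \<omega>\<^sub>2) u) =
      (\<Prod>j\<in>{1..I k \<omega>}. expectation (\<lambda>\<omega>\<^sub>2. s ^ population (\<tau> k j \<omega>\<^sub>2) u))"
    proof (rule indep_vars_lebesgue_integral[OF _ ind])
      fix j
      show "integrable M (\<lambda>\<omega>\<^sub>2. s ^ population (\<tau> k j \<omega>\<^sub>2) u)"
        using ind[of "{j}"] s unfolding indep_vars_def
        by (intro integrable_const_bound[where B=1]) (auto simp: power_le_one)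
    qed simp
    then show "expectation (\<lambda>\<omega>\<^sub>2. ?f (\<omega>, \<omega>\<^sub>2)) = bp_F \<mu> p u s ^ I k \<omega>"
      by (simp add: expectation_population_power)
  qed
  also have "\<dots> = (\<integral>n. bp_F \<mu> p u s ^ n \<partial>distr M (count_space UNIV) (I k))"
    by (rule integral_distr[symmetric, OF group_measurable]) simp
  also have "\<dots> = pgf h (bp_F \<mu> p u s)" by (simp add: group_distr pgf_def)
  finally show ?thesis .
qed

lemma indep_groups:
  fixes s :: real
  shows "indep_vars (\<lambda>_. borel) (\<lambda>k \<omega>. \<Prod>j=1..I k \<omega>. s ^ population (\<tau> k j \<omega>) (u k)) K"
  unfolding indep_vars_def2
proof (intro conjI ballI)
  let ?S = "\<lambda>k. insert (Group k) (range (Tree k))"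
  let ?W = "\<lambda>k \<omega>. \<Prod>j=1..I k \<omega>. s ^ population (\<tau> k j \<omega>) (u k)"
  have pj: "(\<lambda>\<omega>. s ^ population (\<tau> k j \<omega>) (u k)) \<in> borel_measurable (source_algebra (?S k))" for k j
    by (rule measurable_compose[OF measurable_population[OF tree_source_measurable], of _ _ _ "\<lambda>_. u k"]) auto
  have Wm: "?W k \<in> borel_measurable (source_algebra (?S k))" for k
  proof (rule measurable_compose_countable[where f="\<lambda>i \<omega>. \<Prod>j=1..i. s ^ population (\<tau> k j \<omega>) (u k)"])
    show "I k \<in> source_algebra (?S k) \<rightarrow>\<^sub>M count_space UNIV"
      by (rule group_source_measurable) simp
    show "(\<lambda>\<omega>. \<Prod>j=1..i. s ^ population (\<tau> k j \<omega>) (u k)) \<in> borel_measurable (source_algebra (?S k))" for i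
      by (rule borel_measurable_prod) (rule pj)
  qed
  then show "random_variable borel (?W k)" for k
    by (rule measurable_source_algebra)
  have "indep_sets (\<lambda>k. sets (source_algebra (?S k))) K"
    by (rule indep_source_algebras) (auto simp: disjoint_family_on_def)
  then show "indep_sets (\<lambda>k. {?W k -` A \<inter> space M |A. A \<in> sets borel}) K"
    by (rule indep_sets_mono_sets) (use measurable_sets[OF Wm] in auto)
qed

text \<open>
  With the arrivals fixed, the groups are independent, and the one arriving at \<open>S\<^sub>k\<close> contributes the factor
  \<open>pgf h (bp_F \<mu> p (t - S\<^sub>k) s)\<close>.  What remains is the generating functional of the arrivals.
\<close>
lemma expectation_bp_Y_power:
  assumes t: "0 < t" and s: "0 \<le> s" "s \<le> 1"
    and cont: "continuous_on {0..t} (\<lambda>u. bp_F \<mu> p u s)"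
  shows "expectation (\<lambda>\<omega>. s ^ bp_Y \<nu> I \<tau> t \<omega>) = exp (- (LBINT u:{0..t}. r u * bp_q \<mu> p h (t - u) s))"
proof -
  let ?\<phi> = "\<lambda>u. pgf h (bp_F \<mu> p (t - u) s)"
  have F01: "0 \<le> bp_F \<mu> p u s" "bp_F \<mu> p u s \<le> 1" for u
    using bp_F_bounds[OF \<mu>_pos s] by auto
  have ym: "(\<lambda>x. s ^ decoupled_Y t x) \<in> borel_measurable (source_algebra {Arrivals} \<Otimes>\<^sub>M source_algebra non_arrivals)"
    by (rule measurable_compose[OF measurable_decoupled_Y]) (use t in auto)
  have "expectation (\<lambda>\<omega>. s ^ bp_Y \<nu> I \<tau> t \<omega>) = expectation (\<lambda>\<omega>. s ^ decoupled_Y t (\<omega>, \<omega>))"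
    by (simp add: bp_Y_decoupled)
  also have "\<dots> = expectation (\<lambda>\<omega>\<^sub>1. expectation (\<lambda>\<omega>\<^sub>2. s ^ decoupled_Y t (\<omega>\<^sub>1, \<omega>\<^sub>2)))"
  proof (rule expectation_indep_decouple[OF _ _ _ ym])
    show "indep_set (sets (source_algebra {Arrivals})) (sets (source_algebra non_arrivals))"
      by (rule indep_two_source_algebras) auto
    show "norm (s ^ decoupled_Y t x) \<le> 1" for x using s by (simp add: power_le_one)
  qed simp_all
  also have "\<dots> = expectation (\<lambda>\<omega>\<^sub>1. \<Prod>k=1..\<nu> t \<omega>\<^sub>1. ?\<phi> (jump_time \<nu> k \<omega>\<^sub>1))"
  proof (rule Bochner_Integration.integral_cong[OF refl])
    fix \<omega>\<^sub>1
    let ?W = "\<lambda>k \<omega>. \<Prod>j=1..I k \<omega>. s ^ population (\<tau> k j \<omega>) (t - jump_time \<nu> k \<omega>\<^sub>1)"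
    have ind: "indep_vars (\<lambda>_. borel) ?W K" for K by (rule indep_groups)
    have "expectation (\<lambda>\<omega>\<^sub>2. s ^ decoupled_Y t (\<omega>\<^sub>1, \<omega>\<^sub>2)) = expectation (\<lambda>\<omega>\<^sub>2. \<Prod>k\<in>{1..\<nu> t \<omega>\<^sub>1}. ?W k \<omega>\<^sub>2)"
      by (simp add: decoupled_Y_def power_sum)
    also have "\<dots> = (\<Prod>k\<in>{1..\<nu> t \<omega>\<^sub>1}. expectation (?W k))"
    proof (rule indep_vars_lebesgue_integral[OF _ ind])
      fix k
      have "?W k \<in> borel_measurable M" using ind[of "{k}"] unfolding indep_vars_def by auto
      then show "integrable M (?W k)"
        using s by (intro integrable_const_bound[where B=1]) (auto simp: abs_prod intro!: prod_le_1 power_le_one)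
    qed simp
    also have "\<dots> = (\<Prod>k=1..\<nu> t \<omega>\<^sub>1. ?\<phi> (jump_time \<nu> k \<omega>\<^sub>1))"
      by (intro prod.cong refl expectation_group s)
    finally show "expectation (\<lambda>\<omega>\<^sub>2. s ^ decoupled_Y t (\<omega>\<^sub>1, \<omega>\<^sub>2)) = (\<Prod>k=1..\<nu> t \<omega>\<^sub>1. ?\<phi> (jump_time \<nu> k \<omega>\<^sub>1))" .
  qed
  also have "\<dots> = exp (- (LBINT u:{0..t}. r u * (1 - ?\<phi> u)))"
  proof (rule expectation_prod_jump_times[OF t])
    have [measurable]: "(\<lambda>u. bp_F \<mu> p u s) \<in> borel_measurable borel" by (rule measurable_bp_F[OF \<mu>_pos])
    show "?\<phi> \<in> borel_measurable borel" unfolding pgf_def by measurable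
    show "0 \<le> ?\<phi> u" "?\<phi> u \<le> 1" for u
      using F01[of "t - u"] by (auto intro: pgf_nonneg pgf_le_1)
    show "continuous_on {0..t} ?\<phi>"
      by (rule continuous_on_compose2[OF continuous_on_pgf continuous_on_compose2[OF cont]])
         (use F01 in \<open>auto intro!: continuous_intros\<close>)
  qed
  finally show ?thesis by (simp add: bp_q_def)
qed

end

section \<open>Uniform convergence for slowly varying functions\<close>

text \<open>
  For bounds that depend on a truncation parameter and become sharp only when that parameter is sent to its limit.
\<close>
lemma tendsto_squeeze_approx:
  fixes f :: "'a \<Rightarrow> real"
  assumes "\<And>e. 0 < e \<Longrightarrow> \<exists>lo hi a b. (lo \<longlongrightarrow> a) F \<and> (hi \<longlongrightarrow> b) F \<and> l - e < a \<and> b < l + e \<and>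
      eventually (\<lambda>x. lo x \<le> f x \<and> f x \<le> hi x) F"
  shows "(f \<longlongrightarrow> l) F"
proof (rule tendstoI)
  fix e :: real assume "0 < e"
  then obtain lo hi a b where *: "(lo \<longlongrightarrow> a) F" "(hi \<longlongrightarrow> b) F" "l - e < a" "b < l + e"
      "eventually (\<lambda>x. lo x \<le> f x \<and> f x \<le> hi x) F"
    using assms[of e] by blast
  from order_tendstoD(1)[OF *(1,3)] order_tendstoD(2)[OF *(2,4)] *(5)
  show "eventually (\<lambda>x. dist (f x) l < e) F"
    by eventually_elim (auto simp: dist_real_def)
qed

lemma measure_eventually_full:
  fixes P :: "nat \<Rightarrow> real \<Rightarrow> bool"
  assumes m: "\<And>n. {v \<in> {0..T}. P n v} \<in> sets lborel" and T: "0 \<le> T" "c < T"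
    and ev: "\<And>v. v \<in> {0..T} \<Longrightarrow> eventually (\<lambda>n. P n v) sequentially"
  shows "eventually (\<lambda>n. c < measure lborel {v \<in> {0..T}. \<forall>m\<ge>n. P m v}) sequentially"
proof -
  let ?A = "\<lambda>n. {v \<in> {0..T}. \<forall>m\<ge>n. P m v}"
  have A: "?A n \<in> sets lborel" for n
  proof -
    have "?A n = (\<Inter>m\<in>{n..}. {v \<in> {0..T}. P m v})" by auto
    moreover have "(\<Inter>m\<in>{n..}. {v \<in> {0..T}. P m v}) \<in> sets lborel"
    proof (rule sets.countable_INT')
      show "(\<lambda>m. {v \<in> {0..T}. P m v}) ` {n..} \<subseteq> sets lborel" using m by blast
    qed auto
    ultimately show ?thesis by (simp only:)
  qed
  have "(\<lambda>n. emeasure lborel (?A n)) \<longlonglongrightarrow> emeasure lborel (\<Union>n. ?A n)"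
  proof (rule Lim_emeasure_incseq)
    show "range ?A \<subseteq> sets lborel" using A by blast
    show "incseq ?A" by (auto simp: incseq_def)
  qed
  also have "(\<Union>n. ?A n) = {0..T}"
    using ev by (auto simp: eventually_sequentially)
  finally have lim: "(\<lambda>n. emeasure lborel (?A n)) \<longlonglongrightarrow> ennreal T" using T by simp
  have "(\<lambda>n. enn2real (emeasure lborel (?A n))) \<longlonglongrightarrow> T"
    by (rule tendsto_enn2real[OF lim T(1)])
  then have "(\<lambda>n. measure lborel (?A n)) \<longlonglongrightarrow> T" using T by (simp add: measure_def)
  from order_tendstoD(1)[OF this T(2)] show ?thesis .
qed

text \<open>
  The measure-theoretic proof of the uniform convergence theorem.  If uniformity failed along \<open>x n\<close>, \<open>u n\<close>, then
  the sets of increments which are small after \<open>x n\<close>, respectively after \<open>x n + u n\<close>, would both fill most of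
  \<open>[0, 2T]\<close>; the second one, shifted by \<open>u n\<close>, has to meet the first one inside \<open>[0, 3T]\<close>, and a common point links
  \<open>f (x n)\<close> with \<open>f (x n + u n)\<close>.
\<close>
lemma uniform_convergence_additive:
  fixes f :: "real \<Rightarrow> real"
  assumes [measurable]: "f \<in> borel_measurable borel"
    and lim: "\<And>u. ((\<lambda>x. f (x + u) - f x) \<longlongrightarrow> 0) at_top"
    and T: "0 < T" and e: "0 < e"
  shows "eventually (\<lambda>x. \<forall>u\<in>{0..T}. \<bar>f (x + u) - f x\<bar> < e) at_top"
proof (rule ccontr)
  assume "\<not> ?thesis"
  then have "\<forall>n::nat. \<exists>x\<ge>real n. \<exists>u\<in>{0..T}. e \<le> \<bar>f (x + u) - f x\<bar>"
    unfolding eventually_at_top_linorder by (metis linorder_not_le)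
  then obtain x u where x: "\<And>n::nat. real n \<le> x n" and u: "\<And>n. u n \<in> {0..T}"
    and bad: "\<And>n. e \<le> \<bar>f (x n + u n) - f (x n)\<bar>" by metis
  have xinf: "filterlim x at_top sequentially"
    by (rule filterlim_at_top_mono[OF filterlim_real_sequentially]) (simp add: x)
  have yinf: "filterlim (\<lambda>n. x n + u n) at_top sequentially"
    by (rule filterlim_at_top_mono[OF xinf]) (use u in auto)
  have ev: "eventually (\<lambda>n. \<bar>f (y n + v) - f (y n)\<bar> < e / 2) sequentially"
    if "filterlim y at_top sequentially" for y v
  proof -
    have "((\<lambda>n. f (y n + v) - f (y n)) \<longlongrightarrow> 0) sequentially"
      using filterlim_compose[OF lim that] .
    from tendstoD[OF this, of "e / 2"] e show ?thesis by (simp add: dist_real_def)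
  qed
  let ?V = "\<lambda>y n. {v \<in> {0..2 * T}. \<forall>m\<ge>n. \<bar>f (y m + v) - f (y m)\<bar> < e / 2}"
  have Vm: "?V y n \<in> sets lborel" for y and n :: nat by measurable
  have "eventually (\<lambda>n. 3 / 2 * T < measure lborel (?V y n)) sequentially"
    if "filterlim y at_top sequentially" for y
    by (rule measure_eventually_full) (use ev[OF that] T in auto)
  from eventually_conj[OF this[OF xinf] this[OF yinf]]
  obtain n where n: "3 / 2 * T < measure lborel (?V x n)" "3 / 2 * T < measure lborel (?V (\<lambda>n. x n + u n) n)"
    unfolding eventually_sequentially by blast
  let ?A = "?V x n" and ?B = "(\<lambda>w. u n + w) ` ?V (\<lambda>n. x n + u n) n"
  have disjoint_le: "measure lborel A + measure lborel B \<le> 3 * T"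
    if "A \<in> sets lborel" "B \<in> sets lborel" "A \<subseteq> {0..3 * T}" "B \<subseteq> {0..3 * T}" "A \<inter> B = {}" for A B
  proof -
    have fin: "emeasure lborel S \<noteq> \<infinity>" if "S \<subseteq> {0..3 * T}" for S
      using emeasure_mono[OF that, of lborel] T by (auto simp: top_unique)
    have "measure lborel A + measure lborel B = measure lborel (A \<union> B)"
      by (rule measure_Union[symmetric]) (use that fin in auto)
    also have "\<dots> \<le> measure lborel {0..3 * T}"
      by (rule measure_mono_fmeasurable) (use that T in \<open>auto simp: fmeasurable_def\<close>)
    also have "\<dots> = 3 * T" using T by simp
    finally show ?thesis .
  qed
  have subA: "?A \<subseteq> {0..3 * T}" using T by auto
  have subB: "?B \<subseteq> {0..3 * T}" using T u[of n] by auto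
  have Vm2: "?V (\<lambda>n. x n + u n) n \<in> sets lborel" by (rule Vm)
  have img: "(\<lambda>w. c + w) ` S = (\<lambda>v. v - c) -` S" for c :: real and S
    by (auto intro: image_eqI[where x="_ - c"])
  have pre: "(+) c -` ((\<lambda>w. c + w) ` S) = S" for c :: real and S by auto
  have "?B = (\<lambda>v. v - u n) -` ?V (\<lambda>n. x n + u n) n" by (rule img)
  also have "\<dots> \<in> sets borel"
    using Vm2 by (intro measurable_sets_borel[where M=borel]) auto
  finally have Bm: "?B \<in> sets lborel" by simp
  have mB: "measure lborel ?B = measure lborel (?V (\<lambda>n. x n + u n) n)"
  proof -
    have "emeasure lborel ?B = emeasure (distr lborel borel ((+) (u n))) ?B"
      by (simp only: lborel_distr_plus)
    also have "\<dots> = emeasure lborel ((+) (u n) -` ?B \<inter> space lborel)"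
      using Bm by (intro emeasure_distr) auto
    also have "(+) (u n) -` ?B \<inter> space lborel = ?V (\<lambda>n. x n + u n) n"
      by (simp only: space_lborel space_borel Int_UNIV_right pre)
    finally show ?thesis by (simp only: measure_def)
  qed
  have "?A \<inter> ?B \<noteq> {}"
  proof
    assume "?A \<inter> ?B = {}"
    then have "measure lborel ?A + measure lborel ?B \<le> 3 * T"
      by (rule disjoint_le[OF Vm Bm subA subB])
    then show False using n unfolding mB by linarith
  qed
  then obtain w where w: "w \<in> ?V (\<lambda>n. x n + u n) n" "u n + w \<in> ?A" by auto
  have "\<bar>f (x n + u n + w) - f (x n)\<bar> < e / 2" "\<bar>f (x n + u n + w) - f (x n + u n)\<bar> < e / 2"
    using w by (auto simp: add.assoc)
  then have "\<bar>f (x n + u n) - f (x n)\<bar> < e"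
    by (auto simp: abs_if split: if_splits)
  then show False using bad[of n] by simp
qed

lemma slowly_varying_eventually_pos:
  assumes "slowly_varying L" shows "eventually (\<lambda>x. 0 < L x) at_top"
  using assms unfolding slowly_varying_def eventually_at_top_linorder by blast

text \<open>
  The additive form applied to \<open>ln (L (exp x))\<close>, which is set to 0 where \<open>L\<close> is not known to be positive or
  measurable.
\<close>
theorem slowly_varying_uniform:
  assumes L: "slowly_varying L" and \<delta>: "0 < \<delta>" "\<delta> < 1" and e: "0 < e"
  shows "eventually (\<lambda>t. \<forall>u\<in>{\<delta> * t..t}. (1 - e) * L t \<le> L u \<and> L u \<le> (1 + e) * L t) at_top"
proof -
  obtain a where am: "set_borel_measurable borel {a..} L" and apos: "\<And>x. a \<le> x \<Longrightarrow> 0 < L x"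
    using L unfolding slowly_varying_def by blast
  have Lc: "((\<lambda>x. L (c * x) / L x) \<longlongrightarrow> 1) at_top" if "0 < c" for c
    using L that unfolding slowly_varying_def by blast
  define b where "b = max a 1"
  have b: "0 < b" "a \<le> b" by (auto simp: b_def)
  define f where "f x = (if ln b \<le> x then ln (L (exp x)) else 0)" for x
  have bexp: "a \<le> exp x" if "ln b \<le> x" for x
  proof -
    have "b \<le> exp x" using that b by (metis exp_le_cancel_iff exp_ln)
    then show ?thesis using b by simp
  qed
  have f_eq: "f x = ln (L (exp x))" if "ln b \<le> x" for x using that by (simp add: f_def)
  have fm: "f \<in> borel_measurable borel"
  proof -
    have "(\<lambda>x. indicator {a..} (exp x) *\<^sub>R L (exp x)) \<in> borel_measurable borel"
      by (rule measurable_compose[OF _ am[unfolded set_borel_measurable_def]]) measurable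
    then have "(\<lambda>x. if ln b \<le> x then ln (indicator {a..} (exp x) *\<^sub>R L (exp x)) else 0) \<in> borel_measurable borel"
      by measurable
    also have "(\<lambda>x. if ln b \<le> x then ln (indicator {a..} (exp x) *\<^sub>R L (exp x)) else 0) = f"
      by (rule ext) (use bexp in \<open>simp add: f_def\<close>)
    finally show ?thesis .
  qed
  have flim: "((\<lambda>x. f (x + u) - f x) \<longlongrightarrow> 0) at_top" for u
  proof -
    have "((\<lambda>x. ln (L (exp u * exp x) / L (exp x))) \<longlongrightarrow> ln 1) at_top"
      by (intro tendsto_ln filterlim_compose[OF Lc exp_at_top]) auto
    then have "((\<lambda>x. ln (L (exp u * exp x) / L (exp x))) \<longlongrightarrow> 0) at_top" by simp
    then show ?thesis
    proof (rule Lim_transform_eventually)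
      show "eventually (\<lambda>x. ln (L (exp u * exp x) / L (exp x)) = f (x + u) - f x) at_top"
        using eventually_ge_at_top[of "ln b"] eventually_ge_at_top[of "ln b - u"]
      proof eventually_elim
        case (elim x)
        have "0 < L (exp x)" "0 < L (exp (x + u))" using elim by (auto intro!: apos bexp)
        then show ?case using elim by (simp add: f_eq exp_add mult.commute ln_div)
      qed
    qed
  qed
  have \<eta>: "0 < ln (1 + e)" using e by simp
  have "eventually (\<lambda>x. \<forall>u\<in>{0..- ln \<delta>}. \<bar>f (x + u) - f x\<bar> < ln (1 + e)) at_top"
    by (rule uniform_convergence_additive[OF fm flim _ \<eta>]) (use \<delta> in simp)
  then obtain X where X: "\<And>x u. X \<le> x \<Longrightarrow> u \<in> {0..- ln \<delta>} \<Longrightarrow> \<bar>f (x + u) - f x\<bar> < ln (1 + e)"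
    unfolding eventually_at_top_linorder by blast
  define Y where "Y = max X (ln b)"
  show ?thesis
    using eventually_ge_at_top[of "exp Y / \<delta>"]
  proof eventually_elim
    case (elim t)
    then have \<delta>t: "exp Y \<le> \<delta> * t" using \<delta> by (simp add: field_simps)
    then have t0: "0 < t" using \<delta> exp_gt_zero[of Y] by (smt (verit) zero_less_mult_iff)
    show ?case
    proof
      fix u assume u: "u \<in> {\<delta> * t..t}"
      then have "exp Y \<le> u" using \<delta>t by simp
      then have u0: "0 < u" "exp Y \<le> u" using exp_gt_zero[of Y] by linarith+
      have lnu: "Y \<le> ln u" using u0 by (simp add: ln_ge_iff)
      have "ln (\<delta> * t) \<le> ln u" using u u0 \<delta> t0 by (subst ln_le_cancel_iff) auto
      then have "ln t - ln u \<le> - ln \<delta>" using \<delta> t0 by (simp add: ln_mult)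
      moreover have "ln u \<le> ln t" using u u0 t0 by simp
      ultimately have "\<bar>f (ln u + (ln t - ln u)) - f (ln u)\<bar> < ln (1 + e)"
        using lnu by (intro X) (auto simp: Y_def)
      moreover have "ln b \<le> ln u" "ln b \<le> ln t" using lnu \<open>ln u \<le> ln t\<close> by (auto simp: Y_def)
      ultimately have d: "\<bar>ln (L t) - ln (L u)\<bar> < ln (1 + e)" using u0 t0 by (simp add: f_eq)
      have pos: "0 < L t" "0 < L u"
        using apos[OF bexp[OF \<open>ln b \<le> ln t\<close>]] apos[OF bexp[OF \<open>ln b \<le> ln u\<close>]] u0 t0 by auto
      have "ln (L u) \<le> ln ((1 + e) * L t)" "ln (L t) \<le> ln ((1 + e) * L u)"
        using d pos e by (simp_all add: ln_mult)
      then have 1: "L u \<le> (1 + e) * L t" "L t \<le> (1 + e) * L u"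
        using pos e by (simp_all add: ln_le_cancel_iff)
      have "(1 - e) * L t \<le> L u"
      proof (cases "e < 1")
        case True
        then have "(1 - e) * L t \<le> (1 - e) * ((1 + e) * L u)" using 1(2) by (intro mult_left_mono) auto
        also have "\<dots> = (1 - e\<^sup>2) * L u" by (simp add: power2_eq_square algebra_simps)
        also have "\<dots> \<le> 1 * L u" using pos by (intro mult_right_mono) auto
        finally show ?thesis by simp
      next
        case False
        then have "(1 - e) * L t \<le> 0" using pos by (simp add: mult_nonpos_nonneg)
        then show ?thesis using pos by simp
      qed
      with 1 show "(1 - e) * L t \<le> L u \<and> L u \<le> (1 + e) * L t" by simp
    qed
  qed
qed

section \<open>The mean measure is slowly varying\<close>

lemma set_integral_inverse:
  fixes a b :: real
  assumes "0 < a" "a \<le> b"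
  shows "set_integrable lborel {a<..b} (\<lambda>u. 1 / u)" "(LBINT u:{a<..b}. 1 / u) = ln b - ln a"
proof -
  have i: "set_integrable lborel {a..b} (\<lambda>u. 1 / u)"
    by (rule borel_integrable_atLeastAtMost') (use assms in \<open>auto intro!: continuous_intros\<close>)
  then show i2: "set_integrable lborel {a<..b} (\<lambda>u. 1 / u)"
    by (rule set_integrable_subset) auto
  have "((\<lambda>u. 1 / u) has_integral (ln b - ln a)) {a..b}"
    by (rule fundamental_theorem_of_calculus[OF assms(2)])
       (use assms in \<open>auto intro!: derivative_eq_intros simp flip: has_real_derivative_iff_has_vector_derivative\<close>)
  then have "((\<lambda>u. 1 / u) has_integral (ln b - ln a)) {a<..b}"
    by (subst has_integral_spike_set_eq[of _ "{a..b}"]) (auto intro: negligible_subset[of "{a}"])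
  then show "(LBINT u:{a<..b}. 1 / u) = ln b - ln a"
    using set_borel_integral_eq_integral(2)[OF i2] by (simp add: integral_unique)
qed

text \<open>
  Index \<open>-1\<close> is the boundary case in which the integral of the intensity varies slowly, whether it is bounded or not.
\<close>
locale index_minus_one_intensity =
  fixes r L :: "real \<Rightarrow> real"
  assumes L: "slowly_varying L"
    and r_eq: "0 < t \<Longrightarrow> r t = L t / t"
    and r_nonneg: "0 < t \<Longrightarrow> 0 \<le> r t"
    and r_int: "0 \<le> t \<Longrightarrow> set_integrable lborel {0..t} r"
begin

abbreviation R where "R \<equiv> mean_measure r"

lemma r_int_Ioc: "0 \<le> s \<Longrightarrow> set_integrable lborel {s<..t} r"
  by (rule set_integrable_subset[OF r_int[of "max 0 t"]]) auto

lemma r_mult_int_Ioc: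
  assumes "0 \<le> s" and w: "w \<in> borel_measurable borel" and b: "\<And>u. u \<in> {s<..t} \<Longrightarrow> \<bar>w u\<bar> \<le> B"
  shows "set_integrable lborel {s<..t} (\<lambda>u. r u * w u)"
  unfolding set_integrable_def
proof (rule Bochner_Integration.integrable_bound)
  note i = r_int_Ioc[OF assms(1), of t, unfolded set_integrable_def]
  show "integrable lborel (\<lambda>u. B * (indicator {s<..t} u *\<^sub>R r u))" by (intro integrable_mult_right i)
  have "(\<lambda>u. (indicator {s<..t} u *\<^sub>R r u) * w u) \<in> borel_measurable lborel"
    by (intro borel_measurable_times borel_measurable_integrable[OF i]) (use w in simp)
  then show "(\<lambda>u. indicator {s<..t} u *\<^sub>R (r u * w u)) \<in> borel_measurable lborel"
    by (simp add: mult.assoc)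
  show "AE u in lborel. norm (indicator {s<..t} u *\<^sub>R (r u * w u)) \<le> norm (B * (indicator {s<..t} u *\<^sub>R r u))"
  proof (rule AE_I2)
    fix u
    show "norm (indicator {s<..t} u *\<^sub>R (r u * w u)) \<le> norm (B * (indicator {s<..t} u *\<^sub>R r u))"
    proof (cases "u \<in> {s<..t}")
      case True
      have "\<bar>r u\<bar> * \<bar>w u\<bar> \<le> \<bar>r u\<bar> * \<bar>B\<bar>" using b[OF True] by (intro mult_left_mono) auto
      then show ?thesis using True by (simp add: abs_mult mult.commute)
    qed simp
  qed
qed

lemma R_diff: "0 \<le> s \<Longrightarrow> s \<le> t \<Longrightarrow> R t - R s = (LBINT u:{s<..t}. r u)"
  by (rule mean_measure_diff(2)[OF r_int]) auto

lemma R_0: "R 0 = 0"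
  using set_borel_integral_eq_integral(2)[OF r_int[OF order_refl]] by (simp add: mean_measure_def)

lemma R_mono: "0 \<le> s \<Longrightarrow> s \<le> t \<Longrightarrow> R s \<le> R t"
proof -
  assume st: "0 \<le> s" "s \<le> t"
  have "0 \<le> (LBINT u:{s<..t}. r u)"
    unfolding set_lebesgue_integral_def
    by (rule Bochner_Integration.integral_nonneg) (use r_nonneg st in \<open>auto simp: indicator_def\<close>)
  then show ?thesis using R_diff[OF st] by simp
qed

lemma R_nonneg: "0 \<le> t \<Longrightarrow> 0 \<le> R t"
  using R_mono[of 0 t] R_0 by simp

text \<open>
  On \<open>[\<eta>t, t]\<close> the intensity is at least \<open>L t / (2u)\<close>, whose integral is \<open>L t\<close> times \<open>ln (1/\<eta>) / 2\<close>; and \<open>\<eta>\<close> may be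
  as small as desired.
\<close>
lemma L_le_R:
  assumes K: "0 < K" shows "eventually (\<lambda>t. K * L t \<le> R t) at_top"
proof -
  define \<eta> where "\<eta> = exp (- 2 * K)"
  have \<eta>: "0 < \<eta>" "\<eta> < 1" using K by (auto simp: \<eta>_def)
  show ?thesis
    using slowly_varying_uniform[OF L \<eta>, of "1 / 2", simplified] eventually_gt_at_top[of 0]
  proof eventually_elim
    case (elim t)
    have t: "0 < \<eta> * t" "\<eta> * t \<le> t" using \<eta> elim by (auto intro: mult_left_le_one_le)
    have "K * L t = (LBINT u:{\<eta> * t<..t}. (L t / 2) * (1 / u))"
    proof -
      have "(LBINT u:{\<eta> * t<..t}. (L t / 2) * (1 / u)) = (L t / 2) * (ln t - ln (\<eta> * t))"
        unfolding set_integral_inverse(2)[OF t, symmetric] by (rule set_integral_mult_right)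
      also have "ln (\<eta> * t) = - 2 * K + ln t" using elim \<eta> by (simp add: ln_mult \<eta>_def)
      finally show ?thesis by simp
    qed
    also have "\<dots> \<le> (LBINT u:{\<eta> * t<..t}. r u)"
    proof (rule set_integral_mono)
      show "set_integrable lborel {\<eta> * t<..t} (\<lambda>u. (L t / 2) * (1 / u))"
        using set_integral_inverse(1)[OF t] by (rule set_integrable_mult_right)
      show "set_integrable lborel {\<eta> * t<..t} r" by (rule r_int_Ioc) (use t in simp)
      fix u assume u: "u \<in> {\<eta> * t<..t}"
      then have "0 < u" using t by auto
      moreover have "L t / 2 \<le> L u" using elim u by auto
      ultimately show "(L t / 2) * (1 / u) \<le> r u" by (simp add: r_eq field_simps)
    qed
    also have "\<dots> = R t - R (\<eta> * t)" by (rule R_diff[symmetric]) (use t in auto)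
    also have "\<dots> \<le> R t" using R_nonneg[of "\<eta> * t"] t by simp
    finally show ?case .
  qed
qed

lemma R_eventually_pos: "eventually (\<lambda>t. 0 < R t) at_top"
  using L_le_R[OF zero_less_one] slowly_varying_eventually_pos[OF L] by eventually_elim auto

text \<open>
  The increment of \<open>R\<close> over \<open>[\<delta>t, t]\<close> is of the order of \<open>L t\<close>, which is negligible against \<open>R t\<close>.
\<close>
lemma R_slowly_varying:
  assumes \<delta>: "0 < \<delta>" "\<delta> \<le> 1"
  shows "((\<lambda>t. R (\<delta> * t) / R t) \<longlongrightarrow> 1) at_top"
proof (cases "\<delta> = 1")
  case True
  have "eventually (\<lambda>t. R (\<delta> * t) / R t = 1) at_top"
    using R_eventually_pos by eventually_elim (simp add: True)
  then show ?thesis by (rule tendsto_eventually)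
next
  case False
  then have \<delta>: "0 < \<delta>" "\<delta> < 1" using \<delta> by auto
  show ?thesis
  proof (rule tendsto_squeeze_approx)
    fix e :: real assume e: "0 < e"
    \<comment> \<open>With this \<open>K\<close> the crude bound \<open>t (2 L t / (\<delta> t))\<close> for the increment equals \<open>e / 2\<close> times \<open>K L t\<close>.\<close>
    define K where "K = 4 / (\<delta> * e)"
    have K: "0 < K" using \<delta> e by (simp add: K_def)
    have "eventually (\<lambda>t. 1 - e / 2 \<le> R (\<delta> * t) / R t \<and> R (\<delta> * t) / R t \<le> 1) at_top"
      using slowly_varying_uniform[OF L \<delta> zero_less_one] eventually_gt_at_top[of 0] L_le_R[OF K] R_eventually_pos
        slowly_varying_eventually_pos[OF L]
    proof eventually_elim
      case (elim t)
      have t: "0 < \<delta> * t" "\<delta> * t \<le> t" using \<delta> elim by (auto intro: mult_left_le_one_le)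
      have "R t - R (\<delta> * t) = (LBINT u:{\<delta> * t<..t}. r u)" by (rule R_diff) (use t in auto)
      also have "\<dots> \<le> (LBINT u:{\<delta> * t<..t}. 2 * L t / (\<delta> * t))"
      proof (rule set_integral_mono)
        show "set_integrable lborel {\<delta> * t<..t} r" by (rule r_int_Ioc) (use t in simp)
        show "set_integrable lborel {\<delta> * t<..t} (\<lambda>u. 2 * L t / (\<delta> * t))"
          unfolding set_integrable_def using t by simp
        fix u assume u: "u \<in> {\<delta> * t<..t}"
        have "r u = L u / u" using t u by (intro r_eq) auto
        also have "\<dots> \<le> 2 * L t / (\<delta> * t)"
          using elim u t by (intro frac_le) auto
        finally show "r u \<le> 2 * L t / (\<delta> * t)" .
      qed
      also have "\<dots> = (t - \<delta> * t) * (2 * L t / (\<delta> * t))"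
        unfolding set_lebesgue_integral_def using t by simp
      also have "\<dots> \<le> t * (2 * L t / (\<delta> * t))"
        using t elim by (intro mult_right_mono) auto
      also have "\<dots> = e / 2 * (K * L t)" using elim \<delta> e by (simp add: K_def)
      also have "\<dots> \<le> e / 2 * R t" using elim e by (intro mult_left_mono) auto
      finally have "R t - R (\<delta> * t) \<le> e / 2 * R t" .
      moreover have "R (\<delta> * t) \<le> R t" using R_mono[of "\<delta> * t" t] t by simp
      ultimately show ?case using elim by (simp add: field_simps)
    qed
    then show "\<exists>lo hi a b. (lo \<longlongrightarrow> a) at_top \<and> (hi \<longlongrightarrow> b) at_top \<and> 1 - e < a \<and> b < 1 + e \<and>
       eventually (\<lambda>t. lo t \<le> R (\<delta> * t) / R t \<and> R (\<delta> * t) / R t \<le> hi t) at_top"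
      using e by (intro exI[of _ "\<lambda>_. 1 - e / 2"] exI[of _ "\<lambda>_. 1"] exI[of _ "1 - e / 2"] exI[of _ 1]) auto
  qed
qed

end

section \<open>Functions of index -1\<close>

locale index_minus_one_decay =
  fixes q :: "real \<Rightarrow> real"
  assumes q_pos: "0 \<le> t \<Longrightarrow> 0 < q t"
    and q_antimono: "0 \<le> s \<Longrightarrow> s \<le> t \<Longrightarrow> q t \<le> q s"
    and q_cont: "continuous_on {0..b} q"
    and q_meas: "q \<in> borel_measurable borel"
    and q_ratio: "0 < c \<Longrightarrow> ((\<lambda>t. q (c * t) / q t) \<longlongrightarrow> 1 / c) at_top"
begin

definition Q where "Q t = (LBINT u:{0..t}. q u)"

lemma q_int: "set_integrable lborel {0..t} q"
  by (rule borel_integrable_atLeastAtMost') (rule q_cont)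

lemma Q_eq: "Q t = integral {0..t} q"
  unfolding Q_def by (rule set_borel_integral_eq_integral(2)[OF q_int])

lemma Q_deriv:
  assumes "0 < t" shows "(Q has_real_derivative q t) (at t)"
proof -
  have "((\<lambda>t. integral {0..t} q) has_real_derivative q t) (at t within {0..t + 1})"
    by (rule integral_has_real_derivative[OF q_cont]) (use assms in auto)
  moreover have "at t within {0..t + 1} = at t"
    by (rule at_within_Icc_at) (use assms in auto)
  ultimately show ?thesis by (simp add: Q_eq[abs_def])
qed

text \<open>
  By L'Hopital's rule, since \<open>\<delta> q(\<delta>t) / q(t)\<close> tends to 1.
\<close>
lemma Q_slowly_varying:
  assumes Q: "filterlim Q at_top at_top" and \<delta>: "0 < \<delta>"
  shows "((\<lambda>t. Q (\<delta> * t) / Q t) \<longlongrightarrow> 1) at_top"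
proof (rule lhospital_at_top_at_top[OF Q])
  show "eventually (\<lambda>t. q t \<noteq> 0) at_top"
    using eventually_ge_at_top[of 0]
  proof eventually_elim
    case (elim t)
    then show ?case using q_pos[of t] by simp
  qed
  show "eventually (\<lambda>t. ((\<lambda>t. Q (\<delta> * t)) has_real_derivative \<delta> * q (\<delta> * t)) (at t)) at_top"
    using eventually_gt_at_top[of 0]
  proof eventually_elim
    case (elim t)
    have "(Q has_real_derivative q (\<delta> * t)) (at (\<delta> * t))" by (rule Q_deriv) (use elim \<delta> in simp)
    moreover have "((\<lambda>t. \<delta> * t) has_real_derivative \<delta>) (at t)" by (auto intro!: derivative_eq_intros)
    ultimately have "((\<lambda>t. Q (\<delta> * t)) has_real_derivative q (\<delta> * t) * \<delta>) (at t)" by (rule DERIV_chain2)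
    then show ?case by (simp add: mult.commute)
  qed
  show "eventually (\<lambda>t. (Q has_real_derivative q t) (at t)) at_top"
    using eventually_gt_at_top[of 0] by eventually_elim (rule Q_deriv)
  have "((\<lambda>t. \<delta> * (q (\<delta> * t) / q t)) \<longlongrightarrow> \<delta> * (1 / \<delta>)) at_top"
    by (intro tendsto_mult tendsto_const q_ratio \<delta>)
  then show "((\<lambda>t. \<delta> * q (\<delta> * t) / q t) \<longlongrightarrow> 1) at_top" using \<delta> by simp
qed

text \<open>
  Monotonicity upgrades the ratio limit along \<open>c t\<close> to all functions that are asymptotically linear.
\<close>
lemma q_ratio_general:
  assumes b: "((\<lambda>t. b t / t) \<longlongrightarrow> \<beta>) at_top" and \<beta>: "0 < \<beta>"
  shows "((\<lambda>t. q (b t) / q t) \<longlongrightarrow> 1 / \<beta>) at_top"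
proof (rule tendsto_squeeze_approx)
  fix e :: real assume e: "0 < e"
  have "((\<lambda>x. 1 / x) \<longlongrightarrow> 1 / \<beta>) (at \<beta>)" by (intro tendsto_intros) (use \<beta> in auto)
  from tendstoD[OF this e] obtain \<eta> where \<eta>: "0 < \<eta>"
      "\<And>x. x \<noteq> \<beta> \<Longrightarrow> \<bar>x - \<beta>\<bar> < \<eta> \<Longrightarrow> \<bar>1 / x - 1 / \<beta>\<bar> < e"
    unfolding eventually_at dist_real_def by auto
  define \<kappa> where "\<kappa> = min (\<eta> / 2) (\<beta> / 2)"
  have \<kappa>: "0 < \<kappa>" "\<kappa> < \<eta>" "\<kappa> < \<beta>" using \<eta> \<beta> by (auto simp: \<kappa>_def)
  have b1: "eventually (\<lambda>t. \<beta> - \<kappa> < b t / t) at_top"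
    by (rule order_tendstoD(1)[OF b]) (use \<kappa> in simp)
  have b2: "eventually (\<lambda>t. b t / t < \<beta> + \<kappa>) at_top"
    by (rule order_tendstoD(2)[OF b]) (use \<kappa> in simp)
  have ev: "eventually (\<lambda>t. q ((\<beta> + \<kappa>) * t) / q t \<le> q (b t) / q t \<and> q (b t) / q t \<le> q ((\<beta> - \<kappa>) * t) / q t) at_top"
    using b1 b2 eventually_gt_at_top[of 0]
  proof eventually_elim
    case (elim t)
    then have bt: "(\<beta> - \<kappa>) * t \<le> b t" "b t \<le> (\<beta> + \<kappa>) * t" by (auto simp: field_simps)
    have 0: "0 \<le> (\<beta> - \<kappa>) * t" using elim \<kappa> by simp
    then show ?case
      using q_antimono[OF 0 bt(1)] q_antimono[of "b t", OF _ bt(2)] q_pos[of t] bt elim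
      by (auto intro!: divide_right_mono)
  qed
  show "\<exists>lo hi a c. (lo \<longlongrightarrow> a) at_top \<and> (hi \<longlongrightarrow> c) at_top \<and> 1 / \<beta> - e < a \<and> c < 1 / \<beta> + e \<and>
      eventually (\<lambda>t. lo t \<le> q (b t) / q t \<and> q (b t) / q t \<le> hi t) at_top"
  proof (intro exI conjI)
    show "((\<lambda>t. q ((\<beta> + \<kappa>) * t) / q t) \<longlongrightarrow> 1 / (\<beta> + \<kappa>)) at_top" by (rule q_ratio) (use \<kappa> \<beta> in simp)
    show "((\<lambda>t. q ((\<beta> - \<kappa>) * t) / q t) \<longlongrightarrow> 1 / (\<beta> - \<kappa>)) at_top" by (rule q_ratio) (use \<kappa> \<beta> in simp)
    show "1 / \<beta> - e < 1 / (\<beta> + \<kappa>)" using \<eta>(2)[of "\<beta> + \<kappa>"] \<kappa> by auto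
    show "1 / (\<beta> - \<kappa>) < 1 / \<beta> + e" using \<eta>(2)[of "\<beta> - \<kappa>"] \<kappa> by auto
  qed (rule ev)
qed

end

section \<open>The convolution of intensity and decay\<close>

locale poisson_input = index_minus_one_intensity r L + index_minus_one_decay q
  for r L q :: "real \<Rightarrow> real"
begin

text \<open>
  The exponent of the generating function of the process with immigration; \<open>c\<close> is the time shift that stands for the
  argument \<open>s\<close>.
\<close>
definition J :: "real \<Rightarrow> real \<Rightarrow> real" where
  "J c t = (LBINT u:{0..t}. r u * q (t - u + c))"

lemma q_le_q0: "0 \<le> t \<Longrightarrow> \<bar>q t\<bar> \<le> q 0"
  using q_antimono[of 0 t] q_pos[of t] by simp

lemma J_integrand_int:
  assumes "0 \<le> a" "b \<le> t" "0 \<le> c"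
  shows "set_integrable lborel {a<..b} (\<lambda>u. r u * q (t - u + c))"
proof (rule r_mult_int_Ioc[OF assms(1)])
  have "(\<lambda>u. t - u + c) \<in> borel_measurable borel" by measurable
  from measurable_compose[OF this q_meas] show "(\<lambda>u. q (t - u + c)) \<in> borel_measurable borel" .
  show "\<bar>q (t - u + c)\<bar> \<le> q 0" if "u \<in> {a<..b}" for u
    by (rule q_le_q0) (use that assms in auto)
qed

lemma J_Ioc: assumes "0 \<le> t" "0 \<le> c" shows "J c t = (LBINT u:{0<..t}. r u * q (t - u + c))"
proof -
  have "AE u in lborel. u \<noteq> (0 :: real)" by (rule AE_lborel_singleton)
  then have "AE u in lborel. indicator {0..t} u *\<^sub>R (r u * q (t - u + c)) = indicator {0<..t} u *\<^sub>R (r u * q (t - u + c))"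
    by eventually_elim (auto simp: indicator_def)
  moreover have m: "(\<lambda>u. indicator {0<..t} u *\<^sub>R (r u * q (t - u + c))) \<in> borel_measurable lborel"
    using J_integrand_int[of 0 t t c] assms unfolding set_integrable_def by (intro borel_measurable_integrable) auto
  moreover have "(\<lambda>u. indicator {0..t} u *\<^sub>R (r u * q (t - u + c))) \<in> borel_measurable lborel"
  proof -
    have "(\<lambda>u. indicator {0} u * (r 0 * q (t + c)) + indicator {0<..t} u *\<^sub>R (r u * q (t - u + c))) \<in> borel_measurable lborel"
      using m by (intro borel_measurable_add) auto
    also have "(\<lambda>u. indicator {0} u * (r 0 * q (t + c)) + indicator {0<..t} u *\<^sub>R (r u * q (t - u + c)))
        = (\<lambda>u. indicator {0..t} u *\<^sub>R (r u * q (t - u + c)))"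
      using assms by (auto simp: fun_eq_iff indicator_def)
    finally show ?thesis .
  qed
  ultimately show ?thesis
    unfolding J_def set_lebesgue_integral_def by (intro integral_cong_AE) auto
qed

lemma J_split:
  assumes "0 \<le> a" "a \<le> s" "s \<le> b" "b \<le> t" "0 \<le> c"
  shows "(LBINT u:{a<..b}. r u * q (t - u + c)) =
    (LBINT u:{a<..s}. r u * q (t - u + c)) + (LBINT u:{s<..b}. r u * q (t - u + c))"
proof -
  have "{a<..b} = {a<..s} \<union> {s<..b}" using assms by auto
  then show ?thesis
    using assms by (simp only:) (intro set_integral_Un J_integrand_int, auto)
qed

lemma J_bounds:
  assumes "0 \<le> a" "a \<le> b" "b \<le> t" "0 \<le> c"
  shows "q (t - a + c) * (R b - R a) \<le> (LBINT u:{a<..b}. r u * q (t - u + c))"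
    and "(LBINT u:{a<..b}. r u * q (t - u + c)) \<le> q (t - b + c) * (R b - R a)"
proof -
  have i: "set_integrable lborel {a<..b} (\<lambda>u. r u * q (t - u + c))"
    by (rule J_integrand_int) (use assms in auto)
  have k: "set_integrable lborel {a<..b} (\<lambda>u. r u * k)" for k
    by (rule set_integrable_mult_left) (rule r_int_Ioc, rule assms)
  have e: "k * (R b - R a) = (LBINT u:{a<..b}. r u * k)" for k
    unfolding R_diff[OF assms(1,2)] by simp
  show "q (t - a + c) * (R b - R a) \<le> (LBINT u:{a<..b}. r u * q (t - u + c))"
    unfolding e
  proof (rule set_integral_mono[OF k i])
    fix u assume "u \<in> {a<..b}"
    then show "r u * q (t - a + c) \<le> r u * q (t - u + c)"
      using assms by (intro mult_left_mono q_antimono r_nonneg) auto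
  qed
  show "(LBINT u:{a<..b}. r u * q (t - u + c)) \<le> q (t - b + c) * (R b - R a)"
    unfolding e
  proof (rule set_integral_mono[OF i k])
    fix u assume "u \<in> {a<..b}"
    then show "r u * q (t - u + c) \<le> r u * q (t - b + c)"
      using assms by (intro mult_left_mono q_antimono r_nonneg) auto
  qed
qed

text \<open>
  For small \<open>\<delta>\<close> the factor \<open>q\<close> is nearly constant up to time \<open>\<delta>t\<close>.  Later arrivals are negligible: a delay of order \<open>t\<close> keeps \<open>q\<close>
  of the order of \<open>q t\<close>, and the mass of \<open>R\<close> on \<open>[\<delta>t, t]\<close> is small against \<open>R t\<close>.
\<close>
lemma J_delayed_asymp:
  assumes c: "((\<lambda>t. c t / t) \<longlongrightarrow> \<kappa>) at_top" and \<kappa>: "0 < \<kappa>"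
  shows "((\<lambda>t. J (c t) t / (q t * R t)) \<longlongrightarrow> 1 / (1 + \<kappa>)) at_top"
proof (rule tendsto_squeeze_approx)
  fix e :: real assume e: "0 < e"
  have "((\<lambda>\<delta>. 1 / (1 - \<delta> + \<kappa>)) \<longlongrightarrow> 1 / (1 - 0 + \<kappa>)) (at_right 0)"
    by (intro tendsto_intros) (use \<kappa> in auto)
  then have "eventually (\<lambda>\<delta>. 1 / (1 - \<delta> + \<kappa>) < 1 / (1 + \<kappa>) + e) (at_right 0)"
    by (rule order_tendstoD) (use e in simp)
  moreover have "eventually (\<lambda>\<delta>. \<delta> \<in> {0<..<1}) (at_right (0 :: real))"
    by (rule eventually_at_right_real) simp
  ultimately have "eventually (\<lambda>\<delta>. 1 / (1 - \<delta> + \<kappa>) < 1 / (1 + \<kappa>) + e \<and> \<delta> \<in> {0<..<1}) (at_right 0)"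
    by eventually_elim auto
  then obtain \<delta> where \<delta>: "1 / (1 - \<delta> + \<kappa>) < 1 / (1 + \<kappa>) + e" "0 < \<delta>" "\<delta> < 1"
    using eventually_happens[of _ "at_right (0 :: real)"] by auto
  have lim: "((\<lambda>t. (a * t + c t) / t) \<longlongrightarrow> a + \<kappa>) at_top" for a
  proof (rule Lim_transform_eventually)
    show "((\<lambda>t. a + c t / t) \<longlongrightarrow> a + \<kappa>) at_top" by (intro tendsto_intros c)
    show "eventually (\<lambda>t. a + c t / t = (a * t + c t) / t) at_top"
      using eventually_gt_at_top[of 0] by eventually_elim (simp add: field_simps)
  qed
  have q1: "((\<lambda>t. q (t + c t) / q t) \<longlongrightarrow> 1 / (1 + \<kappa>)) at_top"
    using q_ratio_general[OF lim[of 1]] \<kappa> by simp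
  have q2: "((\<lambda>t. q ((1 - \<delta>) * t + c t) / q t) \<longlongrightarrow> 1 / (1 - \<delta> + \<kappa>)) at_top"
    by (rule q_ratio_general[OF lim]) (use \<kappa> \<delta> in simp)
  have q3: "((\<lambda>t. q (c t) / q t) \<longlongrightarrow> 1 / \<kappa>) at_top" by (rule q_ratio_general[OF c \<kappa>])
  have R1: "((\<lambda>t. R (\<delta> * t) / R t) \<longlongrightarrow> 1) at_top" by (rule R_slowly_varying) (use \<delta> in auto)
  have hi: "((\<lambda>t. q ((1 - \<delta>) * t + c t) / q t * (R (\<delta> * t) / R t) + q (c t) / q t * (1 - R (\<delta> * t) / R t))
      \<longlongrightarrow> 1 / (1 - \<delta> + \<kappa>) * 1 + 1 / \<kappa> * (1 - 1)) at_top"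
    by (intro tendsto_add tendsto_mult tendsto_diff tendsto_const q2 q3 R1)
  have ev: "eventually (\<lambda>t. q (t + c t) / q t \<le> J (c t) t / (q t * R t) \<and>
      J (c t) t / (q t * R t) \<le> q ((1 - \<delta>) * t + c t) / q t * (R (\<delta> * t) / R t) + q (c t) / q t * (1 - R (\<delta> * t) / R t)) at_top"
    using eventually_gt_at_top[of 0] R_eventually_pos order_tendstoD(1)[OF c \<kappa>]
  proof eventually_elim
    case (elim t)
    then have ct: "0 \<le> c t" by (simp add: zero_less_divide_iff)
    have t: "0 \<le> \<delta> * t" "\<delta> * t \<le> t" using elim \<delta> by (auto intro: mult_left_le_one_le)
    have qt: "0 < q t" using elim by (intro q_pos) simp
    have "q (t + c t) * R t \<le> J (c t) t"
      using J_bounds(1)[of 0 t t "c t"] ct elim by (simp add: J_Ioc R_0)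
    then have lower: "q (t + c t) / q t \<le> J (c t) t / (q t * R t)"
      using elim qt by (simp add: field_simps)
    have "J (c t) t \<le> q ((1 - \<delta>) * t + c t) * R (\<delta> * t) + q (c t) * (R t - R (\<delta> * t))"
      using J_split[of 0 "\<delta> * t" t t "c t"] J_bounds(2)[of 0 "\<delta> * t" t "c t"] J_bounds(2)[of "\<delta> * t" t t "c t"] t ct elim
      by (simp add: J_Ioc R_0 algebra_simps)
    then have "J (c t) t / (q t * R t) \<le> (q ((1 - \<delta>) * t + c t) * R (\<delta> * t) + q (c t) * (R t - R (\<delta> * t))) / (q t * R t)"
      using elim qt by (intro divide_right_mono) auto
    also have "\<dots> = q ((1 - \<delta>) * t + c t) / q t * (R (\<delta> * t) / R t) + q (c t) / q t * (1 - R (\<delta> * t) / R t)"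
      using elim qt by (simp add: field_simps)
    finally show ?case using lower by simp
  qed
  show "\<exists>lo hi a b. (lo \<longlongrightarrow> a) at_top \<and> (hi \<longlongrightarrow> b) at_top \<and> 1 / (1 + \<kappa>) - e < a \<and> b < 1 / (1 + \<kappa>) + e \<and>
      eventually (\<lambda>t. lo t \<le> J (c t) t / (q t * R t) \<and> J (c t) t / (q t * R t) \<le> hi t) at_top"
    by (intro exI conjI, rule q1, rule hi, use e \<delta> in simp, use \<delta> in simp, rule ev)
qed

lemma set_integral_reflected_q:
  assumes "0 \<le> a" "a \<le> t"
  shows "set_integrable lborel {a<..t} (\<lambda>u. q (t - u))" "(LBINT u:{a<..t}. q (t - u)) = Q (t - a)"
proof -
  have cont: "continuous_on {a..t} (\<lambda>u. q (t - u))"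
    by (rule continuous_on_compose2[OF q_cont[of "t - a"]]) (auto intro!: continuous_intros)
  show "set_integrable lborel {a<..t} (\<lambda>u. q (t - u))"
    by (rule set_integrable_subset[OF borel_integrable_atLeastAtMost'[OF cont]]) auto
  have "(LBINT u:{a<..t}. q (t - u)) = (\<integral>v. indicator {a<..t} (t - v) *\<^sub>R q v \<partial>lborel)"
    unfolding set_lebesgue_integral_def
    by (subst lborel_integral_real_affine[where c="-1" and t=t]) simp_all
  also have "\<dots> = (\<integral>v. indicator {0..t - a} v *\<^sub>R q v \<partial>lborel)"
  proof (rule integral_cong_AE)
    have "AE v in lborel. v \<noteq> t - a" by (rule AE_lborel_singleton)
    then show "AE v in lborel. indicator {a<..t} (t - v) *\<^sub>R q v = indicator {0..t - a} v *\<^sub>R q v"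
      by eventually_elim (auto simp: indicator_def)
  qed (use q_meas in measurable)
  finally show "(LBINT u:{a<..t}. q (t - u)) = Q (t - a)" by (simp add: Q_def set_lebesgue_integral_def)
qed

text \<open>
  Early arrivals contribute \<open>q(t)R(t)\<close>.  Without delay the arrivals just before \<open>t\<close> count too: there \<open>r\<close> is nearly
  constant, by the uniform convergence theorem, and \<open>q\<close> integrates to \<open>Q\<close>.  In between both factors are controlled as in
  the delayed case.
\<close>
lemma J_0_asymp:
  assumes Q: "filterlim Q at_top at_top"
    and ratio: "((\<lambda>t. (r t * Q t) / (q t * R t)) \<longlongrightarrow> d) at_top"
  shows "((\<lambda>t. J 0 t / (q t * R t)) \<longlongrightarrow> 1 + d) at_top"
proof (rule tendsto_squeeze_approx)
  fix e :: real assume e: "0 < e"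
  have "((\<lambda>\<delta>. 1 / (1 - \<delta>) + (1 + \<delta>) / (1 - \<delta>) * d) \<longlongrightarrow> 1 / (1 - 0) + (1 + 0) / (1 - 0) * d) (at_right 0)"
    by (intro tendsto_intros) auto
  then have 1: "eventually (\<lambda>\<delta>. 1 / (1 - \<delta>) + (1 + \<delta>) / (1 - \<delta>) * d < 1 + d + e) (at_right 0)"
    by (rule order_tendstoD) (use e in simp)
  have "((\<lambda>\<delta>. 1 + (1 - \<delta>) * d) \<longlongrightarrow> 1 + (1 - 0) * d) (at_right 0)"
    by (intro tendsto_intros)
  then have 2: "eventually (\<lambda>\<delta>. 1 + d - e < 1 + (1 - \<delta>) * d) (at_right 0)"
    by (rule order_tendstoD) (use e in simp)
  have 3: "eventually (\<lambda>\<delta>. \<delta> \<in> {0<..<1 / 2}) (at_right (0 :: real))"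
    by (rule eventually_at_right_real) simp
  from 1 2 3 have "eventually (\<lambda>\<delta>. 1 / (1 - \<delta>) + (1 + \<delta>) / (1 - \<delta>) * d < 1 + d + e \<and>
      1 + d - e < 1 + (1 - \<delta>) * d \<and> \<delta> \<in> {0<..<1 / 2}) (at_right 0)"
    by eventually_elim auto
  then obtain \<delta> where \<delta>: "1 / (1 - \<delta>) + (1 + \<delta>) / (1 - \<delta>) * d < 1 + d + e" "1 + d - e < 1 + (1 - \<delta>) * d"
      "0 < \<delta>" "\<delta> < 1 / 2"
    using eventually_happens[of _ "at_right (0 :: real)"] by auto
  have q2: "((\<lambda>t. q ((1 - \<delta>) * t) / q t) \<longlongrightarrow> 1 / (1 - \<delta>)) at_top" by (rule q_ratio) (use \<delta> in simp)
  have q3: "((\<lambda>t. q (\<delta> * t) / q t) \<longlongrightarrow> 1 / \<delta>) at_top" by (rule q_ratio) (use \<delta> in simp)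
  have R1: "((\<lambda>t. R (\<delta> * t) / R t) \<longlongrightarrow> 1) at_top" by (rule R_slowly_varying) (use \<delta> in auto)
  have R2: "((\<lambda>t. R ((1 - \<delta>) * t) / R t) \<longlongrightarrow> 1) at_top" by (rule R_slowly_varying) (use \<delta> in auto)
  have Q1: "((\<lambda>t. Q (\<delta> * t) / Q t) \<longlongrightarrow> 1) at_top" by (rule Q_slowly_varying[OF Q]) (use \<delta> in simp)
  let ?\<rho> = "\<lambda>t. (r t * Q t) / (q t * R t)"
  have lo: "((\<lambda>t. R (\<delta> * t) / R t + (1 - \<delta>) * (?\<rho> t * (Q (\<delta> * t) / Q t))) \<longlongrightarrow> 1 + (1 - \<delta>) * (d * 1)) at_top"
    by (intro tendsto_add tendsto_mult tendsto_const R1 Q1 ratio)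
  have hi: "((\<lambda>t. q ((1 - \<delta>) * t) / q t * (R (\<delta> * t) / R t) + q (\<delta> * t) / q t * (R ((1 - \<delta>) * t) / R t - R (\<delta> * t) / R t)
      + (1 + \<delta>) / (1 - \<delta>) * (?\<rho> t * (Q (\<delta> * t) / Q t)))
      \<longlongrightarrow> 1 / (1 - \<delta>) * 1 + 1 / \<delta> * (1 - 1) + (1 + \<delta>) / (1 - \<delta>) * (d * 1)) at_top"
    by (intro tendsto_add tendsto_mult tendsto_diff tendsto_const q2 q3 R1 R2 Q1 ratio)
  \<comment> \<open>The cut-off \<open>\<delta>\<close> also serves as the relative error, so that a single parameter is sent to 0.\<close>
  have unif: "eventually (\<lambda>t. \<forall>u\<in>{(1 - \<delta>) * t..t}. (1 - \<delta>) * L t \<le> L u \<and> L u \<le> (1 + \<delta>) * L t) at_top"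
    by (rule slowly_varying_uniform[OF L]) (use \<delta> in auto)
  have ev: "eventually (\<lambda>t. R (\<delta> * t) / R t + (1 - \<delta>) * (?\<rho> t * (Q (\<delta> * t) / Q t)) \<le> J 0 t / (q t * R t) \<and>
      J 0 t / (q t * R t) \<le> q ((1 - \<delta>) * t) / q t * (R (\<delta> * t) / R t) + q (\<delta> * t) / q t * (R ((1 - \<delta>) * t) / R t - R (\<delta> * t) / R t)
      + (1 + \<delta>) / (1 - \<delta>) * (?\<rho> t * (Q (\<delta> * t) / Q t))) at_top"
    using eventually_gt_at_top[of 0] R_eventually_pos slowly_varying_eventually_pos[OF L]
      filterlim_at_top_dense[THEN iffD1, OF Q, rule_format, of 0]
      unif
  proof eventually_elim
    case (elim t)
    have t: "0 \<le> \<delta> * t" "\<delta> * t \<le> (1 - \<delta>) * t" "(1 - \<delta>) * t \<le> t" "0 < (1 - \<delta>) * t"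
      using elim \<delta> by (auto intro: mult_left_le_one_le mult_right_mono)
    have qt: "0 < q t" using elim by (intro q_pos) simp
    have rt: "r t = L t / t" using elim by (intro r_eq) simp
    let ?I = "\<lambda>a b. LBINT u:{a<..b}. r u * q (t - u + 0)"
    have J: "J 0 t = ?I 0 (\<delta> * t) + (?I (\<delta> * t) ((1 - \<delta>) * t) + ?I ((1 - \<delta>) * t) t)"
      using J_split[of 0 "\<delta> * t" t t 0] J_split[of "\<delta> * t" "(1 - \<delta>) * t" t t 0] t elim by (simp add: J_Ioc)
    have a1: "q t * R (\<delta> * t) \<le> ?I 0 (\<delta> * t)" "?I 0 (\<delta> * t) \<le> q ((1 - \<delta>) * t) * R (\<delta> * t)"
      using J_bounds[of 0 "\<delta> * t" t 0] t elim by (auto simp: R_0 algebra_simps)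
    have a2: "0 \<le> ?I (\<delta> * t) ((1 - \<delta>) * t)"
      "?I (\<delta> * t) ((1 - \<delta>) * t) \<le> q (\<delta> * t) * (R ((1 - \<delta>) * t) - R (\<delta> * t))"
    proof -
      have "0 \<le> q (t - \<delta> * t + 0) * (R ((1 - \<delta>) * t) - R (\<delta> * t))"
        using R_mono[OF t(1,2)] q_pos[of "t - \<delta> * t + 0"] t by (intro mult_nonneg_nonneg) auto
      also have "\<dots> \<le> ?I (\<delta> * t) ((1 - \<delta>) * t)" by (rule J_bounds(1)) (use t in auto)
      finally show "0 \<le> ?I (\<delta> * t) ((1 - \<delta>) * t)" .
      have "t - (1 - \<delta>) * t + 0 = \<delta> * t" by (simp add: algebra_simps)
      then show "?I (\<delta> * t) ((1 - \<delta>) * t) \<le> q (\<delta> * t) * (R ((1 - \<delta>) * t) - R (\<delta> * t))"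
        using J_bounds(2)[of "\<delta> * t" "(1 - \<delta>) * t" t 0] t by simp
    qed
    have Qd: "t - (1 - \<delta>) * t = \<delta> * t" by (simp add: algebra_simps)
    note qi = set_integral_reflected_q[OF less_imp_le[OF t(4)] t(3), unfolded Qd]
    have ii: "set_integrable lborel {(1 - \<delta>) * t<..t} (\<lambda>u. r u * q (t - u + 0))"
      by (rule J_integrand_int) (use t in auto)
    have a3: "((1 - \<delta>) * r t) * Q (\<delta> * t) \<le> ?I ((1 - \<delta>) * t) t"
      unfolding qi(2)[symmetric] set_integral_mult_right[symmetric]
    proof (rule set_integral_mono[OF set_integrable_mult_right[OF qi(1)] ii])
      fix u assume u: "u \<in> {(1 - \<delta>) * t<..t}"
      then have u0: "0 < u" using t by auto
      have Lu: "(1 - \<delta>) * L t \<le> L u" using elim u by auto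
      have "0 \<le> (1 - \<delta>) * L t" using elim \<delta> by simp
      with Lu have "0 \<le> L u" by linarith
      with Lu have "(1 - \<delta>) * L t / t \<le> L u / u"
        using u u0 elim \<delta> by (intro frac_le) auto
      then have "(1 - \<delta>) * r t \<le> r u" by (simp add: rt r_eq[OF u0])
      then show "(1 - \<delta>) * r t * q (t - u) \<le> r u * q (t - u + 0)"
        using q_pos[of "t - u"] u by (simp add: mult_right_mono)
    qed
    have a4: "?I ((1 - \<delta>) * t) t \<le> ((1 + \<delta>) / (1 - \<delta>) * r t) * Q (\<delta> * t)"
      unfolding qi(2)[symmetric] set_integral_mult_right[symmetric]
    proof (rule set_integral_mono[OF ii set_integrable_mult_right[OF qi(1)]])
      fix u assume u: "u \<in> {(1 - \<delta>) * t<..t}"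
      then have u0: "0 < u" using t by auto
      have "L u \<le> (1 + \<delta>) * L t" using elim u by auto
      then have "L u / u \<le> (1 + \<delta>) * L t / ((1 - \<delta>) * t)"
        using u u0 elim \<delta> t by (intro frac_le) auto
      then have "r u \<le> (1 + \<delta>) / (1 - \<delta>) * r t" by (simp add: rt r_eq[OF u0])
      then have "r u * q (t - u) \<le> ((1 + \<delta>) / (1 - \<delta>) * r t) * q (t - u)"
        by (rule mult_right_mono) (use q_pos[of "t - u"] u in simp)
      then show "r u * q (t - u + 0) \<le> (1 + \<delta>) / (1 - \<delta>) * r t * q (t - u)"
        by simp
    qed
    have qR: "0 < q t * R t" using qt elim by simp
    have "(q t * R (\<delta> * t) + ((1 - \<delta>) * r t) * Q (\<delta> * t)) / (q t * R t) \<le> J 0 t / (q t * R t)"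
      using qR a1 a2 a3 unfolding J by (intro divide_right_mono) auto
    moreover have "(q t * R (\<delta> * t) + ((1 - \<delta>) * r t) * Q (\<delta> * t)) / (q t * R t)
      = R (\<delta> * t) / R t + (1 - \<delta>) * (?\<rho> t * (Q (\<delta> * t) / Q t))"
      using qt elim by (simp add: field_simps)
    moreover have "J 0 t / (q t * R t) \<le> (q ((1 - \<delta>) * t) * R (\<delta> * t) + q (\<delta> * t) * (R ((1 - \<delta>) * t) - R (\<delta> * t))
      + ((1 + \<delta>) / (1 - \<delta>) * r t) * Q (\<delta> * t)) / (q t * R t)"
      using qR a1 a2 a4 unfolding J by (intro divide_right_mono) auto
    moreover have "(q ((1 - \<delta>) * t) * R (\<delta> * t) + q (\<delta> * t) * (R ((1 - \<delta>) * t) - R (\<delta> * t))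
      + ((1 + \<delta>) / (1 - \<delta>) * r t) * Q (\<delta> * t)) / (q t * R t)
      = q ((1 - \<delta>) * t) / q t * (R (\<delta> * t) / R t) + q (\<delta> * t) / q t * (R ((1 - \<delta>) * t) / R t - R (\<delta> * t) / R t)
      + (1 + \<delta>) / (1 - \<delta>) * (?\<rho> t * (Q (\<delta> * t) / Q t))"
    proof -
      have "q t \<noteq> 0" "R t \<noteq> 0" "Q t \<noteq> 0" using qt elim by auto
      then show ?thesis by (simp add: add_divide_distrib diff_divide_distrib right_diff_distrib)
    qed
    ultimately show ?case by simp
  qed
  show "\<exists>lo hi a b. (lo \<longlongrightarrow> a) at_top \<and> (hi \<longlongrightarrow> b) at_top \<and> 1 + d - e < a \<and> b < 1 + d + e \<and>
      eventually (\<lambda>t. lo t \<le> J 0 t / (q t * R t) \<and> J 0 t / (q t * R t) \<le> hi t) at_top"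
    by (intro exI conjI, rule lo, rule hi, use \<delta> in simp, use \<delta> in simp, rule ev)
qed

text \<open>
  When \<open>t\<close> is doubled, \<open>q(t)R(t)\<close> is asymptotically halved; already a factor below \<open>1 / sqrt 2\<close> makes
  \<open>q(t)R(t) sqrt t\<close> bounded.
\<close>
lemma qR_tendsto_0: "((\<lambda>t. q t * R t) \<longlongrightarrow> 0) at_top"
proof -
  have 2: "filterlim (\<lambda>t::real. 2 * t) at_top at_top"
    by (rule filterlim_tendsto_pos_mult_at_top[OF tendsto_const _ filterlim_ident]) simp
  have "((\<lambda>t. R (1 / 2 * (2 * t)) / R (2 * t)) \<longlongrightarrow> 1) at_top"
    by (rule filterlim_compose[OF R_slowly_varying 2]) auto
  then have "((\<lambda>t. inverse (R t / R (2 * t))) \<longlongrightarrow> inverse 1) at_top"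
    by (intro tendsto_inverse) auto
  then have "((\<lambda>t. q (2 * t) / q t * inverse (R t / R (2 * t))) \<longlongrightarrow> 1 / 2 * inverse 1) at_top"
    by (intro tendsto_mult q_ratio) simp
  then have "eventually (\<lambda>t. q (2 * t) / q t * inverse (R t / R (2 * t)) < 2 / 3) at_top"
    by (rule order_tendstoD) simp
  then have "eventually (\<lambda>t. 0 < t \<and> q (2 * t) * R (2 * t) \<le> 2 / 3 * (q t * R t)) at_top"
    using eventually_gt_at_top[of 0] R_eventually_pos
  proof eventually_elim
    case (elim t)
    have "0 < q t" using elim by (intro q_pos) simp
    then show ?case using elim by (simp add: field_simps)
  qed
  then obtain T where T0: "\<And>t. T \<le> t \<Longrightarrow> 0 < t \<and> q (2 * t) * R (2 * t) \<le> 2 / 3 * (q t * R t)"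
    unfolding eventually_at_top_linorder by blast
  have T: "0 < T" using T0[of T] by simp
  \<comment> \<open>By monotonicity \<open>B\<close> bounds \<open>q t * R t * sqrt t\<close> on \<open>[T, 2T]\<close>.\<close>
  define B where "B = q T * R (2 * T) * sqrt (2 * T)"
  have step: "q t * R t * sqrt t \<le> B" if "T \<le> t" "t \<le> 2 ^ n * (2 * T)" for t n
    using that
  proof (induction n arbitrary: t)
    case 0
    have qR: "q t * R t \<le> q T * R (2 * T)"
      using 0 T q_pos[of T] R_nonneg[of t] by (intro mult_mono q_antimono R_mono) auto
    then show ?case
      unfolding B_def using 0 T q_pos[of T] R_nonneg[of "2 * T"] by (intro mult_mono[OF qR]) auto
  next
    case (Suc n)
    show ?case
    proof (cases "t \<le> 2 * T")
      case True
      then have qR: "q t * R t \<le> q T * R (2 * T)"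
        using Suc T q_pos[of T] R_nonneg[of t] by (intro mult_mono q_antimono R_mono) auto
      then show ?thesis
        unfolding B_def using Suc T True q_pos[of T] R_nonneg[of "2 * T"] by (intro mult_mono[OF qR]) auto
    next
      case False
      define v where "v = t / 2"
      have v: "T \<le> v" "v \<le> 2 ^ n * (2 * T)" "t = 2 * v" using False Suc.prems by (auto simp: v_def)
      have v0: "0 < v" using v T by simp
      have "2 / 3 * sqrt 2 \<le> (1 :: real)"
        by (rule power2_le_imp_le) (simp_all add: power_mult_distrib power_divide)
      then have s: "2 / 3 * sqrt (2 * v) \<le> sqrt v"
        using v0 mult_right_mono[of "2 / 3 * sqrt 2" 1 "sqrt v"] by (simp add: real_sqrt_mult)
      have "q t * R t * sqrt t \<le> 2 / 3 * (q v * R v) * sqrt (2 * v)"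
        unfolding v(3) using T0[OF v(1)] v0 by (intro mult_right_mono) auto
      also have "\<dots> = (q v * R v) * (2 / 3 * sqrt (2 * v))" by simp
      also have "\<dots> \<le> (q v * R v) * sqrt v"
        using q_pos[of v] R_nonneg[of v] v0 s by (intro mult_left_mono) auto
      also have "\<dots> \<le> B" by (rule Suc.IH) (use v in auto)
      finally show ?thesis .
    qed
  qed
  have bound: "q t * R t \<le> B / sqrt t" if "T \<le> t" for t
  proof -
    obtain n where "t / (2 * T) < 2 ^ n" using real_arch_pow[of 2 "t / (2 * T)"] by auto
    then have "t \<le> 2 ^ n * (2 * T)" using T by (simp add: field_simps)
    from step[OF that this] show ?thesis using that T by (simp add: field_simps)
  qed
  have "((\<lambda>t. B / sqrt t) \<longlongrightarrow> 0) at_top" by real_asymp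
  show ?thesis
  proof (rule tendsto_sandwich[OF _ _ tendsto_const \<open>((\<lambda>t. B / sqrt t) \<longlongrightarrow> 0) at_top\<close>])
    show "eventually (\<lambda>t. 0 \<le> q t * R t) at_top"
      using eventually_ge_at_top[of 0]
    proof eventually_elim
      case (elim t)
      then show ?case using q_pos[of t] R_nonneg[of t] by simp
    qed
    show "eventually (\<lambda>t. q t * R t \<le> B / sqrt t) at_top"
      using eventually_ge_at_top[of T] by eventually_elim (rule bound)
  qed
qed

end

section \<open>Regular variation of the survival probability\<close>

text \<open>
  The argument \<open>y t\<close> lies between multiples of \<open>x t\<close> by constants close to \<open>c\<close>; monotonicity of \<open>\<phi>\<close> and continuity of the
  limit \<open>\<rho>\<close> then replace uniform convergence.
\<close>
lemma monotone_regular_variation: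
  fixes \<phi> w \<rho> :: "real \<Rightarrow> real" and x y :: "'a \<Rightarrow> real"
  assumes mono: "\<And>u v. 0 < u \<Longrightarrow> u \<le> v \<Longrightarrow> v \<le> 1 \<Longrightarrow> \<phi> u \<le> \<phi> v"
    and w: "\<And>u. 0 < u \<Longrightarrow> u < 1 \<Longrightarrow> 0 < w u"
    and rv: "\<And>c. 0 < c \<Longrightarrow> ((\<lambda>u. \<phi> (c * u) / w u) \<longlongrightarrow> \<rho> c) (at_right 0)"
    and \<rho>: "isCont \<rho> c" and c: "0 < c"
    and x: "filterlim x (at_right 0) F" and y: "((\<lambda>t. y t / x t) \<longlongrightarrow> c) F"
  shows "((\<lambda>t. \<phi> (y t) / w (x t)) \<longlongrightarrow> \<rho> c) F"
proof (rule tendsto_squeeze_approx)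
  fix e :: real assume e: "0 < e"
  from tendstoD[OF \<rho>[unfolded isCont_def] e] obtain \<eta> where \<eta>: "0 < \<eta>"
      "\<And>v. v \<noteq> c \<Longrightarrow> \<bar>v - c\<bar> < \<eta> \<Longrightarrow> \<bar>\<rho> v - \<rho> c\<bar> < e"
    unfolding eventually_at dist_real_def by auto
  define \<kappa> where "\<kappa> = min (\<eta> / 2) (c / 2)"
  have \<kappa>: "0 < \<kappa>" "\<kappa> < \<eta>" "\<kappa> < c" using \<eta> c by (auto simp: \<kappa>_def)
  have y1: "eventually (\<lambda>t. c - \<kappa> < y t / x t) F"
    by (rule order_tendstoD(1)[OF y]) (use \<kappa> in simp)
  have y2: "eventually (\<lambda>t. y t / x t < c + \<kappa>) F"
    by (rule order_tendstoD(2)[OF y]) (use \<kappa> in simp)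
  have "eventually (\<lambda>u. u \<in> {0<..<min 1 (1 / (c + \<kappa>))}) (at_right (0 :: real))"
    by (rule eventually_at_right_real) (use \<kappa> c in simp)
  then have xs: "eventually (\<lambda>t. x t \<in> {0<..<min 1 (1 / (c + \<kappa>))}) F"
    by (rule eventually_compose_filterlim[OF _ x])
  have ev: "eventually (\<lambda>t. \<phi> ((c - \<kappa>) * x t) / w (x t) \<le> \<phi> (y t) / w (x t) \<and>
      \<phi> (y t) / w (x t) \<le> \<phi> ((c + \<kappa>) * x t) / w (x t)) F"
    using y1 y2 xs
  proof eventually_elim
    case (elim t)
    have x0: "0 < x t" "x t < 1" using elim by auto
    have wt: "0 < w (x t)" by (rule w[OF x0])
    have a: "0 < (c - \<kappa>) * x t" using \<kappa> x0 by simp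
    have b: "(c - \<kappa>) * x t \<le> y t" "y t \<le> (c + \<kappa>) * x t" using elim x0 by (auto simp: field_simps)
    have d: "(c + \<kappa>) * x t \<le> 1" using elim \<kappa> c by (auto simp: field_simps)
    have "\<phi> ((c - \<kappa>) * x t) \<le> \<phi> (y t)" by (rule mono) (use a b d in auto)
    moreover have "\<phi> (y t) \<le> \<phi> ((c + \<kappa>) * x t)" by (rule mono) (use a b d in auto)
    ultimately show ?case using wt by (auto intro!: divide_right_mono)
  qed
  show "\<exists>lo hi a b. (lo \<longlongrightarrow> a) F \<and> (hi \<longlongrightarrow> b) F \<and> \<rho> c - e < a \<and> b < \<rho> c + e \<and>
      eventually (\<lambda>t. lo t \<le> \<phi> (y t) / w (x t) \<and> \<phi> (y t) / w (x t) \<le> hi t) F"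
  proof (intro exI conjI)
    show "((\<lambda>t. \<phi> ((c - \<kappa>) * x t) / w (x t)) \<longlongrightarrow> \<rho> (c - \<kappa>)) F"
      by (rule filterlim_compose[OF rv x]) (use \<kappa> in simp)
    show "((\<lambda>t. \<phi> ((c + \<kappa>) * x t) / w (x t)) \<longlongrightarrow> \<rho> (c + \<kappa>)) F"
      by (rule filterlim_compose[OF rv x]) (use \<kappa> c in simp)
    show "\<rho> c - e < \<rho> (c - \<kappa>)" using \<eta>(2)[of "c - \<kappa>"] \<kappa> by auto
    show "\<rho> (c + \<kappa>) < \<rho> c + e" using \<eta>(2)[of "c + \<kappa>"] \<kappa> by auto
  qed (rule ev)
qed

lemma powr_slowly_varying_ratio:
  fixes \<beta> c :: real
  assumes L: "slowly_varying L" and c: "0 < c"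
  shows "((\<lambda>y. ((c * y) powr \<beta> * L (1 / (c * y))) / (y powr \<beta> * L (1 / y))) \<longlongrightarrow> c powr \<beta>) (at_right 0)"
proof -
  have inv: "filterlim (\<lambda>y::real. 1 / y) at_top (at_right 0)"
    using filterlim_inverse_at_top_right by (simp add: inverse_eq_divide)
  have "\<forall>a>0. ((\<lambda>x. L (a * x) / L x) \<longlongrightarrow> 1) at_top"
    using L unfolding slowly_varying_def by blast
  then have "((\<lambda>x. L (1 / c * x) / L x) \<longlongrightarrow> 1) at_top"
    by (rule allE[of _ "1 / c"]) (use c in simp)
  from filterlim_compose[OF this inv]
  have "((\<lambda>y. c powr \<beta> * (L (1 / c * (1 / y)) / L (1 / y))) \<longlongrightarrow> c powr \<beta> * 1) (at_right 0)"
    by (intro tendsto_mult tendsto_const)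
  then have "((\<lambda>y. c powr \<beta> * (L (1 / c * (1 / y)) / L (1 / y))) \<longlongrightarrow> c powr \<beta>) (at_right 0)" by simp
  then show ?thesis
  proof (rule Lim_transform_eventually)
    show "eventually (\<lambda>y. c powr \<beta> * (L (1 / c * (1 / y)) / L (1 / y)) =
        ((c * y) powr \<beta> * L (1 / (c * y))) / (y powr \<beta> * L (1 / y))) (at_right 0)"
      using eventually_at_right_less[of 0]
    proof eventually_elim
      case (elim y)
      then show ?case using c by (simp add: powr_mult)
    qed
  qed
qed

text \<open>
  Close to 1 the claim is the eventual positivity of \<open>L\<close>.  By convexity a point with \<open>pgf p u \<le> u\<close> would force the graph
  below the diagonal on all of \<open>[u, 1]\<close>.
\<close>
lemma pgf_gt_self:
  assumes L: "slowly_varying L"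
    and offspring: "\<And>s. 0 \<le> s \<Longrightarrow> s < 1 \<Longrightarrow> pgf p s = s + (1 - s) powr (\<gamma> + 1) * L (1 / (1 - s))"
    and u: "0 \<le> u" "u < 1"
  shows "u < pgf p u"
proof (rule ccontr)
  assume "\<not> u < pgf p u"
  then have le: "pgf p u \<le> u" by simp
  obtain a where a: "\<And>x. a \<le> x \<Longrightarrow> 0 < L x" using L unfolding slowly_varying_def by blast
  define b where "b = max a 1 + 1 / (1 - u)"
  have b: "a \<le> b" "1 / (1 - u) < b" using u by (auto simp: b_def max_def add_increasing2)
  have b0: "0 < b" using b(2) u by (smt (verit) zero_less_divide_1_iff)
  \<comment> \<open>A point to the right of \<open>u\<close> at which \<open>L\<close> is known to be positive.\<close>
  define s where "s = 1 - 1 / b"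
  have "1 / b < 1 - u" using b(2) b0 u by (simp add: field_simps)
  then have s: "u < s" "s < 1" "1 / (1 - s) = b" using b0 by (auto simp: s_def)
  have "0 < (1 - s) powr (\<gamma> + 1) * L (1 / (1 - s))"
    unfolding s(3) using a[OF b(1)] s by (intro mult_pos_pos) auto
  then have gt: "s < pgf p s" using offspring[of s] s u by simp
  define t where "t = (s - u) / (1 - u)"
  have tu: "t * (1 - u) = s - u" using u by (simp add: t_def)
  have "(1 - t) * u + t * 1 = u + t * (1 - u)" by (simp add: algebra_simps)
  then have t3: "s = (1 - t) * u + t * 1" by (simp add: tu)
  have t: "0 \<le> t" "t \<le> 1" using s u by (auto simp: t_def field_simps)
  have "pgf p ((1 - t) *\<^sub>R u + t *\<^sub>R 1) \<le> (1 - t) * pgf p u + t * pgf p 1"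
    by (rule convex_onD[OF convex_on_pgf]) (use t u in auto)
  also have "\<dots> \<le> (1 - t) * u + t * 1"
    using le t by (intro add_mono mult_left_mono) auto
  finally show False using gt t3 by simp
qed

context branching_process
begin

lemma surv_at_right_0: "filterlim surv (at_right 0) at_top"
  unfolding filterlim_at
proof (intro conjI surv_tendsto_0)
  show "eventually (\<lambda>t. surv t \<in> {0<..} \<and> surv t \<noteq> 0) at_top"
    using eventually_ge_at_top[of 0]
  proof eventually_elim
    case (elim t)
    then show ?case using surv_pos[of t] by simp
  qed
qed

text \<open>
  \<open>G\<close> takes every value \<open>\<mu> t\<close>, namely at \<open>1 - surv t\<close>.
\<close>
lemma G_at_top: "filterlim (\<lambda>y. G (1 - y)) at_top (at_right 0)"
  unfolding filterlim_at_top
proof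
  fix Z :: real
  define t where "t = max Z 0 / \<mu>"
  have t: "0 \<le> t" "Z \<le> \<mu> * t" using \<mu>_pos by (auto simp: t_def)
  have "eventually (\<lambda>y. y \<in> {0<..<surv t}) (at_right 0)"
    by (rule eventually_at_right_real) (rule surv_pos[OF t(1)])
  then show "eventually (\<lambda>y. Z \<le> G (1 - y)) (at_right 0)"
  proof eventually_elim
    case (elim y)
    then have "G (1 - surv t) < G (1 - y)"
      using surv_le_1[of t] by (intro G_strict_mono) auto
    then show ?case using G_surv[OF t(1)] t(2) by simp
  qed
qed

lemma G_DERIV:
  assumes "0 < s" "s < 1" shows "(G has_real_derivative 1 / (pgf p s - s)) (at s)"
proof -
  define c where "c = (s + 1) / 2"
  have c: "s < c" "c < 1" using assms by (auto simp: c_def)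
  have "(G has_real_derivative 1 / (pgf p s - s)) (at s within {0..c})"
    by (rule G_has_derivative) (use assms c in auto)
  moreover have "at s within {0..c} = at s" by (rule at_within_Icc_at) (use assms c in auto)
  ultimately show ?thesis by simp
qed

text \<open>
  By L'Hopital's rule: the derivatives are multiples of reciprocals of \<open>pgf p s - s\<close>, which varies regularly at 1 with index
  \<open>\<gamma> + 1\<close>.
\<close>
lemma G_regularly_varying:
  assumes L: "slowly_varying L"
    and offspring: "\<And>s. 0 \<le> s \<Longrightarrow> s < 1 \<Longrightarrow> pgf p s = s + (1 - s) powr (\<gamma> + 1) * L (1 / (1 - s))"
    and c: "0 < c"
  shows "((\<lambda>y. G (1 - c * y) / G (1 - y)) \<longlongrightarrow> c powr (- \<gamma>)) (at_right 0)"
proof (rule lhopital_right_at_top[OF G_at_top])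
  let ?\<phi> = "\<lambda>y. pgf p (1 - y) - (1 - y)"
  have small: "eventually (\<lambda>y. y \<in> {0<..<min 1 (1 / c)}) (at_right (0 :: real))"
    by (rule eventually_at_right_real) (use c in simp)
  have D: "((\<lambda>y. G (1 - a * y)) has_real_derivative - a / ?\<phi> (a * y)) (at y)"
    if "0 < a" "0 < y" "a * y < 1" for a y
  proof -
    have "(G has_real_derivative 1 / ?\<phi> (a * y)) (at (1 - a * y))"
      by (rule G_DERIV) (use that in auto)
    moreover have "((\<lambda>y. 1 - a * y) has_real_derivative - a) (at y)"
      by (auto intro!: derivative_eq_intros)
    ultimately have "((\<lambda>y. G (1 - a * y)) has_real_derivative 1 / ?\<phi> (a * y) * - a) (at y)"
      by (rule DERIV_chain2)
    then show ?thesis by simp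
  qed
  have \<phi>_pos: "0 < ?\<phi> y" if "0 < y" "y < 1" for y using pgf_gt[of "1 - y"] that by simp
  show "eventually (\<lambda>y. - 1 / ?\<phi> y \<noteq> 0) (at_right 0)"
    using small
  proof eventually_elim
    case (elim y)
    then show ?case using \<phi>_pos[of y] by auto
  qed
  show "eventually (\<lambda>y. ((\<lambda>y. G (1 - c * y)) has_real_derivative - c / ?\<phi> (c * y)) (at y)) (at_right 0)"
    using small by eventually_elim (rule D, use c in \<open>auto simp: field_simps\<close>)
  show "eventually (\<lambda>y. ((\<lambda>y. G (1 - y)) has_real_derivative - 1 / ?\<phi> y) (at y)) (at_right 0)"
    using small by eventually_elim (use D[of 1] in auto)
  have "((\<lambda>y. c * inverse (((c * y) powr (\<gamma> + 1) * L (1 / (c * y))) / (y powr (\<gamma> + 1) * L (1 / y))))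
      \<longlongrightarrow> c * inverse (c powr (\<gamma> + 1))) (at_right 0)"
    by (intro tendsto_mult tendsto_const tendsto_inverse powr_slowly_varying_ratio L c) (use c in simp)
  moreover have "c * inverse (c powr (\<gamma> + 1)) = c powr (- \<gamma>)"
    using c by (simp add: powr_add powr_minus field_simps)
  ultimately have "((\<lambda>y. c * inverse (((c * y) powr (\<gamma> + 1) * L (1 / (c * y))) / (y powr (\<gamma> + 1) * L (1 / y))))
      \<longlongrightarrow> c powr (- \<gamma>)) (at_right 0)" by simp
  then show "((\<lambda>y. (- c / ?\<phi> (c * y)) / (- 1 / ?\<phi> y)) \<longlongrightarrow> c powr (- \<gamma>)) (at_right 0)"
  proof (rule Lim_transform_eventually)
    show "eventually (\<lambda>y. c * inverse (((c * y) powr (\<gamma> + 1) * L (1 / (c * y))) / (y powr (\<gamma> + 1) * L (1 / y)))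
        = (- c / ?\<phi> (c * y)) / (- 1 / ?\<phi> y)) (at_right 0)"
      using small
    proof eventually_elim
      case (elim y)
      then have y: "0 < y" "y < 1" "c * y < 1" using c by (auto simp: field_simps)
      have 1: "?\<phi> y = y powr (\<gamma> + 1) * L (1 / y)" using offspring[of "1 - y"] y by simp
      have 2: "?\<phi> (c * y) = (c * y) powr (\<gamma> + 1) * L (1 / (c * y))"
        using offspring[of "1 - c * y"] y c by simp
      show ?case unfolding 1[symmetric] 2[symmetric] by simp
    qed
  qed
qed

text \<open>
  \<open>1 - surv t\<close> is the inverse of \<open>G\<close> at \<open>\<mu> t\<close>, and inverting a monotone function inverts the index of regular
  variation.
\<close>
lemma surv_ratio:
  assumes L: "slowly_varying L" and \<gamma>: "0 < \<gamma>"
    and offspring: "\<And>s. 0 \<le> s \<Longrightarrow> s < 1 \<Longrightarrow> pgf p s = s + (1 - s) powr (\<gamma> + 1) * L (1 / (1 - s))"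
    and c: "0 < c"
  shows "((\<lambda>t. surv (c * t) / surv t) \<longlongrightarrow> c powr (- 1 / \<gamma>)) at_top"
proof -
  have rv: "((\<lambda>t. G (1 - a * surv t) / G (1 - surv t)) \<longlongrightarrow> a powr (- \<gamma>)) at_top" if "0 < a" for a
    by (rule filterlim_compose[OF G_regularly_varying[OF L offspring that] surv_at_right_0])
  have small: "eventually (\<lambda>t. a * surv t < 1) at_top" if "0 < a" for a
    using order_tendstoD(2)[OF surv_tendsto_0, of "1 / a"] that
    by (auto elim!: eventually_mono simp: field_simps)
  have c_eq: "(c powr (- 1 / \<gamma>)) powr (- \<gamma>) = c" using c \<gamma> by (simp add: powr_powr)
  have cp: "0 < c powr (- 1 / \<gamma>)" using c by simp
  show ?thesis
  proof (rule order_tendstoI)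
    fix a assume a: "a < c powr (- 1 / \<gamma>)"
    show "eventually (\<lambda>t. a < surv (c * t) / surv t) at_top"
    proof (cases "0 < a")
      case False
      show ?thesis using eventually_gt_at_top[of 0]
      proof eventually_elim
        case (elim t)
        then have "0 < surv (c * t) / surv t" using c by (intro divide_pos_pos surv_pos) auto
        then show ?case using False by linarith
      qed
    next
      case True
      have "c < a powr (- \<gamma>)"
        using powr_less_mono2_neg[of "- \<gamma>" a "c powr (- 1 / \<gamma>)"] True a \<gamma> unfolding c_eq by simp
      then have "eventually (\<lambda>t. c < G (1 - a * surv t) / G (1 - surv t)) at_top"
        by (rule order_tendstoD(1)[OF rv[OF True]])
      then show ?thesis using small[OF True] eventually_gt_at_top[of 0]
      proof eventually_elim
        case (elim t)
        have st: "0 < surv t" using elim by (intro surv_pos) simp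
        have ct: "0 \<le> c * t" using c elim by simp
        have "c * (\<mu> * t) < G (1 - a * surv t)"
          using elim \<mu>_pos by (simp add: G_surv field_simps)
        then have "G (1 - surv (c * t)) < G (1 - a * surv t)" using G_surv[OF ct] by (simp add: ac_simps)
        then have "1 - surv (c * t) < 1 - a * surv t"
          using surv_pos[OF ct] surv_le_1[of "c * t"] st True elim by (subst (asm) G_less_iff) auto
        then show ?case using st by (simp add: field_simps)
      qed
    qed
  next
    fix a assume a: "c powr (- 1 / \<gamma>) < a"
    then have a0: "0 < a" using cp by linarith
    have "a powr (- \<gamma>) < c"
      using powr_less_mono2_neg[of "- \<gamma>" "c powr (- 1 / \<gamma>)" a] cp a \<gamma> unfolding c_eq by simp
    then have "eventually (\<lambda>t. G (1 - a * surv t) / G (1 - surv t) < c) at_top"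
      by (rule order_tendstoD(2)[OF rv[OF a0]])
    then show "eventually (\<lambda>t. surv (c * t) / surv t < a) at_top"
      using small[OF a0] eventually_gt_at_top[of 0]
    proof eventually_elim
      case (elim t)
      have st: "0 < surv t" using elim by (intro surv_pos) simp
      have ct: "0 \<le> c * t" using c elim by simp
      have "G (1 - a * surv t) < c * (\<mu> * t)"
        using elim \<mu>_pos by (simp add: G_surv field_simps)
      then have "G (1 - a * surv t) < G (1 - surv (c * t))" using G_surv[OF ct] by (simp add: ac_simps)
      then have "1 - a * surv t < 1 - surv (c * t)"
        using surv_pos[OF ct] surv_le_1[of "c * t"] st a0 elim by (subst (asm) G_less_iff) auto
      then show ?case using st by (simp add: field_simps)
    qed
  qed
qed

text \<open>
  \<open>1 - exp (- y surv t)\<close> is asymptotically \<open>y surv t\<close>, so \<open>G\<close> at \<open>exp (- y surv t)\<close> is compared with \<open>G (1 - surv t) = \<mu> t\<close>.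
\<close>
lemma delay_ratio:
  assumes L: "slowly_varying L" and \<gamma>: "0 < \<gamma>"
    and offspring: "\<And>s. 0 \<le> s \<Longrightarrow> s < 1 \<Longrightarrow> pgf p s = s + (1 - s) powr (\<gamma> + 1) * L (1 / (1 - s))"
    and y: "0 < y"
  shows "((\<lambda>t. G (exp (- y * surv t)) / \<mu> / t) \<longlongrightarrow> y powr (- \<gamma>)) at_top"
proof -
  have e: "((\<lambda>u. (1 - exp (- y * u)) / u) \<longlongrightarrow> y) (at_right 0)" by real_asymp
  have "((\<lambda>t. - G (1 - (1 - exp (- y * surv t))) / G (1 - surv t)) \<longlongrightarrow> - (y powr (- \<gamma>))) at_top"
  proof (rule monotone_regular_variation[where \<phi>="\<lambda>u. - G (1 - u)" and w="\<lambda>u. G (1 - u)" and \<rho>="\<lambda>c. - (c powr (- \<gamma>))" and c=y and x=surv])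
    show "- G (1 - u) \<le> - G (1 - v)" if "0 < u" "u \<le> v" "v \<le> 1" for u v
      using G_strict_mono[of "1 - v" "1 - u"] that by (cases "u = v") auto
    show "0 < G (1 - u)" if "0 < u" "u < 1" for u
      using G_strict_mono[of 0 "1 - u"] that by simp
    show "((\<lambda>u. - G (1 - c * u) / G (1 - u)) \<longlongrightarrow> - (c powr (- \<gamma>))) (at_right 0)" if "0 < c" for c
      using tendsto_minus[OF G_regularly_varying[OF L offspring that]] by simp
    show "isCont (\<lambda>c. - (c powr (- \<gamma>))) y" using y by (intro continuous_intros) auto
    show "((\<lambda>t. (1 - exp (- y * surv t)) / surv t) \<longlongrightarrow> y) at_top"
      by (rule filterlim_compose[OF e surv_at_right_0])
  qed (use y surv_at_right_0 in auto)
  from tendsto_minus[OF this]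
  have "((\<lambda>t. G (exp (- y * surv t)) / G (1 - surv t)) \<longlongrightarrow> y powr (- \<gamma>)) at_top" by simp
  then show ?thesis
  proof (rule Lim_transform_eventually)
    show "eventually (\<lambda>t. G (exp (- y * surv t)) / G (1 - surv t) = G (exp (- y * surv t)) / \<mu> / t) at_top"
      using eventually_ge_at_top[of 0] by eventually_elim (simp add: G_surv)
  qed
qed

end

section \<open>Laplace transforms on the half-line\<close>

lemma (in real_distribution) integrable_exp_neg:
  assumes nn: "measure M {..<0} = 0" and y: "0 \<le> y"
  shows "integrable M (\<lambda>x. exp (- y * x))" "AE x in M. 0 \<le> x"
proof -
  have "emeasure M {..<0} = 0" using nn by (simp add: emeasure_eq_measure)
  then show ae: "AE x in M. 0 \<le> x"
    by (intro AE_I[of _ _ "{..<0}"]) auto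
  show "integrable M (\<lambda>x. exp (- y * x))"
  proof (rule integrable_const_bound[where B=1])
    show "AE x in M. norm (exp (- y * x)) \<le> 1"
      using ae by eventually_elim (use y in simp)
  qed simp
qed

lemma integral_polynomial_exp_eq:
  assumes A: "real_distribution A" "measure A {..<0} = 0"
    and B: "real_distribution B" "measure B {..<0} = 0"
    and LT: "\<And>y. 0 < y \<Longrightarrow> (\<integral>x. exp (- y * x) \<partial>A) = (\<integral>x. exp (- y * x) \<partial>B)"
  shows "(\<integral>x. (\<Sum>i\<le>n. a i * exp (- x) ^ i) \<partial>A) = (\<integral>x. (\<Sum>i\<le>n. a i * exp (- x) ^ i) \<partial>B)"
proof -
  interpret A: real_distribution A by fact
  interpret B: real_distribution B by fact
  have e: "exp (- x) ^ i = exp (- real i * x)" for x :: real and i by (simp add: exp_of_nat_mult[symmetric])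
  have "(\<integral>x. exp (- real i * x) \<partial>A) = (\<integral>x. exp (- real i * x) \<partial>B)" for i
    using LT[of "real i"] by (cases "i = 0") (auto simp: A.prob_space B.prob_space A.prob_space[simplified] B.prob_space[simplified])
  moreover have "integrable A (\<lambda>x. exp (- real i * x))" "integrable B (\<lambda>x. exp (- real i * x))" for i
    using A.integrable_exp_neg[OF A(2), of "real i"] B.integrable_exp_neg[OF B(2), of "real i"] by auto
  ultimately show ?thesis
    unfolding e by (simp only: Bochner_Integration.integral_sum integrable_mult_right integral_mult_right_zero)
qed

text \<open>
  In the variable \<open>exp (- x)\<close>, which ranges over \<open>[0, 1]\<close>, the Laplace transforms at integers are the moments, so the
  Weierstrass approximation theorem applies.
\<close>
lemma integral_continuous_exp_eq:
  fixes g :: "real \<Rightarrow> real"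
  assumes A: "real_distribution A" "measure A {..<0} = 0"
    and B: "real_distribution B" "measure B {..<0} = 0"
    and LT: "\<And>y. 0 < y \<Longrightarrow> (\<integral>x. exp (- y * x) \<partial>A) = (\<integral>x. exp (- y * x) \<partial>B)"
    and g: "continuous_on UNIV g"
  shows "(\<integral>x. g (exp (- x)) \<partial>A) = (\<integral>x. g (exp (- x)) \<partial>B)"
proof -
  have gm[measurable]: "g \<in> borel_measurable borel" by (rule borel_measurable_continuous_onI[OF g])
  have approx: "\<bar>(\<integral>x. g (exp (- x)) \<partial>C) - (\<integral>x. (\<Sum>i\<le>n. a i * exp (- x) ^ i) \<partial>C)\<bar> \<le> e"
    if C: "real_distribution C" "measure C {..<0} = 0"
      and ae: "\<And>z. z \<in> {0..1} \<Longrightarrow> \<bar>g z - (\<Sum>i\<le>n. a i * z ^ i)\<bar> < e" for C e a n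
  proof -
    interpret C: real_distribution C by fact
    have nn: "AE x in C. 0 \<le> x" using C.integrable_exp_neg[OF C(2), of 0] by simp
    obtain Bd where Bd: "\<And>z. z \<in> {0..1} \<Longrightarrow> \<bar>g z\<bar> \<le> Bd"
      using compact_imp_bounded[OF compact_continuous_image[OF continuous_on_subset[OF g subset_UNIV] compact_Icc[of 0 1]]]
      unfolding bounded_iff by (metis imageI real_norm_def)
    have i1: "integrable C (\<lambda>x. g (exp (- x)))"
    proof (rule C.integrable_const_bound[where B=Bd])
      show "AE x in C. norm (g (exp (- x))) \<le> Bd" using nn by eventually_elim (use Bd in simp)
    qed simp
    have i2: "integrable C (\<lambda>x. \<Sum>i\<le>n. a i * exp (- x) ^ i)"
    proof (intro Bochner_Integration.integrable_sum integrable_mult_right)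
      fix i
      show "integrable C (\<lambda>x. exp (- x) ^ i)"
      proof (rule C.integrable_const_bound[where B=1])
        show "AE x in C. norm (exp (- x) ^ i) \<le> 1" using nn by eventually_elim (simp add: power_le_one)
      qed simp
    qed
    have "\<bar>(\<integral>x. g (exp (- x)) \<partial>C) - (\<integral>x. (\<Sum>i\<le>n. a i * exp (- x) ^ i) \<partial>C)\<bar>
      = \<bar>\<integral>x. g (exp (- x)) - (\<Sum>i\<le>n. a i * exp (- x) ^ i) \<partial>C\<bar>"
      by (subst Bochner_Integration.integral_diff[OF i1 i2]) simp
    also have "\<dots> \<le> (\<integral>x. \<bar>g (exp (- x)) - (\<Sum>i\<le>n. a i * exp (- x) ^ i)\<bar> \<partial>C)"
      by (rule integral_abs_bound)
    also have "\<dots> \<le> e"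
    proof (rule C.integral_le_const)
      show "integrable C (\<lambda>x. \<bar>g (exp (- x)) - (\<Sum>i\<le>n. a i * exp (- x) ^ i)\<bar>)"
        by (intro integrable_abs Bochner_Integration.integrable_diff i1 i2)
      show "AE x in C. \<bar>g (exp (- x)) - (\<Sum>i\<le>n. a i * exp (- x) ^ i)\<bar> \<le> e"
        using nn
      proof eventually_elim
        case (elim x)
        then show ?case using ae[of "exp (- x)"] by simp
      qed
    qed
    finally show ?thesis .
  qed
  have "\<bar>(\<integral>x. g (exp (- x)) \<partial>A) - (\<integral>x. g (exp (- x)) \<partial>B)\<bar> \<le> e" if "0 < e" for e
  proof -
    obtain P where P: "real_polynomial_function P" "\<And>z. z \<in> {0..1} \<Longrightarrow> \<bar>g z - P z\<bar> < e / 2"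
      using Stone_Weierstrass_real_polynomial_function[OF compact_Icc continuous_on_subset[OF g subset_UNIV], of "e / 2" 0 1] \<open>0 < e\<close>
      by (metis half_gt_zero)
    then obtain a n where "P = (\<lambda>z. \<Sum>i\<le>n. a i * z ^ i)"
      unfolding real_polynomial_function_iff_sum by blast
    with P(2) have b: "\<And>z. z \<in> {0..1} \<Longrightarrow> \<bar>g z - (\<Sum>i\<le>n. a i * z ^ i)\<bar> < e / 2" by simp
    show ?thesis
      using approx[OF A b] approx[OF B b] integral_polynomial_exp_eq[OF A B LT, of a n] by linarith
  qed
  then show ?thesis
    using field_le_epsilon[of "\<bar>(\<integral>x. g (exp (- x)) \<partial>A) - (\<integral>x. g (exp (- x)) \<partial>B)\<bar>" 0] by simp
qed

text \<open>
  The indicator of \<open>x \<le> c\<close>, that is of \<open>exp (- c) \<le> exp (- x)\<close>, is a bounded limit of continuous functions of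
  \<open>exp (- x)\<close>.
\<close>
theorem laplace_transform_unique:
  assumes A: "real_distribution A" "measure A {..<0} = 0"
    and B: "real_distribution B" "measure B {..<0} = 0"
    and LT: "\<And>y. 0 < y \<Longrightarrow> (\<integral>x. exp (- y * x) \<partial>A) = (\<integral>x. exp (- y * x) \<partial>B)"
  shows "A = B"
proof -
  interpret A: real_distribution A by fact
  interpret B: real_distribution B by fact
  have cdf_lim: "(\<lambda>n. \<integral>x. max 0 (1 - real n * max 0 (exp (- c) - exp (- x))) \<partial>C) \<longlonglongrightarrow> cdf C c"
    if "real_distribution C" for C c
  proof -
    interpret C: real_distribution C by fact
    have "(\<lambda>n. \<integral>x. max 0 (1 - real n * max 0 (exp (- c) - exp (- x))) \<partial>C) \<longlonglongrightarrow> (\<integral>x. indicator {..c} x \<partial>C)"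
    proof (rule integral_dominated_convergence[where w="\<lambda>_. 1"])
      show "AE x in C. (\<lambda>n. max 0 (1 - real n * max 0 (exp (- c) - exp (- x)))) \<longlonglongrightarrow> indicator {..c} x"
      proof (rule AE_I2)
        fix x
        show "(\<lambda>n. max 0 (1 - real n * max 0 (exp (- c) - exp (- x)))) \<longlonglongrightarrow> indicator {..c} x"
        proof (cases "x \<le> c")
          case True
          then show ?thesis by simp
        next
          case False
          define \<delta> where "\<delta> = exp (- c) - exp (- x)"
          have \<delta>: "0 < \<delta>" using False by (simp add: \<delta>_def)
          have "eventually (\<lambda>n. max 0 (1 - real n * max 0 \<delta>) = 0) sequentially"
            using eventually_ge_at_top[of "nat \<lceil>1 / \<delta>\<rceil>"]
          proof eventually_elim
            case (elim n)
            then have "1 / \<delta> \<le> real n" by linarith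
            then show ?case using \<delta> by (simp add: field_simps)
          qed
          then show ?thesis using False by (auto simp: \<delta>_def intro: tendsto_eventually)
        qed
      qed
      show "AE x in C. norm (max 0 (1 - real n * max 0 (exp (- c) - exp (- x)))) \<le> 1" for n
        by (rule AE_I2) auto
    qed auto
    then show ?thesis by (simp add: cdf_def)
  qed
  have "cdf A c = cdf B c" for c
  proof (rule LIMSEQ_unique[OF cdf_lim[OF A(1)]])
    have "(\<integral>x. max 0 (1 - real n * max 0 (exp (- c) - exp (- x))) \<partial>A) = (\<integral>x. max 0 (1 - real n * max 0 (exp (- c) - exp (- x))) \<partial>B)" for n
      by (rule integral_continuous_exp_eq[OF A B LT, of "\<lambda>z. max 0 (1 - real n * max 0 (exp (- c) - z))"])
         (auto intro!: continuous_intros)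
    then show "(\<lambda>n. \<integral>x. max 0 (1 - real n * max 0 (exp (- c) - exp (- x))) \<partial>A) \<longlonglongrightarrow> cdf B c"
      using cdf_lim[OF B(1), of c] by simp
  qed
  then show ?thesis
    by (intro cdf_unique) (auto intro: A(1) B(1))
qed

text \<open>
  Markov's inequality for \<open>1 - exp (- y x)\<close>; with \<open>y = ln 2 / b\<close> this is \<open>1 / 2\<close> at \<open>x = b\<close>.
\<close>
lemma (in real_distribution) tail_le_laplace:
  assumes nn: "measure M {..<0} = 0" and b: "0 < b"
  shows "measure M {b<..} \<le> 2 * (1 - (\<integral>x. exp (- (ln 2 / b) * x) \<partial>M))"
proof -
  let ?y = "ln 2 / b"
  have y: "0 < ?y" using b by simp
  note int = integrable_exp_neg[OF nn less_imp_le[OF y]]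
  have "measure M {b<..} = (\<integral>x. indicator {b<..} x \<partial>M)" by simp
  also have "\<dots> \<le> (\<integral>x. 2 * (1 - exp (- ?y * x)) \<partial>M)"
  proof (rule integral_mono_AE)
    show "integrable M (indicat_real {b<..})"
      by (rule integrable_const_bound[where B=1]) auto
    show "integrable M (\<lambda>x. 2 * (1 - exp (- ?y * x)))"
      using int(1) by simp
    show "AE x in M. indicator {b<..} x \<le> 2 * (1 - exp (- ?y * x))"
      using int(2)
    proof eventually_elim
      case (elim x)
      show ?case
      proof (cases "b < x")
        case True
        then have "?y * b \<le> ?y * x" using y by (intro mult_left_mono) auto
        then have "ln 2 \<le> ?y * x" using b by simp
        then have "exp (- ?y * x) \<le> exp (- ln 2)" by simp
        also have "\<dots> = 1 / 2" by (simp add: exp_minus)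
        finally show ?thesis using True by simp
      next
        case False
        have "0 \<le> ?y * x" using y elim by (intro mult_nonneg_nonneg) auto
        then show ?thesis using False by simp
      qed
    qed
  qed
  also have "\<dots> = 2 * (1 - (\<integral>x. exp (- ?y * x) \<partial>M))"
    using int(1) prob_space by simp
  finally show ?thesis .
qed

text \<open>
  For large \<open>n\<close> the tails are bounded by the Laplace transforms near 0, where \<open>\<psi>\<close> is close to 1; the remaining finitely
  many laws are tight anyway.
\<close>
lemma tight_laplace:
  fixes \<psi> :: "real \<Rightarrow> real"
  assumes \<mu>: "\<And>n. real_distribution (\<mu> n)" "\<And>n. measure (\<mu> n) {..<0} = 0"
    and LT: "\<And>y. 0 < y \<Longrightarrow> (\<lambda>n. \<integral>x. exp (- y * x) \<partial>\<mu> n) \<longlonglongrightarrow> \<psi> y"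
    and \<psi>: "(\<psi> \<longlongrightarrow> 1) (at_right 0)"
  shows "tight \<mu>"
  unfolding tight_def
proof (intro conjI allI impI \<mu>)
  fix \<epsilon> :: real assume \<epsilon>: "0 < \<epsilon>"
  interpret \<mu>: real_distribution "\<mu> n" for n by (rule \<mu>)
  have "eventually (\<lambda>y. 1 - \<epsilon> / 2 < \<psi> y \<and> 0 < y) (at_right 0)"
    using order_tendstoD(1)[OF \<psi>, of "1 - \<epsilon> / 2"] \<epsilon> eventually_at_right_less[of 0] by (auto elim: eventually_elim2)
  then obtain y where y: "1 - \<epsilon> / 2 < \<psi> y" "0 < y"
    using eventually_happens[of _ "at_right (0 :: real)"] by auto
  define b0 where "b0 = ln 2 / y"
  have b0: "0 < b0" "ln 2 / b0 = y" using y by (auto simp: b0_def)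
  have "eventually (\<lambda>n. 1 - \<epsilon> / 2 < (\<integral>x. exp (- y * x) \<partial>\<mu> n)) sequentially"
    by (rule order_tendstoD(1)[OF LT[OF y(2)] y(1)])
  then obtain n0 where n0: "\<And>n. n0 \<le> n \<Longrightarrow> 1 - \<epsilon> / 2 < (\<integral>x. exp (- y * x) \<partial>\<mu> n)"
    unfolding eventually_sequentially by blast
  have large: "measure (\<mu> n) {b0<..} < \<epsilon>" if "n0 \<le> n" for n
    using \<mu>.tail_le_laplace[OF \<mu>(2) b0(1), of n] n0[OF that] unfolding b0(2) by simp
  have mono: "measure (\<mu> n) {b<..} \<le> measure (\<mu> n) {a<..}" if "a \<le> b" for n and a b :: real
    by (rule \<mu>.finite_measure_mono) (use that in auto)
  have small: "\<exists>b\<ge>b0. \<forall>n<m. measure (\<mu> n) {b<..} < \<epsilon>" for m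
  proof (induction m)
    case 0
    then show ?case by auto
  next
    case (Suc m)
    then obtain b where b: "b0 \<le> b" "\<And>n. n < m \<Longrightarrow> measure (\<mu> n) {b<..} < \<epsilon>" by blast
    have "eventually (\<lambda>x. 1 - \<epsilon> < cdf (\<mu> m) x) at_top"
      by (rule order_tendstoD(1)[OF \<mu>.cdf_lim_at_top_prob]) (use \<epsilon> in simp)
    then obtain c where c: "1 - \<epsilon> < cdf (\<mu> m) c"
      using eventually_happens[of _ "at_top :: real filter"] by auto
    have "measure (\<mu> m) {c<..} = 1 - cdf (\<mu> m) c"
      unfolding cdf_def using \<mu>.prob_compl[of "{..c}" m] by (simp add: Compl_eq_Diff_UNIV[symmetric])
    then have "measure (\<mu> m) {c<..} < \<epsilon>" using c by simp
    then have "measure (\<mu> n) {max b c<..} < \<epsilon>" if "n < Suc m" for n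
      using b(2)[of n] mono[of b "max b c" n] mono[of c "max b c" n] that by (cases "n = m") auto
    then show ?case using b(1) by (intro exI[of _ "max b c"]) auto
  qed
  then obtain b where b: "b0 \<le> b" "\<And>n. n < n0 \<Longrightarrow> measure (\<mu> n) {b<..} < \<epsilon>" by blast
  have tail: "measure (\<mu> n) {b<..} < \<epsilon>" for n
    using b(2)[of n] large[of n] mono[OF b(1), of n] by (cases "n < n0") auto
  have "1 - \<epsilon> < measure (\<mu> n) {-1<..b}" for n
  proof -
    have "1 = measure (\<mu> n) UNIV" using \<mu>.prob_space[of n] by simp
    also have "\<dots> \<le> measure (\<mu> n) ({..<0} \<union> ({-1<..b} \<union> {b<..}))"
      by (rule \<mu>.finite_measure_mono) auto
    also have "\<dots> \<le> measure (\<mu> n) {..<0} + (measure (\<mu> n) {-1<..b} + measure (\<mu> n) {b<..})"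
      by (intro order_trans[OF measure_Un_le] add_left_mono measure_Un_le) auto
    finally show ?thesis using tail[of n] \<mu>(2)[of n] by simp
  qed
  moreover have "-1 < b" using b0 b by simp
  ultimately show "\<exists>a b. a < b \<and> (\<forall>n. 1 - \<epsilon> < measure (\<mu> n) {a<..b})" by blast
qed

text \<open>
  Weak convergence tests bounded functions only.  Therefore the limit is first shown to live on the half-line, where
  \<open>exp (- y x)\<close> agrees with the bounded function \<open>exp (- y max 0 x)\<close>.
\<close>
lemma laplace_weak_limit:
  fixes \<psi> :: "real \<Rightarrow> real"
  assumes \<mu>: "\<And>n. real_distribution (\<mu> n)" "\<And>n. measure (\<mu> n) {..<0} = 0"
    and LT: "\<And>y. 0 < y \<Longrightarrow> (\<lambda>n. \<integral>x. exp (- y * x) \<partial>\<mu> n) \<longlonglongrightarrow> \<psi> y"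
    and N: "real_distribution N" "weak_conv_m \<mu> N"
  shows "measure N {..<0} = 0" "\<And>y. 0 < y \<Longrightarrow> (\<integral>x. exp (- y * x) \<partial>N) = \<psi> y"
proof -
  interpret \<mu>: real_distribution "\<mu> n" for n by (rule \<mu>)
  interpret N: real_distribution N by fact
  have AEpos: "AE x in \<mu> n. 0 \<le> x" for n using \<mu>.integrable_exp_neg(2)[OF \<mu>(2), of 0] by simp
  have conv: "(\<lambda>n. \<integral>x. f x \<partial>\<mu> n) \<longlonglongrightarrow> (\<integral>x. f x \<partial>N)"
    if "\<And>x. isCont f x" "\<And>x. \<bar>f x\<bar> \<le> 1" for f :: "real \<Rightarrow> real"
    by (rule weak_conv_imp_integral_bdd_continuous_conv[OF _ _ N(2)]) (use \<mu> N that in auto)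
  have "(\<integral>x. min 1 (max 0 (- x)) \<partial>\<mu> n) = 0" for n
  proof -
    have "(\<integral>x. min 1 (max 0 (- x)) \<partial>\<mu> n) = (\<integral>x. 0 \<partial>\<mu> n)"
      by (rule integral_cong_AE) (use AEpos[of n] in \<open>auto elim: eventually_mono\<close>)
    then show ?thesis by simp
  qed
  with conv[of "\<lambda>x. min 1 (max 0 (- x))"] have "(\<lambda>n. 0) \<longlonglongrightarrow> (\<integral>x. min 1 (max 0 (- x)) \<partial>N)"
    by (simp add: isCont_def continuous_intros tendsto_intros)
  then have z: "(\<integral>x. min 1 (max 0 (- x)) \<partial>N) = 0" using LIMSEQ_unique tendsto_const by blast
  have "AE x in N. min 1 (max 0 (- x)) = 0"
    by (subst integral_nonneg_eq_0_iff_AE[symmetric])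
       (use z in \<open>auto intro!: N.integrable_const_bound[where B=1]\<close>)
  then have "AE x in N. x \<notin> {..<0}" by eventually_elim (auto simp: min_def max_def split: if_splits)
  then show nn: "measure N {..<0} = 0"
    by (subst N.prob_eq_0) auto
  fix y :: real assume y: "0 < y"
  have e: "(\<integral>x. exp (- y * max 0 x) \<partial>C) = (\<integral>x. exp (- y * x) \<partial>C)" if "real_distribution C" "measure C {..<0} = 0" for C
  proof -
    interpret C: real_distribution C by fact
    have "AE x in C. exp (- y * max 0 x) = exp (- y * x)"
      using C.integrable_exp_neg(2)[OF that(2) order_refl] by eventually_elim (simp add: max_def)
    then show ?thesis by (rule integral_cong_AE[rotated 2]) auto
  qed
  have "(\<lambda>n. \<integral>x. exp (- y * max 0 x) \<partial>\<mu> n) \<longlonglongrightarrow> (\<integral>x. exp (- y * max 0 x) \<partial>N)"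
    by (rule conv) (use y in \<open>auto simp: isCont_def intro!: tendsto_intros\<close>)
  then show "(\<integral>x. exp (- y * x) \<partial>N) = \<psi> y"
    using LT[OF y] unfolding e[OF \<mu>] e[OF N(1) nn] by (rule LIMSEQ_unique)
qed

text \<open>
  Helly's theorem provides limits along subsequences, and all of them have the Laplace transform \<open>\<psi>\<close>.  That such a law
  exists at all is part of the conclusion.
\<close>
theorem laplace_continuity:
  fixes \<psi> :: "real \<Rightarrow> real"
  assumes \<mu>: "\<And>n. real_distribution (\<mu> n)" "\<And>n. measure (\<mu> n) {..<0} = 0"
    and LT: "\<And>y. 0 < y \<Longrightarrow> (\<lambda>n. \<integral>x. exp (- y * x) \<partial>\<mu> n) \<longlonglongrightarrow> \<psi> y"
    and \<psi>: "(\<psi> \<longlongrightarrow> 1) (at_right 0)"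
  shows "\<exists>N. real_distribution N \<and> measure N {..<0} = 0 \<and> (\<forall>y>0. (\<integral>x. exp (- y * x) \<partial>N) = \<psi> y) \<and> weak_conv_m \<mu> N"
proof -
  have tight: "tight \<mu>" by (rule tight_laplace[OF \<mu> LT \<psi>])
  have sub: "measure N {..<0} = 0 \<and> (\<forall>y>0. (\<integral>x. exp (- y * x) \<partial>N) = \<psi> y)"
    if s: "strict_mono s" and N: "real_distribution N" "weak_conv_m (\<mu> \<circ> s) N" for s N
  proof -
    have "(\<lambda>n. \<integral>x. exp (- y * x) \<partial>(\<mu> \<circ> s) n) \<longlonglongrightarrow> \<psi> y" if "0 < y" for y
      using LIMSEQ_subseq_LIMSEQ[OF LT[OF that] s] by (simp add: o_def)
    then show ?thesis
      using laplace_weak_limit[of "\<mu> \<circ> s" \<psi> N] \<mu> N by auto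
  qed
  obtain r N where r: "strict_mono r" "real_distribution N" "weak_conv_m (\<mu> \<circ> id \<circ> r) N"
    using tight_imp_convergent_subsubsequence[OF tight strict_mono_id] by blast
  then have N: "measure N {..<0} = 0" "\<And>y. 0 < y \<Longrightarrow> (\<integral>x. exp (- y * x) \<partial>N) = \<psi> y"
    using sub[of r N] by auto
  have "weak_conv_m \<mu> N"
  proof (rule tight_subseq_weak_converge[OF \<mu>(1) r(2) tight])
    fix s \<nu> assume s: "strict_mono s" "real_distribution \<nu>" "weak_conv_m (\<mu> \<circ> s) \<nu>"
    from sub[OF this] have "\<nu> = N"
      using N by (intro laplace_transform_unique s r) auto
    then show "weak_conv_m (\<mu> \<circ> s) N" using s by simp
  qed
  then show ?thesis using N r by blast
qed

section \<open>The limit law\<close>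

lemma Mittag_Leffler_LT_at_0:
  fixes p \<gamma> :: real assumes "0 < \<gamma>"
  shows "((\<lambda>y. 1 - p * (y powr \<gamma> / (1 + y powr \<gamma>))) \<longlongrightarrow> 1) (at_right 0)"
proof -
  have "((\<lambda>y. y powr \<gamma>) \<longlongrightarrow> 0) (at_right 0)"
    using assms by real_asymp
  then have "((\<lambda>y. 1 - p * (y powr \<gamma> / (1 + y powr \<gamma>))) \<longlongrightarrow> 1 - p * (0 / (1 + 0))) (at_right 0)"
    by (intro tendsto_intros) auto
  then show ?thesis by simp
qed

text \<open>
  Written as a defect from 1, the transform has the shape in which the limit arises.
\<close>
lemma limit_law_LT:
  fixes d \<gamma> y :: real assumes "0 \<le> d"
  shows "d / (1 + d) + 1 / (1 + d) * (1 / (1 + y powr \<gamma>)) = 1 - 1 / (1 + d) * (y powr \<gamma> / (1 + y powr \<gamma>))"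
proof -
  have "1 + y powr \<gamma> \<noteq> 0" using powr_ge_zero[of y \<gamma>] by linarith
  then have 1: "y powr \<gamma> / (1 + y powr \<gamma>) = 1 - 1 / (1 + y powr \<gamma>)" by (simp add: field_simps)
  have 2: "d / (1 + d) = 1 - 1 / (1 + d)" using assms by (simp add: field_simps)
  show ?thesis unfolding 1 2 by (simp add: right_diff_distrib)
qed

text \<open>
  The mass at 0 is the limit of the Laplace transform at infinity.
\<close>
lemma limit_law_atom_0:
  assumes N: "limit_law \<gamma> d N" and d: "0 \<le> d" and \<gamma>: "0 < \<gamma>"
  shows "measure N {0} = d / (1 + d)"
proof -
  interpret N: real_distribution N using N by (simp add: limit_law_def)
  have nn: "measure N {..<0} = 0" using N by (simp add: limit_law_def)
  have ae: "AE x in N. 0 \<le> x" using N.integrable_exp_neg(2)[OF nn order_refl] .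
  have "(\<lambda>n. \<integral>x. exp (- real (Suc n) * x) \<partial>N) \<longlonglongrightarrow> (\<integral>x. indicator {0} x \<partial>N)"
  proof (rule integral_dominated_convergence[where w="\<lambda>_. 1"])
    show "AE x in N. (\<lambda>n. exp (- real (Suc n) * x)) \<longlonglongrightarrow> indicator {0} x"
      using ae
    proof eventually_elim
      case (elim x)
      show ?case
      proof (cases "x = 0")
        case False
        then have "0 < x" using elim by simp
        then have "(\<lambda>n. exp (- real (Suc n) * x)) \<longlonglongrightarrow> 0" by real_asymp
        then show ?thesis using False by simp
      qed simp
    qed
    show "AE x in N. norm (exp (- real (Suc n) * x)) \<le> 1" for n
      using ae
    proof eventually_elim
      case (elim x)
      then have "0 \<le> real (Suc n) * x" by (intro mult_nonneg_nonneg) auto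
      then show ?case by (simp del: of_nat_Suc)
    qed
  qed auto
  moreover have "(\<lambda>n. \<integral>x. exp (- real (Suc n) * x) \<partial>N) \<longlonglongrightarrow> d / (1 + d) + 1 / (1 + d) * 0"
  proof -
    have LT: "(\<integral>x. exp (- y * x) \<partial>N) = d / (1 + d) + 1 / (1 + d) * (1 / (1 + y powr \<gamma>))" if "0 < y" for y
      using N that unfolding limit_law_def by simp
    have eq: "(\<integral>x. exp (- real (Suc n) * x) \<partial>N) = d / (1 + d) + 1 / (1 + d) * (1 / (1 + real (Suc n) powr \<gamma>))" for n
      by (rule LT) simp
    have lim: "(\<lambda>n. 1 / (1 + real (Suc n) powr \<gamma>)) \<longlonglongrightarrow> 0"
      using \<gamma> by real_asymp
    show ?thesis unfolding eq by (intro tendsto_add tendsto_const tendsto_mult lim)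
  qed
  ultimately show ?thesis by (simp add: LIMSEQ_unique)
qed

lemma limit_law_unique: "limit_law \<gamma> d A \<Longrightarrow> limit_law \<gamma> d B \<Longrightarrow> A = B"
  unfolding limit_law_def by (intro laplace_transform_unique) auto

text \<open>
  Conditioning on \<open>(0, \<infinity>)\<close> removes the atom at the origin and leaves the Mittag-Leffler law, which is the case
  \<open>d = 0\<close>.
\<close>
lemma limit_law_reduce:
  assumes N: "limit_law \<gamma> d N" and d: "0 \<le> d" and \<gamma>: "0 < \<gamma>"
  obtains D where "limit_law \<gamma> 0 D" "\<And>x. 0 < x \<Longrightarrow> measure N {x} \<le> measure D {x}"
proof -
  interpret N: real_distribution N using N by (simp add: limit_law_def)
  have nn: "measure N {..<0} = 0" using N by (simp add: limit_law_def)
  let ?p = "measure N {0<..}"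
  have p: "?p = 1 / (1 + d)"
  proof -
    have "1 = measure N UNIV" using N.prob_space by simp
    also have "(UNIV :: real set) = {..<0} \<union> ({0} \<union> {0<..})" by auto
    also have "measure N \<dots> = measure N {..<0} + (measure N {0} + ?p)"
      by (subst N.finite_measure_Union; (subst N.finite_measure_Union)?) auto
    finally show ?thesis
      using nn limit_law_atom_0[OF N d \<gamma>] d by (simp add: field_simps)
  qed
  have ppos: "0 < ?p" unfolding p using d by simp
  have emp: "emeasure N {0<..} = ennreal ?p" by (rule N.emeasure_eq_measure)
  define D where "D = uniform_measure N {0<..}"
  interpret D: prob_space D
    unfolding D_def by (rule prob_space_uniform_measure) (use ppos emp in auto)
  have sD: "sets D = sets borel" by (simp add: D_def)
  have DD: "real_distribution D" by standard (simp_all add: sD sets_eq_imp_space_eq[OF sD])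
  have mD: "measure D A = measure N ({0<..} \<inter> A) / ?p" if "A \<in> sets borel" for A
    unfolding D_def by (rule measure_uniform_measure) (use that ppos emp in auto)
  have "limit_law \<gamma> 0 D"
    unfolding limit_law_def
  proof (intro conjI allI impI DD)
    have "{0<..} \<inter> {..<0 :: real} = {}" by auto
    then show "measure D {..<0} = 0" by (simp add: mD)
    fix y :: real assume y: "0 < y"
    have "(\<integral>x. exp (- y * x) \<partial>D) = (\<integral>x. indicator {0<..} x * exp (- y * x) \<partial>N) / ?p"
    proof -
      have "D = density N (\<lambda>x. ennreal (indicator {0<..} x / ?p))"
        unfolding D_def uniform_measure_def emp
        by (intro density_cong) (use ppos divide_ennreal[of 1 ?p] in \<open>auto simp: indicator_def\<close>)
      then have "(\<integral>x. exp (- y * x) \<partial>D) = (\<integral>x. (indicator {0<..} x / ?p) *\<^sub>R exp (- y * x) \<partial>N)"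
        by (simp only:) (rule integral_density, use ppos in auto)
      then show ?thesis by simp
    qed
    also have "(\<integral>x. indicator {0<..} x * exp (- y * x) \<partial>N) = (\<integral>x. exp (- y * x) - indicator {0} x \<partial>N)"
      by (rule integral_cong_AE)
         (use N.integrable_exp_neg(2)[OF nn order_refl] in \<open>auto simp: indicator_def elim!: eventually_mono\<close>)
    also have "\<dots> = (\<integral>x. exp (- y * x) \<partial>N) - measure N {0}"
      using N.integrable_exp_neg(1)[OF nn, of y] y
      by (subst Bochner_Integration.integral_diff) (auto intro!: N.integrable_const_bound[where B=1])
    also have "\<dots> = 1 / (1 + d) * (1 / (1 + y powr \<gamma>))"
      using N y limit_law_atom_0[OF N d \<gamma>] unfolding limit_law_def by simp
    finally show "(\<integral>x. exp (- y * x) \<partial>D) = 0 / (1 + 0) + 1 / (1 + 0) * (1 / (1 + y powr \<gamma>))"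
      using d by (simp add: p)
  qed
  moreover have "measure N {x} \<le> measure D {x}" if "0 < x" for x
  proof -
    have "measure N {x} * ?p \<le> measure N {x}"
      by (rule mult_left_le) auto
    then show ?thesis using that ppos by (simp add: mD field_simps)
  qed
  ultimately show ?thesis using that by blast
qed

text \<open>
  Self-decomposability.  With \<open>\<psi>(y) = 1 / (1 + y\<^sup>\<gamma>)\<close> one has \<open>\<psi>(y) = \<psi>(cy) (c\<^sup>\<gamma> + (1 - c\<^sup>\<gamma>) \<psi>(y))\<close>, so
  \<open>c U + B V\<close> has law \<open>D\<close> when \<open>U\<close> and \<open>V\<close> have law \<open>D\<close>, \<open>B\<close> is a Bernoulli variable with parameter \<open>1 - c\<^sup>\<gamma>\<close>, and all three are independent.
  The atoms of both sides are compared.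
\<close>
lemma Mittag_Leffler_decompose:
  assumes D: "limit_law \<gamma> 0 D" and c: "0 < c" "c < 1" and \<gamma>: "0 < \<gamma>"
  shows "measure D {x} = c powr \<gamma> * measure D {x / c} + (1 - c powr \<gamma>) * (\<integral>u. measure D {x - c * u} \<partial>D)"
proof -
  interpret D: real_distribution D using D by (simp add: limit_law_def)
  have nn: "measure D {..<0} = 0" using D by (simp add: limit_law_def)
  have LT: "(\<integral>x. exp (- y * x) \<partial>D) = 1 / (1 + y powr \<gamma>)" if "0 < y" for y
    using D that unfolding limit_law_def by simp
  have ae: "AE x in D. 0 \<le> x" using D.integrable_exp_neg(2)[OF nn order_refl] .
  let ?q = "1 - c powr \<gamma>"
  note [measurable_cong] = D.events_eq_borel
  have cg: "0 < c powr \<gamma>" "c powr \<gamma> < 1"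
    using c \<gamma> powr_less_mono2[of \<gamma> c 1] by auto
  let ?B = "measure_pmf (bernoulli_pmf ?q)"
  interpret DB: pair_prob_space D ?B ..
  interpret P: pair_prob_space D "D \<Otimes>\<^sub>M ?B" ..
  let ?P = "D \<Otimes>\<^sub>M (D \<Otimes>\<^sub>M ?B)"
  let ?X = "\<lambda>w. c * fst w + (if snd (snd w) then fst (snd w) else 0)"
  have Xm[measurable]: "?X \<in> borel_measurable ?P" by measurable
  define E where "E = distr ?P borel ?X"
  have E: "real_distribution E" unfolding E_def by (rule P.real_distribution_distr) measurable
  have iter: "(\<integral>w. f (?X w) \<partial>?P) = (\<integral>u. (\<integral>v. f (c * u + v) * ?q + f (c * u) * c powr \<gamma> \<partial>D) \<partial>D)"
    if f[measurable]: "f \<in> borel_measurable borel" and b: "AE w in ?P. norm (f (?X w)) \<le> 1" and bb: "\<And>v. 0 \<le> v \<Longrightarrow> norm (f v) \<le> 1" for f :: "real \<Rightarrow> real"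
  proof -
    have "(\<integral>w. f (?X w) \<partial>?P) = (\<integral>u. \<integral>z. f (?X (u, z)) \<partial>(D \<Otimes>\<^sub>M ?B) \<partial>D)"
      by (rule P.integral_fst'[symmetric]) (rule P.integrable_const_bound[OF b], measurable)
    also have "\<dots> = (\<integral>u. (\<integral>v. f (c * u + v) * ?q + f (c * u) * c powr \<gamma> \<partial>D) \<partial>D)"
    proof (rule integral_cong_AE)
      show "AE u in D. (\<integral>z. f (?X (u, z)) \<partial>(D \<Otimes>\<^sub>M ?B)) = (\<integral>v. f (c * u + v) * ?q + f (c * u) * c powr \<gamma> \<partial>D)"
        using ae
      proof eventually_elim
        case (elim u)
        have "AE z in D \<Otimes>\<^sub>M ?B. 0 \<le> fst z"
          by (rule DB.AE_pair_measure) (use ae in \<open>auto elim!: eventually_mono\<close>)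
        then have "AE z in D \<Otimes>\<^sub>M ?B. norm (f (?X (u, z))) \<le> 1"
          by eventually_elim
            (use elim c in \<open>auto intro!: bb[unfolded real_norm_def] add_nonneg_nonneg mult_nonneg_nonneg\<close>)
        moreover have "(\<lambda>z. f (c * u + (if snd z then fst z else 0))) \<in> borel_measurable (D \<Otimes>\<^sub>M ?B)"
          by measurable
        ultimately have "integrable (D \<Otimes>\<^sub>M ?B) (\<lambda>z. f (?X (u, z)))"
          by (intro DB.integrable_const_bound[where B=1]) (simp_all cong: if_cong)
        then have "(\<integral>z. f (?X (u, z)) \<partial>(D \<Otimes>\<^sub>M ?B)) = (\<integral>v. \<integral>b. f (?X (u, v, b)) \<partial>?B \<partial>D)"
          by (rule DB.integral_fst'[symmetric])
        also have "\<dots> = (\<integral>v. f (c * u + v) * ?q + f (c * u) * c powr \<gamma> \<partial>D)"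
          using cg by (subst integral_bernoulli_pmf) auto
        finally show ?case .
      qed
    qed measurable
    finally show ?thesis .
  qed
  have aeX: "AE w in ?P. 0 \<le> ?X w"
  proof -
    have "AE w in ?P. 0 \<le> fst w"
    proof (rule P.AE_pair_measure)
      show "{w \<in> space ?P. 0 \<le> fst w} \<in> sets ?P" by measurable
    qed (use ae in \<open>auto elim!: eventually_mono\<close>)
    moreover have "AE w in ?P. 0 \<le> fst (snd w)"
    proof -
      have "AE z in D \<Otimes>\<^sub>M ?B. 0 \<le> fst z"
        by (rule DB.AE_pair_measure) (use ae in \<open>auto elim!: eventually_mono\<close>)
      moreover have "{w \<in> space ?P. 0 \<le> fst (snd w)} \<in> sets ?P" by measurable
      ultimately show ?thesis
        by (intro P.AE_pair_measure) auto
    qed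
    ultimately show ?thesis by eventually_elim (use c in auto)
  qed
  have "E = D"
  proof (rule laplace_transform_unique[OF E _ D.real_distribution_axioms nn])
    have "AE x in E. x \<notin> {..<0}"
      unfolding E_def using aeX by (subst AE_distr_iff) (auto elim!: eventually_mono)
    interpret E: real_distribution E by (rule E)
    show "measure E {..<0} = 0"
      using \<open>AE x in E. x \<notin> {..<0}\<close> by (subst E.prob_eq_0) auto
    fix y :: real assume y: "0 < y"
    have i: "integrable D (\<lambda>x. exp (- y * x))" by (rule D.integrable_exp_neg[OF nn]) (use y in simp)
    have i2: "integrable D (\<lambda>x. exp (- (c * y) * x))" by (rule D.integrable_exp_neg[OF nn]) (use y c in simp)
    have "(\<integral>x. exp (- y * x) \<partial>E) = (\<integral>w. exp (- y * ?X w) \<partial>?P)"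
      unfolding E_def by (rule integral_distr) auto
    also have "\<dots> = (\<integral>u. (\<integral>v. exp (- y * (c * u + v)) * ?q + exp (- y * (c * u)) * c powr \<gamma> \<partial>D) \<partial>D)"
    proof (rule iter)
      show "AE w in ?P. norm (exp (- y * ?X w)) \<le> 1"
        using aeX by eventually_elim (use y in simp)
    qed (use y in auto)
    also have "\<dots> = (\<integral>u. exp (- (c * y) * u) * (?q * (1 / (1 + y powr \<gamma>)) + c powr \<gamma>) \<partial>D)"
    proof (rule Bochner_Integration.integral_cong[OF refl])
      fix u
      have "(\<integral>v. exp (- y * (c * u + v)) * ?q + exp (- y * (c * u)) * c powr \<gamma> \<partial>D)
        = (\<integral>v. (exp (- (c * y) * u) * ?q) * exp (- y * v) + exp (- (c * y) * u) * c powr \<gamma> \<partial>D)"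
        by (rule Bochner_Integration.integral_cong) (auto simp: algebra_simps exp_add exp_diff exp_minus divide_inverse)
      also have "\<dots> = (exp (- (c * y) * u) * ?q) * (1 / (1 + y powr \<gamma>)) + exp (- (c * y) * u) * c powr \<gamma>"
        using LT[OF y]
        by (subst Bochner_Integration.integral_add[OF integrable_mult_right[OF i] D.integrable_const])
           (simp add: D.prob_space[simplified])
      also have "\<dots> = exp (- (c * y) * u) * (?q * (1 / (1 + y powr \<gamma>)) + c powr \<gamma>)"
        by (simp only: distrib_left mult.assoc)
      finally show "(\<integral>v. exp (- y * (c * u + v)) * ?q + exp (- y * (c * u)) * c powr \<gamma> \<partial>D)
        = exp (- (c * y) * u) * (?q * (1 / (1 + y powr \<gamma>)) + c powr \<gamma>)" .
    qed
    also have "\<dots> = (\<integral>u. exp (- (c * y) * u) \<partial>D) * (?q * (1 / (1 + y powr \<gamma>)) + c powr \<gamma>)"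
      by (rule integral_mult_left_zero)
    also have "\<dots> = 1 / (1 + y powr \<gamma>)"
    proof -
      have pos: "0 < 1 + y powr \<gamma>" "0 < 1 + c powr \<gamma> * y powr \<gamma>"
        using cg powr_ge_zero[of y \<gamma>] by (auto intro: add_pos_nonneg)
      have "(c * y) powr \<gamma> = c powr \<gamma> * y powr \<gamma>" using c y by (simp add: powr_mult)
      moreover have "?q * (1 / (1 + y powr \<gamma>)) + c powr \<gamma> = (1 + c powr \<gamma> * y powr \<gamma>) / (1 + y powr \<gamma>)"
        using pos by (simp add: field_simps)
      ultimately show ?thesis using LT[of "c * y"] c y pos by simp
    qed
    finally show "(\<integral>x. exp (- y * x) \<partial>E) = (\<integral>x. exp (- y * x) \<partial>D)" using LT[OF y] by simp
  qed
  have "measure D {x} = measure E {x}" using \<open>E = D\<close> by simp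
  also have "\<dots> = (\<integral>v. indicator {x} v \<partial>E)"
    using E by (simp add: E_def)
  also have "\<dots> = (\<integral>w. indicator {x} (?X w) \<partial>?P)"
    unfolding E_def by (rule integral_distr) auto
  also have "\<dots> = (\<integral>u. (\<integral>v. indicator {x} (c * u + v) * ?q + indicator {x} (c * u) * c powr \<gamma> \<partial>D) \<partial>D)"
    by (rule iter) auto
  also have "\<dots> = (\<integral>u. measure D {x - c * u} * ?q + indicator {x / c} u * c powr \<gamma> \<partial>D)"
  proof (rule Bochner_Integration.integral_cong[OF refl])
    fix u
    have "(\<integral>v. indicator {x} (c * u + v) * ?q + indicator {x} (c * u) * c powr \<gamma> \<partial>D)
      = (\<integral>v. indicator {x - c * u} v * ?q + indicator {x / c} u * c powr \<gamma> \<partial>D)"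
      by (rule Bochner_Integration.integral_cong) (use c in \<open>auto simp: indicator_def field_simps\<close>)
    also have "\<dots> = measure D {x - c * u} * ?q + indicator {x / c} u * c powr \<gamma>"
      by (subst Bochner_Integration.integral_add)
         (use D.prob_space in \<open>auto intro!: integrable_mult_left D.integrable_const_bound[where B=1]\<close>)
    finally show "(\<integral>v. indicator {x} (c * u + v) * ?q + indicator {x} (c * u) * c powr \<gamma> \<partial>D)
      = measure D {x - c * u} * ?q + indicator {x / c} u * c powr \<gamma>" .
  qed
  also have "\<dots> = (\<integral>u. measure D {x - c * u} \<partial>D) * ?q + measure D {x / c} * c powr \<gamma>"
  proof -
    have "(\<lambda>u. measure D {x - c * u}) \<in> borel_measurable D"
    proof -
      have "(\<lambda>u. \<integral>v. indicat_real {x} (c * u + v) \<partial>D) \<in> borel_measurable D" by measurable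
      moreover have "(\<integral>v. indicat_real {x} (c * u + v) \<partial>D) = measure D {x - c * u}" for u
      proof -
        have "(\<integral>v. indicat_real {x} (c * u + v) \<partial>D) = (\<integral>v. indicator {x - c * u} v \<partial>D)"
          by (rule Bochner_Integration.integral_cong) (auto simp: indicator_def)
        then show ?thesis by simp
      qed
      ultimately show ?thesis by simp
    qed
    then have "integrable D (\<lambda>u. measure D {x - c * u})"
      by (intro D.integrable_const_bound[where B=1]) auto
    then show ?thesis
      by (subst Bochner_Integration.integral_add)
         (auto intro!: integrable_mult_left D.integrable_const_bound[where B=1])
  qed
  finally show ?thesis by (simp add: algebra_simps)
qed

text \<open>
  Take a largest atom of the Mittag-Leffler law.  In the decomposition its mass is an average of the atom at \<open>x / c\<close> and
  of a mean of atoms, none of which is larger; so the atom at \<open>x / c\<close> is as large.  Iteration gives infinitely many atoms of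
  the same mass.
\<close>
lemma limit_law_no_atom:
  assumes N: "limit_law \<gamma> d N" and d: "0 \<le> d" and \<gamma>: "0 < \<gamma>" and x: "0 < x"
  shows "measure N {x} = 0"
proof -
  obtain D where D: "limit_law \<gamma> 0 D" and ND: "\<And>x. 0 < x \<Longrightarrow> measure N {x} \<le> measure D {x}"
    using limit_law_reduce[OF N d \<gamma>] by blast
  interpret D: real_distribution D using D by (simp add: limit_law_def)
  have D_le0: "measure D {x} = 0" if "x \<le> 0" for x
  proof (cases "x = 0")
    case True
    then show ?thesis using limit_law_atom_0[OF D order_refl \<gamma>] by simp
  next
    case False
    then have "measure D {x} \<le> measure D {..<0}" using that by (intro D.finite_measure_mono) auto
    then show ?thesis using D measure_nonneg[of D "{x}"] unfolding limit_law_def by simp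
  qed
  have fin: "finite {z. a \<le> measure D {z}}" if a: "0 < a" for a
  proof (rule conjunct1, rule finite_if_finite_subsets_card_bdd)
    fix G assume G: "G \<subseteq> {z. a \<le> measure D {z}}" "finite G"
    have "real (card G) * a = (\<Sum>z\<in>G. a)" by simp
    also have "\<dots> \<le> (\<Sum>z\<in>G. measure D {z})" using G by (intro sum_mono) auto
    also have "\<dots> = measure D G"
      using G by (subst D.finite_measure_eq_sum_singleton) auto
    also have "\<dots> \<le> 1" by simp
    finally have "real (card G) \<le> 1 / a" using a by (simp add: field_simps)
    then show "card G \<le> nat \<lfloor>1 / a\<rfloor>" by linarith
  qed
  have "measure D {z} = 0" for z
  proof (rule ccontr)
    assume "measure D {z} \<noteq> 0"
    then have z: "0 < measure D {z}" using measure_nonneg[of D "{z}"] by linarith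
    let ?S = "{v. measure D {z} \<le> measure D {v}}"
    define m where "m = Max ((\<lambda>v. measure D {v}) ` ?S)"
    have S: "finite ?S" "z \<in> ?S" using fin[OF z] by auto
    have m_le: "measure D {v} \<le> m" for v
    proof (cases "v \<in> ?S")
      case True
      then show ?thesis unfolding m_def using S by (intro Max_ge) auto
    next
      case False
      have "measure D {z} \<le> m" unfolding m_def using S by (intro Max_ge) auto
      then show ?thesis using False by simp
    qed
    have m: "0 < m" using z m_le[of z] by linarith
    have "m \<in> (\<lambda>v. measure D {v}) ` ?S" unfolding m_def using S by (intro Max_in) auto
    then obtain w where w: "measure D {w} = m" by blast
    have w0: "0 < w" using D_le0[of w] w m by (cases "0 < w") auto
    \<comment> \<open>One value of \<open>c\<close> suffices: from the atom at \<open>w\<close> one passes to those at \<open>2\<^sup>k w\<close>.\<close>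
    let ?c = "1 / 2 :: real"
    let ?g = "?c powr \<gamma>"
    have g: "0 < ?g" "?g < 1" using powr_less_mono2[of \<gamma> "1 / 2" 1] \<gamma> by auto
    have step: "measure D {2 * v} = m" if v: "measure D {v} = m" for v
    proof -
      have "(\<integral>u. measure D {v - ?c * u} \<partial>D) \<le> m"
      proof (cases "integrable D (\<lambda>u. measure D {v - ?c * u})")
        case True
        then show ?thesis by (intro D.integral_le_const) (auto simp: m_le)
      next
        case False
        then show ?thesis using m by (simp add: not_integrable_integral_eq)
      qed
      then have "(1 - ?g) * (\<integral>u. measure D {v - ?c * u} \<partial>D) \<le> (1 - ?g) * m"
        using g by (intro mult_left_mono) auto
      then have "m \<le> ?g * measure D {2 * v} + (1 - ?g) * m"
        using Mittag_Leffler_decompose[OF D, of ?c v] \<gamma> v by (simp add: mult.commute)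
      then have "?g * m \<le> ?g * measure D {2 * v}" by (simp add: algebra_simps)
      then have "m \<le> measure D {2 * v}" using g(1) by (simp only: mult_le_cancel_left_pos)
      then show ?thesis using m_le[of "2 * v"] by simp
    qed
    have "measure D {2 ^ k * w} = m" for k :: nat
    proof (induction k)
      case (Suc k)
      then show ?case using step[of "2 ^ k * w"] by (simp add: mult.assoc)
    qed (simp add: w)
    then have "range (\<lambda>k::nat. 2 ^ k * w) \<subseteq> {v. m \<le> measure D {v}}" by auto
    then have "finite (range (\<lambda>k::nat. 2 ^ k * w))" using fin[OF m] finite_subset by blast
    moreover have "inj (\<lambda>k::nat. 2 ^ k * w)" using w0 by (auto simp: inj_def)
    ultimately show False using finite_imageD[of "\<lambda>k::nat. 2 ^ k * w" UNIV] by simp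
  qed
  then show ?thesis using ND[OF x] measure_nonneg[of N "{x}"] by simp
qed

section \<open>The conditional limit theorem\<close>

text \<open>
  Small exponents may be replaced by \<open>1 - exp\<close> of them in ratio limits.
\<close>
lemma tendsto_one_minus_exp:
  fixes a b :: "'a \<Rightarrow> real"
  assumes ab: "((\<lambda>t. a t / b t) \<longlongrightarrow> l) F" and b: "(b \<longlongrightarrow> 0) F" and l: "0 < l"
    and pos: "eventually (\<lambda>t. 0 < b t) F"
  shows "((\<lambda>t. (1 - exp (- a t)) / b t) \<longlongrightarrow> l) F"
proof -
  have a_pos: "eventually (\<lambda>t. 0 < a t) F"
    using order_tendstoD(1)[OF ab l] pos by eventually_elim (simp add: zero_less_divide_iff)
  have "((\<lambda>t. a t / b t * b t) \<longlongrightarrow> l * 0) F" by (intro tendsto_mult ab b)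
  then have "((\<lambda>t. a t / b t * b t) \<longlongrightarrow> 0) F" by simp
  then have "(a \<longlongrightarrow> 0) F"
    by (rule Lim_transform_eventually) (use pos in \<open>auto elim: eventually_mono\<close>)
  then have a0: "filterlim a (at_right 0) F"
    unfolding filterlim_at using a_pos by (auto elim: eventually_mono)
  have "((\<lambda>x::real. (1 - exp (- x)) / x) \<longlongrightarrow> 1) (at_right 0)" by real_asymp
  from filterlim_compose[OF this a0] have "((\<lambda>t. (1 - exp (- a t)) / a t) \<longlongrightarrow> 1) F" .
  then have "((\<lambda>t. (1 - exp (- a t)) / a t * (a t / b t)) \<longlongrightarrow> 1 * l) F"
    by (intro tendsto_mult ab)
  then have "((\<lambda>t. (1 - exp (- a t)) / a t * (a t / b t)) \<longlongrightarrow> l) F" by simp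
  then show ?thesis
    by (rule Lim_transform_eventually) (use a_pos in \<open>auto elim!: eventually_mono\<close>)
qed

lemma mean_le_1_of_critical:
  assumes "critical_offspring p" shows "(\<integral>\<^sup>+k. of_nat k \<partial>measure_pmf p) \<le> 1"
proof -
  have "(\<integral>\<^sup>+k. of_nat k \<partial>measure_pmf p) = (\<integral>\<^sup>+k. ennreal (real k) \<partial>measure_pmf p)"
    by (simp add: ennreal_of_nat_eq_real_of_nat)
  also have "\<dots> = ennreal (measure_pmf.expectation p real)"
    using assms unfolding critical_offspring_def by (intro nn_integral_eq_integral) auto
  finally show ?thesis using assms unfolding critical_offspring_def by simp
qed

context branching_process
begin

lemma bp_q_delay:
  assumes "0 \<le> s" "s < 1" "0 \<le> t"
  shows "bp_q \<mu> p h t s = bp_q \<mu> p h (t + G s / \<mu>) 0"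
  unfolding bp_q_def using F_eq_F_0[OF assms] by simp

text \<open>
  \<open>surv\<close> has index \<open>-1/\<gamma>\<close> and the generating function of the groups turns this into \<open>\<gamma> times (-1/\<gamma>) = -1\<close>.
\<close>
lemma index_minus_one_decay_bp_q:
  assumes L: "slowly_varying L" and \<gamma>: "0 < \<gamma>" and l: "slowly_varying l"
    and offspring: "\<And>s. 0 \<le> s \<Longrightarrow> s < 1 \<Longrightarrow> pgf p s = s + (1 - s) powr (\<gamma> + 1) * L (1 / (1 - s))"
    and immigrants: "\<And>s. 0 \<le> s \<Longrightarrow> s < 1 \<Longrightarrow> pgf h s = 1 - (1 - s) powr \<gamma> * l (1 / (1 - s))"
  shows "index_minus_one_decay (\<lambda>t. bp_q \<mu> p h t 0)"
proof -
  let ?\<psi> = "\<lambda>y. 1 - pgf h (1 - y)"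
  have q_eq: "bp_q \<mu> p h t 0 = ?\<psi> (surv t)" for t by (simp add: bp_q_def surv_def)
  have \<psi>_mono: "?\<psi> u \<le> ?\<psi> v" if "0 < u" "u \<le> v" "v \<le> 1" for u v
    using that by (auto intro!: pgf_mono)
  have \<psi>_eq: "?\<psi> y = y powr \<gamma> * l (1 / y)" if "0 < y" "y \<le> 1" for y
    using immigrants[of "1 - y"] that by simp
  have \<psi>_pos: "0 < ?\<psi> y" if y: "0 < y" "y \<le> 1" for y
  proof -
    obtain a where a: "\<And>x. a \<le> x \<Longrightarrow> 0 < l x" using l unfolding slowly_varying_def by blast
    define b where "b = max a (1 / y)"
    have b: "a \<le> b" "1 / y \<le> b" by (auto simp: b_def)
    have b0: "0 < b" using b(2) y by (smt (verit) zero_less_divide_1_iff)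
    have b_inv: "1 / b \<le> y" using b(2) b0 y by (simp add: field_simps)
    have "0 < (1 / b) powr \<gamma> * l (1 / (1 / b))" using a[OF b(1)] b0 by simp
    also have "\<dots> = ?\<psi> (1 / b)" by (rule \<psi>_eq[symmetric]) (use b0 order_trans[OF b_inv y(2)] in auto)
    also have "\<dots> \<le> ?\<psi> y" by (rule \<psi>_mono) (use b0 b_inv y in auto)
    finally show ?thesis .
  qed
  have \<psi>_rv: "((\<lambda>y. ?\<psi> (c * y) / ?\<psi> y) \<longlongrightarrow> c powr \<gamma>) (at_right 0)" if c: "0 < c" for c
  proof (rule Lim_transform_eventually[OF powr_slowly_varying_ratio[OF l c]])
    have "eventually (\<lambda>y. y \<in> {0<..<min 1 (1 / c)}) (at_right (0 :: real))"
      by (rule eventually_at_right_real) (use c in simp)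
    then show "eventually (\<lambda>y. (c * y) powr \<gamma> * l (1 / (c * y)) / (y powr \<gamma> * l (1 / y)) = ?\<psi> (c * y) / ?\<psi> y) (at_right 0)"
    proof eventually_elim
      case (elim y)
      then have "0 < c * y" "c * y \<le> 1" "0 < y" "y \<le> 1" using c by (auto simp: field_simps)
      then show ?case using \<psi>_eq[of y] \<psi>_eq[of "c * y"] by simp
    qed
  qed
  show ?thesis
  proof
    show "0 < bp_q \<mu> p h t 0" if "0 \<le> t" for t
      unfolding q_eq using that by (intro \<psi>_pos surv_pos surv_le_1)
    show "bp_q \<mu> p h t 0 \<le> bp_q \<mu> p h s 0" if "0 \<le> s" "s \<le> t" for s t
      unfolding q_eq using that by (intro \<psi>_mono surv_antimono surv_pos surv_le_1) auto
    show "continuous_on {0..b} (\<lambda>t. bp_q \<mu> p h t 0)" for b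
      unfolding bp_q_def
      by (intro continuous_intros continuous_on_compose2[OF continuous_on_pgf continuous_on_F])
         (use bp_F_bounds[OF \<mu>_pos, of 0 p] in auto)
    show "(\<lambda>t. bp_q \<mu> p h t 0) \<in> borel_measurable borel"
    proof -
      have [measurable]: "(\<lambda>t. F t 0) \<in> borel_measurable borel" by (rule measurable_bp_F[OF \<mu>_pos])
      show ?thesis unfolding bp_q_def pgf_def by measurable
    qed
    fix c :: real assume c: "0 < c"
    have "((\<lambda>t. ?\<psi> (surv (c * t)) / ?\<psi> (surv t)) \<longlongrightarrow> (c powr (- 1 / \<gamma>)) powr \<gamma>) at_top"
    proof (rule monotone_regular_variation[where w="?\<psi>" and \<phi>="?\<psi>" and \<rho>="\<lambda>c. c powr \<gamma>" and c="c powr (- 1 / \<gamma>)"])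
      show "((\<lambda>t. surv (c * t) / surv t) \<longlongrightarrow> c powr (- 1 / \<gamma>)) at_top"
        by (rule surv_ratio[OF L \<gamma> offspring c])
      show "isCont (\<lambda>c. c powr \<gamma>) (c powr (- 1 / \<gamma>))" using c by (intro continuous_intros) auto
    qed (use c \<psi>_mono \<psi>_pos \<psi>_rv surv_at_right_0 in auto)
    also have "(c powr (- 1 / \<gamma>)) powr \<gamma> = c powr (- 1)"
      by (subst powr_powr) (use \<gamma> in simp)
    also have "\<dots> = 1 / c" using c by (simp add: powr_minus_divide)
    finally show "((\<lambda>t. bp_q \<mu> p h (c * t) 0 / bp_q \<mu> p h t 0) \<longlongrightarrow> 1 / c) at_top"
      unfolding q_eq .
  qed
qed

end

text \<open>
  The event \<open>Y = 0\<close> has probability \<open>E 0^Y\<close>, so the conditional Laplace transform is expressed by the generating function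
  of \<open>Y\<close>.
\<close>
lemma (in prob_space) conditional_law:
  fixes Y :: "'a \<Rightarrow> nat" and c :: real
  assumes Y[measurable]: "Y \<in> M \<rightarrow>\<^sub>M count_space UNIV" and c: "0 < c"
    and pos: "0 < \<P>(\<omega> in M. 0 < Y \<omega>)"
  defines "N \<equiv> distr (uniform_measure M {\<omega> \<in> space M. 0 < Y \<omega>}) borel (\<lambda>\<omega>. real (Y \<omega>) * c)"
  shows "real_distribution N" "measure N {..<0} = 0"
    "cdf N x = \<P>(\<omega> in M. real (Y \<omega>) * c \<le> x \<bar> 0 < Y \<omega>)"
    "0 < y \<Longrightarrow> (\<integral>x. exp (- y * x) \<partial>N) =
       1 - (1 - expectation (\<lambda>\<omega>. exp (- y * c) ^ Y \<omega>)) / (1 - expectation (\<lambda>\<omega>. 0 ^ Y \<omega>))"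
proof -
  let ?A = "{\<omega> \<in> space M. 0 < Y \<omega>}"
  have em: "emeasure M ?A = ennreal (prob ?A)" by (rule emeasure_eq_measure)
  have A[measurable]: "?A \<in> events" by measurable
  interpret U: prob_space "uniform_measure M ?A"
    by (rule prob_space_uniform_measure) (use pos em in auto)
  have Xm[measurable]: "(\<lambda>\<omega>. real (Y \<omega>) * c) \<in> borel_measurable M" by measurable
  show "real_distribution N"
    unfolding N_def by (rule U.real_distribution_distr) measurable
  have mN: "measure N B = measure M (?A \<inter> {\<omega> \<in> space M. real (Y \<omega>) * c \<in> B}) / prob ?A"
    if [measurable]: "B \<in> sets borel" for B
  proof -
    have "measure N B = measure (uniform_measure M ?A) {\<omega> \<in> space M. real (Y \<omega>) * c \<in> B}"
      unfolding N_def by (subst measure_distr) (auto intro!: arg_cong2[where f=measure])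
    also have "\<dots> = measure M (?A \<inter> {\<omega> \<in> space M. real (Y \<omega>) * c \<in> B}) / prob ?A"
      by (rule measure_uniform_measure) (use pos em in auto)
    finally show ?thesis .
  qed
  have "?A \<inter> {\<omega> \<in> space M. real (Y \<omega>) * c \<in> {..<0}} = {}"
    using c by (auto simp: mult_less_0_iff)
  then show "measure N {..<0} = 0" by (simp only: mN[OF lessThan_borel]) simp
  show "cdf N x = \<P>(\<omega> in M. real (Y \<omega>) * c \<le> x \<bar> 0 < Y \<omega>)"
  proof -
    have "?A \<inter> {\<omega> \<in> space M. real (Y \<omega>) * c \<in> {..x}} = {\<omega> \<in> space M. real (Y \<omega>) * c \<le> x \<and> 0 < Y \<omega>}" by auto
    then show ?thesis unfolding cdf_def cond_prob_def by (simp only: mN[OF atMost_borel])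
  qed
  assume y: "0 < y"
  let ?s = "exp (- y * c)"
  have s: "0 \<le> ?s" "?s \<le> 1" using y c by auto
  have i: "integrable M (\<lambda>\<omega>. z ^ Y \<omega>)" if "0 \<le> z" "z \<le> 1" for z :: real
    by (rule integrable_const_bound[where B=1]) (use that in \<open>auto simp: power_le_one\<close>)
  have i0: "integrable M (\<lambda>\<omega>. (0::real) ^ Y \<omega>)" by (rule i) auto
  have P0: "prob ?A = 1 - expectation (\<lambda>\<omega>. 0 ^ Y \<omega>)"
  proof -
    have "prob ?A = expectation (indicator ?A)" by simp
    also have "\<dots> = expectation (\<lambda>\<omega>. 1 - 0 ^ Y \<omega>)"
      by (rule Bochner_Integration.integral_cong) (auto simp: indicator_def power_0_left)
    also have "\<dots> = 1 - expectation (\<lambda>\<omega>. 0 ^ Y \<omega>)"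
      by (subst Bochner_Integration.integral_diff) (use i0 prob_space in auto)
    finally show ?thesis .
  qed
  have "(\<integral>x. exp (- y * x) \<partial>N) = (\<integral>\<omega>. ?s ^ Y \<omega> \<partial>uniform_measure M ?A)"
    unfolding N_def by (subst integral_distr) (auto simp: exp_of_nat_mult[symmetric] ac_simps)
  also have "\<dots> = (\<integral>\<omega>. (indicator ?A \<omega> / prob ?A) *\<^sub>R ?s ^ Y \<omega> \<partial>M)"
  proof -
    have "uniform_measure M ?A = density M (\<lambda>\<omega>. ennreal (indicator ?A \<omega> / prob ?A))"
      unfolding uniform_measure_def em
      by (intro density_cong) (use pos divide_ennreal[of 1 "prob ?A"] in \<open>auto simp: indicator_def\<close>)
    then show ?thesis
      by (simp only:) (rule integral_density, use pos in auto)
  qed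
  also have "\<dots> = expectation (\<lambda>\<omega>. (?s ^ Y \<omega> - 0 ^ Y \<omega>) / prob ?A)"
    by (rule Bochner_Integration.integral_cong) (auto simp: indicator_def power_0_left)
  also have "\<dots> = (expectation (\<lambda>\<omega>. ?s ^ Y \<omega>) - expectation (\<lambda>\<omega>. 0 ^ Y \<omega>)) / prob ?A"
    by (simp only: integral_divide_zero Bochner_Integration.integral_diff[OF i[OF s] i0])
  also have "\<dots> = 1 - (1 - expectation (\<lambda>\<omega>. ?s ^ Y \<omega>)) / prob ?A"
    using pos by (simp add: P0 field_simps)
  finally show "(\<integral>x. exp (- y * x) \<partial>N) =
       1 - (1 - expectation (\<lambda>\<omega>. ?s ^ Y \<omega>)) / (1 - expectation (\<lambda>\<omega>. 0 ^ Y \<omega>))"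
    unfolding P0 .
qed

theorem theorem5p3:
  fixes M :: "'a measure"
    and \<mu> \<gamma> \<alpha> \<theta> d :: real
    and p h :: "nat pmf"
    and L l L\<^sub>R r :: "real \<Rightarrow> real"
    and R_inf :: ereal
    and \<nu> :: "real \<Rightarrow> 'a \<Rightarrow> nat"
    and I :: "nat \<Rightarrow> 'a \<Rightarrow> nat"
    and \<tau> :: "nat \<Rightarrow> nat \<Rightarrow> 'a \<Rightarrow> family_tree"
  assumes model: "bp_poisson_immigration M r \<nu> \<mu> p h \<tau> I"
    and critical: "critical_offspring p"
    and \<gamma>: "0 < \<gamma>" "\<gamma> \<le> 1"
    and L: "slowly_varying L"
    and offspring: "\<And>s. 0 \<le> s \<Longrightarrow> s < 1 \<Longrightarrow> pgf p s = s + (1 - s) powr (\<gamma> + 1) * L (1 / (1 - s))"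
    and \<alpha>: "0 < \<alpha>" "\<alpha> \<le> 1"
    and l: "slowly_varying l"
    and immigrants: "\<And>s. 0 \<le> s \<Longrightarrow> s < 1 \<Longrightarrow> pgf h s = 1 - (1 - s) powr \<alpha> * l (1 / (1 - s))"
    and L\<^sub>R: "slowly_varying L\<^sub>R"
    and intensity: "\<And>t. 0 < t \<Longrightarrow> r t = t powr (- \<theta>) * L\<^sub>R t"
    and "\<theta> = 1"
    and "\<alpha> = \<gamma>"
    and R: "mono_on {0..} (mean_measure r)"
           "((\<lambda>t. ereal (mean_measure r t)) \<longlongrightarrow> R_inf) at_top"
    and Q: "mono_on {0..} (bp_Q \<mu> p h)" "filterlim (bp_Q \<mu> p h) at_top at_top"
    and "0 \<le> d"
    and ratio: "((\<lambda>t. (r t * bp_Q \<mu> p h t) / (bp_q \<mu> p h t 0 * mean_measure r t)) \<longlongrightarrow> d) at_top"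
  shows "(\<exists>!N. limit_law \<gamma> d N) \<and>
    (\<forall>N x. limit_law \<gamma> d N \<longrightarrow> 0 < x \<longrightarrow>
      ((\<lambda>t. \<P>(\<omega> in M. real (bp_Y \<nu> I \<tau> t \<omega>) / bp_W p (\<mu> * t) \<le> x \<bar> 0 < bp_Y \<nu> I \<tau> t \<omega>))
         \<longlongrightarrow> cdf N x) at_top)"
proof -
  interpret model: bp_poisson_immigration M r \<nu> \<mu> p h \<tau> I by (rule model)
  interpret branching: branching_process \<mu> p
    by standard (use model.\<mu>_pos mean_le_1_of_critical[OF critical] pgf_gt_self[OF L offspring] in auto)
  interpret intensity: index_minus_one_intensity r L\<^sub>R
  proof
    show "r t = L\<^sub>R t / t" if "0 < t" for t
      using intensity[OF that] that \<open>\<theta> = 1\<close> by (simp add: powr_minus_divide)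
  qed (use L\<^sub>R model.intensity_nonneg model.intensity_integrable in auto)
  interpret decay: index_minus_one_decay "\<lambda>t. bp_q \<mu> p h t 0"
    by (rule branching.index_minus_one_decay_bp_q[OF L \<gamma>(1) l offspring])
       (use immigrants \<open>\<alpha> = \<gamma>\<close> in auto)
  interpret input: poisson_input r L\<^sub>R "\<lambda>t. bp_q \<mu> p h t 0" ..
  let ?Y = "bp_Y \<nu> I \<tau>"
  let ?surv = "branching.surv"
  let ?J = "input.J"
  let ?qR = "\<lambda>t. bp_q \<mu> p h t 0 * mean_measure r t"
  have Q_eq: "decay.Q = bp_Q \<mu> p h"
    by (simp add: fun_eq_iff decay.Q_def bp_Q_def)
  have Q_inf: "filterlim decay.Q at_top at_top" using Q(2) by (simp only: Q_eq)
  have ratio': "((\<lambda>t. (r t * decay.Q t) / ?qR t) \<longlongrightarrow> d) at_top" using ratio by (simp only: Q_eq)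

  have pgf_Y: "model.expectation (\<lambda>\<omega>. s ^ ?Y t \<omega>) = exp (- ?J (branching.G s / \<mu>) t)"
    if "0 < t" "0 \<le> s" "s < 1" for s t
  proof -
    have "(LBINT u:{0..t}. r u * bp_q \<mu> p h (t - u) s) = ?J (branching.G s / \<mu>) t"
      unfolding input.J_def
      by (rule set_lebesgue_integral_cong) (use that branching.bp_q_delay[of s] in auto)
    moreover have "model.expectation (\<lambda>\<omega>. s ^ ?Y t \<omega>) = exp (- (LBINT u:{0..t}. r u * bp_q \<mu> p h (t - u) s))"
      by (rule model.expectation_bp_Y_power) (use that branching.continuous_on_F[of s t] in auto)
    ultimately show ?thesis by simp
  qed

  have qR_pos: "eventually (\<lambda>t. 0 < ?qR t) at_top"
    using intensity.R_eventually_pos eventually_ge_at_top[of 0]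
    by eventually_elim (use decay.q_pos in auto)
  have J0: "((\<lambda>t. ?J 0 t / ?qR t) \<longlongrightarrow> 1 + d) at_top"
    by (rule input.J_0_asymp[OF Q_inf ratio'])
  have J0': "((\<lambda>t. (1 - exp (- ?J 0 t)) / ?qR t) \<longlongrightarrow> 1 + d) at_top"
    by (rule tendsto_one_minus_exp[OF J0 input.qR_tendsto_0 _ qR_pos]) (use \<open>0 \<le> d\<close> in simp)
  have LT_lim: "((\<lambda>t. 1 - (1 - exp (- ?J (branching.G (exp (- y * ?surv t)) / \<mu>) t)) / (1 - exp (- ?J 0 t)))
      \<longlongrightarrow> 1 - 1 / (1 + d) * (y powr \<gamma> / (1 + y powr \<gamma>))) at_top" if y: "0 < y" for y
  proof -
    let ?c = "\<lambda>t. branching.G (exp (- y * ?surv t)) / \<mu>"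
    have k: "0 < y powr (- \<gamma>)" using y by simp
    have "((\<lambda>t. ?J (?c t) t / ?qR t) \<longlongrightarrow> 1 / (1 + y powr (- \<gamma>))) at_top"
      by (rule input.J_delayed_asymp[OF branching.delay_ratio[OF L \<gamma>(1) offspring y] k])
    then have "((\<lambda>t. (1 - exp (- ?J (?c t) t)) / ?qR t) \<longlongrightarrow> 1 / (1 + y powr (- \<gamma>))) at_top"
      by (rule tendsto_one_minus_exp[OF _ input.qR_tendsto_0 _ qR_pos]) (use k in \<open>simp add: add_pos_pos\<close>)
    then have "((\<lambda>t. 1 - ((1 - exp (- ?J (?c t) t)) / ?qR t) / ((1 - exp (- ?J 0 t)) / ?qR t))
        \<longlongrightarrow> 1 - (1 / (1 + y powr (- \<gamma>))) / (1 + d)) at_top"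
      by (rule tendsto_diff[OF tendsto_const tendsto_divide[OF _ J0']]) (use \<open>0 \<le> d\<close> in simp)
    moreover have "1 - (1 / (1 + y powr (- \<gamma>))) / (1 + d) = 1 - 1 / (1 + d) * (y powr \<gamma> / (1 + y powr \<gamma>))"
    proof -
      have "0 < y powr \<gamma>" using y by simp
      then have "1 / (1 + y powr (- \<gamma>)) = y powr \<gamma> / (1 + y powr \<gamma>)"
        by (simp add: powr_minus field_simps)
      then show ?thesis by simp
    qed
    ultimately have "((\<lambda>t. 1 - ((1 - exp (- ?J (?c t) t)) / ?qR t) / ((1 - exp (- ?J 0 t)) / ?qR t))
        \<longlongrightarrow> 1 - 1 / (1 + d) * (y powr \<gamma> / (1 + y powr \<gamma>))) at_top" by simp
    then show ?thesis
    proof (rule Lim_transform_eventually)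
      show "eventually (\<lambda>t. 1 - ((1 - exp (- ?J (?c t) t)) / ?qR t) / ((1 - exp (- ?J 0 t)) / ?qR t)
        = 1 - (1 - exp (- ?J (?c t) t)) / (1 - exp (- ?J 0 t))) at_top"
        using qR_pos
      proof eventually_elim
        case (elim t)
        have cancel: "(a / k) / (b / k) = a / b" if "k \<noteq> 0" for a b k :: real using that by simp
        from elim have k: "?qR t \<noteq> 0" by linarith
        show ?case by (simp only: cancel[OF k])
      qed
    qed
  qed

  have Y_meas: "?Y t \<in> M \<rightarrow>\<^sub>M count_space UNIV" if "0 < t" for t
    by (rule model.measurable_bp_Y) (use that in simp)
  have prob_pos: "\<P>(\<omega> in M. 0 < ?Y t \<omega>) = 1 - exp (- ?J 0 t)" if t: "0 < t" for t
  proof -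
    note [measurable] = Y_meas[OF t]
    have "\<P>(\<omega> in M. 0 < ?Y t \<omega>) = model.expectation (indicator {\<omega> \<in> space M. 0 < ?Y t \<omega>})" by simp
    also have "\<dots> = model.expectation (\<lambda>\<omega>. 1 - 0 ^ ?Y t \<omega>)"
      by (rule Bochner_Integration.integral_cong) (auto simp: indicator_def power_0_left)
    also have "\<dots> = 1 - model.expectation (\<lambda>\<omega>. 0 ^ ?Y t \<omega>)"
      by (subst Bochner_Integration.integral_diff)
         (auto simp: model.prob_space power_0_left intro!: model.integrable_const_bound[where B=1])
    finally show ?thesis using pgf_Y[OF t, of 0] by simp
  qed
  have "eventually (\<lambda>t. 0 < ?J 0 t / ?qR t) at_top"
    by (rule order_tendstoD(1)[OF J0]) (use \<open>0 \<le> d\<close> in simp)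
  then have "eventually (\<lambda>t. 0 < ?J 0 t) at_top"
    using qR_pos
  proof eventually_elim
    case (elim t)
    then show ?case by (simp only: zero_less_divide_iff) (use elim in linarith)
  qed
  then have "eventually (\<lambda>t. 0 < t \<and> 0 < \<P>(\<omega> in M. 0 < ?Y t \<omega>)) at_top"
    using eventually_gt_at_top[of 0] by eventually_elim (simp add: prob_pos)
  then obtain T where T: "\<And>t. T \<le> t \<Longrightarrow> 0 < t \<and> 0 < \<P>(\<omega> in M. 0 < ?Y t \<omega>)"
    unfolding eventually_at_top_linorder by blast

  let ?P = "\<lambda>t x. \<P>(\<omega> in M. real (?Y t \<omega>) / bp_W p (\<mu> * t) \<le> x \<bar> 0 < ?Y t \<omega>)"
  have along: "\<exists>N. limit_law \<gamma> d N \<and> (\<forall>x. measure N {x} = 0 \<longrightarrow> (\<lambda>n. ?P (X n) x) \<longlonglongrightarrow> cdf N x)"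
    if X: "filterlim X at_top sequentially" for X :: "nat \<Rightarrow> real"
  proof -
    \<comment> \<open>Conditioning is possible only from \<open>T\<close> on; the limit does not see the change.\<close>
    define X' where "X' n = max T (X n)" for n
    have X'T: "T \<le> X' n" for n by (simp add: X'_def)
    have X'0: "0 < X' n" for n using T[OF X'T] by simp
    have X': "filterlim X' at_top sequentially"
      by (rule filterlim_at_top_mono[OF X]) (simp add: X'_def)
    have X_eq: "eventually (\<lambda>n. X' n = X n) sequentially"
      using filterlim_at_top[THEN iffD1, OF X, rule_format, of T] by eventually_elim (simp add: X'_def)
    have surv0: "0 < ?surv (X' n)" for n using X'0[of n] by (intro branching.surv_pos) simp
    define N where "N n = distr (uniform_measure M {\<omega> \<in> space M. 0 < ?Y (X' n) \<omega>}) borel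
        (\<lambda>\<omega>. real (?Y (X' n) \<omega>) * ?surv (X' n))" for n
    note pos = conjunct2[OF T[OF X'T]]
    have N_dist: "real_distribution (N n)" for n
      unfolding N_def by (rule model.conditional_law(1)[OF Y_meas[OF X'0] surv0 pos])
    have N_nonneg: "measure (N n) {..<0} = 0" for n
      unfolding N_def by (rule model.conditional_law(2)[OF Y_meas[OF X'0] surv0 pos])
    have cdf_N: "cdf (N n) x = ?P (X' n) x" for n x
    proof -
      have "cdf (N n) x = \<P>(\<omega> in M. real (?Y (X' n) \<omega>) * ?surv (X' n) \<le> x \<bar> 0 < ?Y (X' n) \<omega>)"
        unfolding N_def by (rule model.conditional_law(3)[OF Y_meas[OF X'0] surv0 pos])
      then show ?thesis using branching.bp_W_eq[of "X' n"] X'0[of n] by simp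
    qed
    have LT_N: "(\<lambda>n. \<integral>x. exp (- y * x) \<partial>N n) \<longlonglongrightarrow> 1 - 1 / (1 + d) * (y powr \<gamma> / (1 + y powr \<gamma>))"
      if y: "0 < y" for y
    proof -
      have "(\<integral>x. exp (- y * x) \<partial>N n) =
        1 - (1 - exp (- ?J (branching.G (exp (- y * ?surv (X' n))) / \<mu>) (X' n))) / (1 - exp (- ?J 0 (X' n)))" for n
      proof -
        have "(\<integral>x. exp (- y * x) \<partial>N n) =
          1 - (1 - model.expectation (\<lambda>\<omega>. exp (- y * ?surv (X' n)) ^ ?Y (X' n) \<omega>)) /
            (1 - model.expectation (\<lambda>\<omega>. 0 ^ ?Y (X' n) \<omega>))"
          unfolding N_def by (rule model.conditional_law(4)[OF Y_meas[OF X'0] surv0 pos y])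
        then show ?thesis
          using pgf_Y[OF X'0[of n], of "exp (- y * ?surv (X' n))"] pgf_Y[OF X'0[of n], of 0] surv0[of n] y
          by simp
      qed
      then show ?thesis using filterlim_compose[OF LT_lim[OF y] X'] by simp
    qed
    obtain N' where N': "real_distribution N'" "measure N' {..<0} = 0"
        "\<And>y. 0 < y \<Longrightarrow> (\<integral>x. exp (- y * x) \<partial>N') = 1 - 1 / (1 + d) * (y powr \<gamma> / (1 + y powr \<gamma>))"
        "weak_conv_m N N'"
      using laplace_continuity[OF N_dist N_nonneg LT_N Mittag_Leffler_LT_at_0[OF \<gamma>(1)]] by blast
    interpret N': real_distribution N' by fact
    have "limit_law \<gamma> d N'"
      unfolding limit_law_def using N' \<open>0 \<le> d\<close> by (simp only: limit_law_LT) auto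
    moreover have "(\<lambda>n. ?P (X n) x) \<longlonglongrightarrow> cdf N' x" if "measure N' {x} = 0" for x
    proof -
      have "(\<lambda>n. cdf (N n) x) \<longlonglongrightarrow> cdf N' x"
        using N'(4) that N'.isCont_cdf unfolding weak_conv_m_def weak_conv_def by blast
      then have "(\<lambda>n. ?P (X' n) x) \<longlonglongrightarrow> cdf N' x" unfolding cdf_N .
      then show ?thesis
        by (rule Lim_transform_eventually) (use X_eq in \<open>auto elim: eventually_mono\<close>)
    qed
    ultimately show ?thesis by blast
  qed
  have "\<exists>N. limit_law \<gamma> d N" using along[OF filterlim_real_sequentially] by blast
  then have "\<exists>!N. limit_law \<gamma> d N" using limit_law_unique by blast
  moreover have "((\<lambda>t. ?P t x) \<longlongrightarrow> cdf N x) at_top" if N: "limit_law \<gamma> d N" and x: "0 < x" for N x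
  proof (rule tendsto_at_topI_sequentially)
    fix X :: "nat \<Rightarrow> real" assume "filterlim X at_top sequentially"
    then obtain N' where "limit_law \<gamma> d N'" "measure N' {x} = 0 \<Longrightarrow> (\<lambda>n. ?P (X n) x) \<longlonglongrightarrow> cdf N' x"
      using along by blast
    moreover have "N' = N" using limit_law_unique calculation(1) N by blast
    ultimately show "(\<lambda>n. ?P (X n) x) \<longlonglongrightarrow> cdf N x"
      using limit_law_no_atom[OF N \<open>0 \<le> d\<close> \<gamma>(1) x] by simp
  qed
  ultimately show ?thesis by blast
qed

end
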